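(* Let $\mu,\nu$ be compactly supported probability measures on $\mathbb{R}$ such that $\mu$ is non-degenerate. Then: (a) If $F_{\mu,\nu}$ has a critical point, then $h^*_{\mu,\nu}$ is the leftmost critical point. (b) If $F_{\mu,\nu}$ has no critical points, then $h^*_{\mu,\nu}=\sup\operatorname{dom}(F_{\mu,\nu})$. (c) If $F_{\mu,\nu}$ has no critical points, then furthermore (i) $h^*_{\mu,\nu}=\operatorname{supp}_-\nu$ and $g^*_{\mu\boxplus\nu}=G_\nu(\operatorname{supp}_-\nu)$, or (ii) $G_\mu(\operatorname{supp}_-\mu)=G_\nu(h^*_{\mu,\nu})=g^*_{\mu\boxplus\nu}$. (d) If there are constants $c_1,c_2>0$ such that $c_1^{-1}\varepsilon^{3/2}\le(\mu\boxplus\nu)\big((z^*_{\mu\boxplus\nu},z^*_{\mu\boxplus\nu}+\varepsilon)\big)\le c_1\varepsilon^{3/2}$ for all $\varepsilon\in(0,c_2)$, then $h^*_{\mu,\nu}$ is a local maximum of $F_{\mu,\nu}$. (e) If $F_{\mu,\nu}$ is strictly concave, then $h^*_{\mu,\nu}$ is the global maximum of $F_{\mu,\nu}$, and $$z^*_{\mu\boxplus\nu}=\sup_{h\in\operatorname{dom}(F_{\mu,\nu})}F_{\mu,\nu}(h),\qquad g^*_{\mu\boxplus\nu}=G_\nu\Big(\underset{h\in\operatorname{dom}(F_{\mu,\nu})}{\operatorname{argsup}}F_{\mu,\nu}(h)\Big).$$ (f) The equation $F_{\mu,\nu}(h)=z$ has a solution in $\operatorname{dom}(F_{\mu,\nu})\cap(-\infty,h^*_{\mu,\nu})$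 if and only if $z<z^*_{\mu\boxplus\nu}$. If $z<z^*_{\mu\boxplus\nu}$ then $h^<_{\mu,\nu}(z)$ is the unique solution in that set, and $G_{\mu\boxplus\nu}(z)=G_\nu(h^<_{\mu,\nu}(z))$.
   Context: For a compactly supported probability measure $\rho$ on $\mathbb{R}$: $\operatorname{supp}_-\rho$ and $\operatorname{supp}_+\rho$ are the infimum and supremum of its support; $\rho$ is non-degenerate if it is not a Dirac mass. $G_\rho(z)=\int\frac{\rho(d\lambda)}{\lambda-z}$ (note the sign). On the real line, $G_\rho$ is strictly increasing and positive on $(-\infty,\operatorname{supp}_-\rho)$, strictly increasing and negative on $(\operatorname{supp}_+\rho,\infty)$; set $G_\rho(\operatorname{supp}_-\rho)=\lim_{z\uparrow\operatorname{supp}_-\rho}G_\rho(z)\in(0,\infty]$ and $G_\rho(\operatorname{supp}_+\rho)=\lim_{z\downarrow\operatorname{supp}_+\rho}G_\rho(z)\in[-\infty,0)$. $G_\rho^{\langle-1\rangle}$ is the inverse of $G_\rho$ restricted to $\mathbb{R}\setminus[\operatorname{supp}_-\rho,\operatorname{supp}_+\rho]$. Let $\hat D_\rho=(-G_\rho(\operatorname{supp}_-\rho),-G_\rho(\operatorname{supp}_+\rho))$, and $\hat R_\rho(t)=G_\rho^{\langle-1\rangle}(-t)-t^{-1}$ for $t\in\hat D_\rho\setminus\{0\}$. The real $R$-transform $R_\rho:D_\rho\to\mathbb{R}$ is the unique real analytic extension of $\hat R_\rho$ to a maximal open interval $D_\rho\supset\hat D_\rho$ (so $0\in D_\rho$).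 The free additive convolution $\mu\boxplus\nu$ is the unique compactly supported probability measure with $D_\mu\cap D_\nu\subset D_{\mu\boxplus\nu}$ and $R_{\mu\boxplus\nu}=R_\mu+R_\nu$ on $D_\mu\cap D_\nu$. $z^*_{\mu\boxplus\nu}=\operatorname{supp}_-(\mu\boxplus\nu)$ and $g^*_{\mu\boxplus\nu}=G_{\mu\boxplus\nu}(z^*_{\mu\boxplus\nu})\in(0,\infty]$. $F_{\mu,\nu}(h)=R_\mu(-G_\nu(h))+h$ for $h\in\operatorname{dom}(F_{\mu,\nu})=\{h\in(-\infty,\operatorname{supp}_-\nu):G_\nu(h)\in-D_\mu\}$, which is an open interval unbounded to the left. $\mathcal{H}_{\mu,\nu}=\{h\in\operatorname{dom}(F_{\mu,\nu}):F'_{\mu,\nu}(t)>0\ \forall t\in(-\infty,h)\}$ and $h^*_{\mu,\nu}=\sup\mathcal{H}_{\mu,\nu}$. $h^<_{\mu,\nu}(z)$ is the leftmost solution of $F_{\mu,\nu}(h)=z$ in $\operatorname{dom}(F_{\mu,\nu})$ if a solution exists, and otherwise $h^<_{\mu,\nu}(z)=\sup\operatorname{dom}(F_{\mu,\nu})$. Convention: if a point (such as $h^*_{\mu,\nu}$) equals the right endpoint $\sup\operatorname{dom}(F_{\mu,\nu})$, which is not in the open domain, then $F_{\mu,\nu}$ at that point denotes the limit from the left, and statements that the point is a (local or global) maximum or the argsup of $F_{\mu,\nu}$ are understood for $F_{\mu,\nu}$ extended to the endpoint by this limit; $G_\nu$ at $\operatorname{supp}_-\nu$ likewise denotes the left limit.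 *)

theory Defs
  imports "HOL-Probability.Probability"
begin

definition measure_support :: "real measure \<Rightarrow> real set" where
  "measure_support \<rho> = {x. \<forall>U. open U \<and> x \<in> U \<longrightarrow> emeasure \<rho> U > 0}"

definition compactly_supported_prob :: "real measure \<Rightarrow> bool" where
  "compactly_supported_prob \<rho> \<longleftrightarrow>
     prob_space \<rho> \<and> sets \<rho> = sets borel \<and> compact (measure_support \<rho>)"

definition non_degenerate :: "real measure \<Rightarrow> bool" where
  "non_degenerate \<rho> \<longleftrightarrow> \<not> (\<exists>a. \<rho> = return borel a)"

definition supp_minus :: "real measure \<Rightarrow> real" where
  "supp_minus \<rho> = Inf (measure_support \<rho>)"

definition supp_plus :: "real measure \<Rightarrow> real" where
  "supp_plus \<rho> = Sup (measure_support \<rho>)"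

text \<open>The sign convention is opposite to the usual Cauchy transform.  Only real arguments
  outside the convex hull of the support are used.\<close>

definition stieltjes :: "real measure \<Rightarrow> real \<Rightarrow> real" where
  "stieltjes \<rho> z = (\<integral>x. 1 / (x - z) \<partial>\<rho>)"

text \<open>Extended-real versions that include one edge of the support, where the value is the
  one-sided limit from outside and may be infinite.  There are two functions because for a Dirac
  mass both edges coincide while the two limits differ.  The first one is meaningful for
  \<open>z \<le> supp_minus \<rho>\<close>, the second one for \<open>z \<ge> supp_plus \<rho>\<close>.\<close>

definition stieltjes_left :: "real measure \<Rightarrow> real \<Rightarrow> ereal" where
  "stieltjes_left \<rho> z =
     (if z < supp_minus \<rho> then ereal (stieltjes \<rho> z)
      else Lim (at_left (supp_minus \<rho>)) (\<lambda>x. ereal (stieltjes \<rho> x)))"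

definition stieltjes_right :: "real measure \<Rightarrow> real \<Rightarrow> ereal" where
  "stieltjes_right \<rho> z =
     (if supp_plus \<rho> < z then ereal (stieltjes \<rho> z)
      else Lim (at_right (supp_plus \<rho>)) (\<lambda>x. ereal (stieltjes \<rho> x)))"

definition stieltjes_inv :: "real measure \<Rightarrow> real \<Rightarrow> real" where
  "stieltjes_inv \<rho> = inv_into (- {supp_minus \<rho>..supp_plus \<rho>}) (stieltjes \<rho>)"

definition Rhat_domain :: "real measure \<Rightarrow> real set" where
  "Rhat_domain \<rho> = {t. - stieltjes_left \<rho> (supp_minus \<rho>) < ereal t \<and>
                       ereal t < - stieltjes_right \<rho> (supp_plus \<rho>)}"

definition Rhat :: "real measure \<Rightarrow> real \<Rightarrow> real" where
  "Rhat \<rho> t = stieltjes_inv \<rho> (- t) - 1 / t"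

definition real_analytic_on :: "(real \<Rightarrow> real) \<Rightarrow> real set \<Rightarrow> bool" where
  "real_analytic_on f S \<longleftrightarrow>
     (\<forall>x\<in>S. \<exists>r>0. \<exists>a. \<forall>y. \<bar>y - x\<bar> < r \<longrightarrow> (\<lambda>n. a n * (y - x) ^ n) sums f y)"

definition R_extension :: "real measure \<Rightarrow> real set \<Rightarrow> (real \<Rightarrow> real) \<Rightarrow> bool" where
  "R_extension \<rho> I f \<longleftrightarrow>
     open I \<and> is_interval I \<and> Rhat_domain \<rho> \<subseteq> I \<and> real_analytic_on f I \<and>
     (\<forall>t \<in> Rhat_domain \<rho> - {0}. f t = Rhat \<rho> t)"

text \<open>Any two such extensions agree on the intersection of their intervals by the identity
  theorem, so the union of all these intervals is the maximal one, and the values of an extension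
  to it are unique there.  The values of \<open>R_transform \<rho>\<close> outside \<open>R_domain \<rho>\<close> are irrelevant.\<close>

definition R_domain :: "real measure \<Rightarrow> real set" where
  "R_domain \<rho> = \<Union> {I. \<exists>f. R_extension \<rho> I f}"

definition R_transform :: "real measure \<Rightarrow> real \<Rightarrow> real" where
  "R_transform \<rho> = (SOME f. R_extension \<rho> (R_domain \<rho>) f)"

text \<open>\<open>is_free_convolution \<mu> \<nu> \<rho>\<close> says that \<open>\<rho>\<close> is the free additive convolution of \<open>\<mu>\<close> and \<open>\<nu>\<close>.
  For compactly supported probability measures \<open>\<mu>\<close> and \<open>\<nu>\<close>, exactly one \<open>\<rho>\<close> satisfies it.\<close>

definition is_free_convolution :: "real measure \<Rightarrow> real measure \<Rightarrow> real measure \<Rightarrow> bool" where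
  "is_free_convolution \<mu> \<nu> \<rho> \<longleftrightarrow>
     compactly_supported_prob \<rho> \<and>
     R_domain \<mu> \<inter> R_domain \<nu> \<subseteq> R_domain \<rho> \<and>
     (\<forall>t \<in> R_domain \<mu> \<inter> R_domain \<nu>. R_transform \<rho> t = R_transform \<mu> t + R_transform \<nu> t)"

definition zstar :: "real measure \<Rightarrow> real" where
  "zstar \<rho> = supp_minus \<rho>"

definition gstar :: "real measure \<Rightarrow> ereal" where
  "gstar \<rho> = stieltjes_left \<rho> (zstar \<rho>)"

definition domF :: "real measure \<Rightarrow> real measure \<Rightarrow> real set" where
  "domF \<mu> \<nu> = {h. h < supp_minus \<nu> \<and> - stieltjes \<nu> h \<in> R_domain \<mu>}"

definition F :: "real measure \<Rightarrow> real measure \<Rightarrow> real \<Rightarrow> real" where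
  "F \<mu> \<nu> h = R_transform \<mu> (- stieltjes \<nu> h) + h"

definition critical_point :: "real measure \<Rightarrow> real measure \<Rightarrow> real \<Rightarrow> bool" where
  "critical_point \<mu> \<nu> h \<longleftrightarrow> h \<in> domF \<mu> \<nu> \<and> deriv (F \<mu> \<nu>) h = 0"

definition Hset :: "real measure \<Rightarrow> real measure \<Rightarrow> real set" where
  "Hset \<mu> \<nu> = {h \<in> domF \<mu> \<nu>. \<forall>t<h. deriv (F \<mu> \<nu>) t > 0}"

definition hstar :: "real measure \<Rightarrow> real measure \<Rightarrow> real" where
  "hstar \<mu> \<nu> = Sup (Hset \<mu> \<nu>)"

definition hless :: "real measure \<Rightarrow> real measure \<Rightarrow> real \<Rightarrow> real" where
  "hless \<mu> \<nu> z =
     (if \<exists>h \<in> domF \<mu> \<nu>. F \<mu> \<nu> h = z then (LEAST h. h \<in> domF \<mu> \<nu> \<and> F \<mu> \<nu> h = z)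
      else Sup (domF \<mu> \<nu>))"

text \<open>The extension of \<open>F\<close> to the right endpoint of its open domain by the left limit, which may
  be infinite.  Maxima and the argsup of \<open>F\<close> refer to this extension.\<close>

definition domF_ext :: "real measure \<Rightarrow> real measure \<Rightarrow> real set" where
  "domF_ext \<mu> \<nu> = insert (Sup (domF \<mu> \<nu>)) (domF \<mu> \<nu>)"

definition F_ext :: "real measure \<Rightarrow> real measure \<Rightarrow> real \<Rightarrow> ereal" where
  "F_ext \<mu> \<nu> h =
     (if h \<in> domF \<mu> \<nu> then ereal (F \<mu> \<nu> h) else Lim (at_left h) (\<lambda>x. ereal (F \<mu> \<nu> x)))"

definition F_local_max :: "real measure \<Rightarrow> real measure \<Rightarrow> real \<Rightarrow> bool" where
  "F_local_max \<mu> \<nu> h \<longleftrightarrow>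
     (\<exists>e>0. is_arg_max (F_ext \<mu> \<nu>) (\<lambda>x. x \<in> domF_ext \<mu> \<nu> \<and> \<bar>x - h\<bar> < e) h)"

definition F_global_max :: "real measure \<Rightarrow> real measure \<Rightarrow> real \<Rightarrow> bool" where
  "F_global_max \<mu> \<nu> h \<longleftrightarrow> is_arg_max (F_ext \<mu> \<nu>) (\<lambda>x. x \<in> domF_ext \<mu> \<nu>) h"

definition F_argsup :: "real measure \<Rightarrow> real measure \<Rightarrow> real" where
  "F_argsup \<mu> \<nu> = (THE h. F_global_max \<mu> \<nu> h)"

definition strictly_concave_on :: "real set \<Rightarrow> (real \<Rightarrow> real) \<Rightarrow> bool" where
  "strictly_concave_on S f \<longleftrightarrow>
     convex S \<and>
     (\<forall>x\<in>S. \<forall>y\<in>S. \<forall>u. x \<noteq> y \<and> 0 < u \<and> u < 1 \<longrightarrow>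
        (1 - u) * f x + u * f y < f ((1 - u) * x + u * y))"

end

theory Submission
  imports Defs "HOL-Complex_Analysis.Complex_Analysis"
begin

text \<open>On \<open>domF \<mu> \<nu>\<close> one has \<open>F \<mu> \<nu> h = K (- stieltjes \<nu> h)\<close>, where
  \<open>K t = R_transform \<rho> t + 1 / t\<close> continues the inverse of \<open>\<lambda>z. - stieltjes \<rho> z\<close>. As long as
  \<open>stieltjes \<nu> h < gstar \<rho>\<close>, \<open>F\<close> is therefore increasing with values below \<open>zstar \<rho>\<close>; if equality
  occurs, \<open>K\<close> has a critical point there, since otherwise \<open>stieltjes \<rho>\<close> would extend analytically
  across the edge of the support, which positivity forbids. So everything reduces to showing that
  \<open>stieltjes \<nu>\<close> tends to \<open>gstar \<rho>\<close> at \<open>hstar \<mu> \<nu>\<close> when \<open>F\<close> has no critical point. If the limit were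
  smaller, the two subordination functions would be defined to the left of some \<open>z0 < zstar \<rho>\<close>, with
  an analytic sum at \<open>z0\<close>. By Kaluza's theorem on reciprocals of log-convex power series and
  \<open>F' > 0\<close>, their Taylor coefficients are nonnegative, so each of them is analytic at \<open>z0\<close>; then the
  \<open>R\<close>-transforms of \<open>\<mu>\<close> and \<open>\<nu>\<close> extend to the limit point, and a comparison of their derivatives
  gives a contradiction. For the local maximum, the growth condition bounds the increment of
  \<open>stieltjes \<rho>\<close> at the edge, which makes the second derivative of \<open>K\<close> there negative.\<close>

subsection \<open>Real analytic functions\<close>

text \<open>Analyticity of a sum says nothing about its summands: a priori
  \<open>R_transform \<rho>\<close> may be analytic where the transforms of \<mu> and \<nu> are both
  singular. Signs exclude such a cancellation. Put H z = - 1 / G z - z for either Stieltjes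
  transform. The subordination functions satisfy v = id + H o w with the H of \<mu> and w = id + H o
  v with that of \<nu>. Kaluza's theorem makes the coefficients of 1 / G nonpositive from order 1
  on, Cauchy-Schwarz settles order 1 of H, where the identity is subtracted, and F' > 0 says
  precisely that the linear coefficients of the two H have product below 1. Two series that are
  nonnegative from order 1 on cannot have a smaller radius of convergence than their sum. The final
  contradiction is again one of signs: at the limit point the derivative of
  \<open>R_transform \<mu>\<close> would be negative, but it is a limit of nonnegative values. In
  the local maximum part, mass of order \<epsilon>^(3/2) permits every exponent below 1/2 for the
  increment at the edge, and excluding a third order zero needs one above 1/3; hence 2/5.\<close>

abbreviation real_analytic_at :: "(real \<Rightarrow> real) \<Rightarrow> real \<Rightarrow> bool" where
  "real_analytic_at f x \<equiv> real_analytic_on f {x}"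

lemma real_analytic_onD: "real_analytic_on f S \<Longrightarrow> x \<in> S \<Longrightarrow> real_analytic_at f x"
  by (simp add: real_analytic_on_def)

lemma real_analytic_onI: "(\<And>x. x \<in> S \<Longrightarrow> real_analytic_at f x) \<Longrightarrow> real_analytic_on f S"
  by (simp add: real_analytic_on_def)

text \<open>Complexification: composition, recentring and local inversion of real analytic functions
  are carried out for the holomorphic function given by this series.\<close>

definition cfps :: "real fps \<Rightarrow> complex fps" where
  "cfps A = Abs_fps (\<lambda>n. complex_of_real (fps_nth A n))"

lemma fps_nth_cfps [simp]: "fps_nth (cfps A) n = complex_of_real (fps_nth A n)"
  by (simp add: cfps_def)

lemma cfps_mult: "cfps (A * B) = cfps A * cfps B"
  by (rule fps_ext) (simp add: fps_mult_nth)

lemma cfps_power: "cfps (A ^ n) = cfps A ^ n"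
proof (induction n)
  case 0
  then show ?case by (simp add: fps_eq_iff)
next
  case (Suc n)
  then show ?case by (simp add: cfps_mult)
qed

lemma cfps_compose: "cfps (fps_compose A B) = fps_compose (cfps A) (cfps B)"
  by (rule fps_ext) (simp add: fps_compose_nth cfps_power[symmetric])

lemma fps_conv_radius_cfps [simp]: "fps_conv_radius (cfps A) = fps_conv_radius A"
proof -
  have "conv_radius (\<lambda>n. norm (complex_of_real (fps_nth A n))) = conv_radius (\<lambda>n. norm (fps_nth A n))"
    by simp
  then show ?thesis
    unfolding fps_conv_radius_def conv_radius_norm by simp
qed

lemma eval_fps_cfps:
  assumes "ereal \<bar>y\<bar> < fps_conv_radius A"
  shows "eval_fps (cfps A) (of_real y) = of_real (eval_fps A y)"
proof -
  have "(\<lambda>n. fps_nth A n * y ^ n) sums eval_fps A y"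
    using assms by (intro sums_eval_fps) auto
  then have "(\<lambda>n. complex_of_real (fps_nth A n * y ^ n)) sums of_real (eval_fps A y)"
    by (rule sums_of_real)
  then show ?thesis
    by (auto simp: eval_fps_def sums_iff)
qed

lemma eventually_fps_conv_radius:
  assumes "fps_conv_radius (A :: real fps) > 0"
  shows "eventually (\<lambda>y. ereal \<bar>y\<bar> < fps_conv_radius A) (nhds 0)"
proof -
  have "eventually (\<lambda>y. y \<in> eball 0 (fps_conv_radius A)) (nhds (0::real))"
    using assms by (intro eventually_nhds_in_open) (auto simp: zero_ereal_def)
  then show ?thesis by eventually_elim auto
qed

lemma has_fps_expansion_complexify:
  assumes "f has_fps_expansion A"
  shows "eventually (\<lambda>y. eval_fps (cfps A) (of_real y) = of_real (f y)) (nhds 0)"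
proof -
  have "fps_conv_radius A > 0" and ev: "eventually (\<lambda>y. eval_fps A y = f y) (nhds 0)"
    using assms by (auto simp: has_fps_expansion_def)
  from eventually_fps_conv_radius[OF this(1)] ev show ?thesis
    by eventually_elim (simp add: eval_fps_cfps)
qed

text \<open>The way back from complex to real series: at a real argument the powers are real, so
  taking real parts termwise leaves the real value unchanged.\<close>

lemma has_fps_expansion_real_part:
  assumes g: "g has_fps_expansion B"
    and ev: "eventually (\<lambda>y. g (of_real y) = of_real (f y)) (nhds 0)"
  shows "f has_fps_expansion Abs_fps (\<lambda>n. Re (fps_nth B n))"
proof (rule has_fps_expansionI)
  have R: "fps_conv_radius B > 0" and ev2: "eventually (\<lambda>w. eval_fps B w = g w) (nhds 0)"
    using g by (auto simp: has_fps_expansion_def)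
  have "eventually (\<lambda>w. w \<in> eball 0 (fps_conv_radius B)) (nhds (0::complex))"
    using R by (intro eventually_nhds_in_open) (auto simp: zero_ereal_def)
  with ev2 have ev3: "eventually (\<lambda>w. eval_fps B w = g w \<and> w \<in> eball 0 (fps_conv_radius B)) (nhds 0)"
    by eventually_elim auto
  have lim: "filterlim complex_of_real (nhds 0) (nhds 0)"
    by (rule tendsto_eq_intros filterlim_ident | simp)+
  have "eventually (\<lambda>y. eval_fps B (of_real y) = g (of_real y) \<and>
          complex_of_real y \<in> eball 0 (fps_conv_radius B)) (nhds 0)"
    using filterlim_iff[THEN iffD1, OF lim] ev3 by auto
  with ev show "eventually (\<lambda>u. (\<lambda>n. fps_nth (Abs_fps (\<lambda>n. Re (fps_nth B n))) n * u ^ n) sums f u) (nhds 0)"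
  proof eventually_elim
    case (elim u)
    then have "(\<lambda>n. fps_nth B n * of_real u ^ n) sums of_real (f u)"
      using sums_eval_fps[of "of_real u" B] by auto
    from sums_Re[OF this] show ?case
      by (simp flip: of_real_power)
  qed
qed

lemma has_fps_expansion_compose_real:
  fixes f g :: "real \<Rightarrow> real"
  assumes A: "f has_fps_expansion A" and B: "g has_fps_expansion B" "fps_nth B 0 = 0"
  shows "(\<lambda>x. f (g x)) has_fps_expansion fps_compose A B"
proof -
  let ?f = "eval_fps (cfps A)" and ?g = "eval_fps (cfps B)"
  have c: "(?f \<circ> ?g) has_fps_expansion fps_compose (cfps A) (cfps B)"
    using A B by (intro has_fps_expansion_compose eval_fps_has_fps_expansion)
      (auto simp: has_fps_expansion_def)
  have "g 0 = 0"
    using B has_fps_expansion_imp_0_eq_fps_nth_0 by metis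
  moreover have "isCont g 0"
    using has_fps_expansion_imp_continuous[OF B(1)] by auto
  ultimately have lim: "filterlim g (nhds 0) (nhds 0)"
    by (metis isCont_def tendsto_at_iff_tendsto_nhds)
  have "eventually (\<lambda>y. ?f (of_real (g y)) = of_real (f (g y))) (nhds 0)"
    using has_fps_expansion_complexify[OF A] lim filterlim_iff by fastforce
  with has_fps_expansion_complexify[OF B(1)]
  have "eventually (\<lambda>y. (?f \<circ> ?g) (of_real y) = of_real (f (g y))) (nhds 0)"
    by eventually_elim simp
  from has_fps_expansion_real_part[OF c this] show ?thesis
    by (simp add: cfps_compose[symmetric] fps_nth_inverse)
qed

lemma real_fps_expansionD:
  assumes "(\<lambda>y. f (x + y)) has_fps_expansion A"
  obtains r where "r > 0" "\<And>y. \<bar>y - x\<bar> < r \<Longrightarrow> (\<lambda>n. fps_nth A n * (y - x) ^ n) sums (f y :: real)"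
proof -
  have R: "fps_conv_radius A > 0" and ev: "eventually (\<lambda>y. eval_fps A y = f (x + y)) (nhds 0)"
    using assms by (auto simp: has_fps_expansion_def)
  from eventually_fps_conv_radius[OF R] ev
  have "eventually (\<lambda>y. (\<lambda>n. fps_nth A n * y ^ n) sums f (x + y)) (nhds 0)"
  proof eventually_elim
    case (elim y)
    then show ?case using sums_eval_fps[of y A] by simp
  qed
  then obtain r where r: "r > 0" "\<And>y. \<bar>y\<bar> < r \<Longrightarrow> (\<lambda>n. fps_nth A n * y ^ n) sums f (x + y)"
    unfolding eventually_nhds_metric by (auto simp: dist_norm)
  show ?thesis
  proof (rule that[OF r(1)])
    fix y assume "\<bar>y - x\<bar> < r"
    from r(2)[OF this] show "(\<lambda>n. fps_nth A n * (y - x) ^ n) sums f y" by simp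
  qed
qed

section \<open>Local power series and closure properties of real analytic functions\<close>

lemma real_analytic_at_iff_fps:
  "real_analytic_at f x \<longleftrightarrow> (\<exists>A. (\<lambda>y. f (x + y)) has_fps_expansion A)"
proof
  assume "real_analytic_at f x"
  then obtain r a where r: "r > 0"
    and a: "\<And>y. \<bar>y - x\<bar> < r \<Longrightarrow> (\<lambda>n. a n * (y - x) ^ n) sums f y"
    by (auto simp: real_analytic_on_def)
  have "eventually (\<lambda>u::real. \<bar>u\<bar> < r) (nhds 0)"
    using eventually_nhds_in_open[of "ball (0::real) r" 0] r by (auto simp: dist_norm)
  then have "eventually (\<lambda>u. (\<lambda>n. fps_nth (Abs_fps a) n * u ^ n) sums f (x + u)) (nhds 0)"
    by eventually_elim (use a[of "x + u" for u] in simp)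
  from has_fps_expansionI[OF this] show "\<exists>A. (\<lambda>y. f (x + y)) has_fps_expansion A" ..
next
  assume "\<exists>A. (\<lambda>y. f (x + y)) has_fps_expansion A"
  then obtain A r where "r > 0" "\<And>y. \<bar>y - x\<bar> < r \<Longrightarrow> (\<lambda>n. fps_nth A n * (y - x) ^ n) sums f y"
    using real_fps_expansionD by blast
  then show "real_analytic_at f x"
    unfolding real_analytic_on_def by blast
qed

text \<open>The complexified series is holomorphic on the disc of radius r - |z - x| about z and
  equals its Taylor series there. The radius is explicit because the positivity arguments depend on
  how far the recentred series reaches.\<close>

lemma real_power_series_reexpand:
  assumes a: "\<And>y. \<bar>y - x\<bar> < r \<Longrightarrow> (\<lambda>n. a n * (y - x) ^ n) sums f y"
    and z: "\<bar>z - x\<bar> < (r::real)"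
  obtains b where "\<And>y. \<bar>y - z\<bar> < r - \<bar>z - x\<bar> \<Longrightarrow> (\<lambda>n. b n * (y - z) ^ n) sums f y"
proof -
  define A where "A = Abs_fps a"
  have r0: "r > 0" using z by linarith
  have rad: "fps_conv_radius A \<ge> r"
    unfolding fps_conv_radius_def
  proof (rule conv_radius_geI_ex')
    fix \<rho> assume "0 < \<rho>" "ereal \<rho> < ereal r"
    then show "summable (\<lambda>n. fps_nth A n * of_real \<rho> ^ n)"
      using a[of "x + \<rho>"] by (auto simp: A_def sums_iff)
  qed
  define g where "g = (\<lambda>w. eval_fps (cfps A) (w - of_real x))"
  have hol: "g holomorphic_on ball (of_real z) (r - \<bar>z - x\<bar>)"
    unfolding g_def
  proof (rule holomorphic_on_compose_gen[where g = "eval_fps (cfps A)" and t = "eball 0 (fps_conv_radius A)", unfolded o_def])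
    show "(\<lambda>w. w - complex_of_real x) ` ball (of_real z) (r - \<bar>z - x\<bar>) \<subseteq> eball 0 (fps_conv_radius A)"
    proof safe
      fix w assume "w \<in> ball (complex_of_real z) (r - \<bar>z - x\<bar>)"
      then have "norm (w - of_real z) < r - \<bar>z - x\<bar>"
        by (simp add: dist_norm norm_minus_commute)
      moreover have "norm (w - of_real x) \<le> norm (w - of_real z) + \<bar>z - x\<bar>"
      proof -
        have "w - of_real x = (w - of_real z) + of_real (z - x)" by simp
        then show ?thesis
          by (metis norm_of_real norm_triangle_ineq)
      qed
      ultimately have "ereal (norm (w - of_real x)) < r" by auto
      from less_le_trans[OF this rad] show "w - of_real x \<in> eball 0 (fps_conv_radius A)"
        by simp
    qed
  qed (auto intro!: holomorphic_intros holomorphic_on_eval_fps)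
  have ev: "g (of_real y) = of_real (f y)" if "\<bar>y - x\<bar> < r" for y
  proof -
    have "ereal \<bar>y - x\<bar> < fps_conv_radius A"
      using that rad by (meson ereal_less_le less_ereal.simps(1) less_le_trans)
    from eval_fps_cfps[OF this] show ?thesis
      using a[OF that] by (simp add: g_def A_def eval_fps_def sums_iff)
  qed
  define c where "c = (\<lambda>n. (deriv ^^ n) g (of_real z) / fact n)"
  show ?thesis
  proof (rule that[of "\<lambda>n. Re (c n)"])
    fix y assume y: "\<bar>y - z\<bar> < r - \<bar>z - x\<bar>"
    then have "(\<lambda>n. c n * (of_real y - of_real z) ^ n) sums g (of_real y)"
      unfolding c_def
      by (intro holomorphic_power_series[OF hol]) (simp add: dist_norm abs_minus_commute flip: of_real_diff)
    moreover have "g (of_real y) = of_real (f y)"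
      using y by (intro ev) linarith
    ultimately have "(\<lambda>n. c n * of_real ((y - z) ^ n)) sums of_real (f y)"
      by simp
    from sums_Re[OF this] show "(\<lambda>n. Re (c n) * (y - z) ^ n) sums f y"
      by (simp del: of_real_power)
  qed
qed

lemma real_analytic_at_fpsE:
  assumes "real_analytic_at f x"
  obtains A where "(\<lambda>y. f (x + y)) has_fps_expansion A"
  using assms real_analytic_at_iff_fps by blast

lemma real_analytic_at_cong:
  assumes "real_analytic_at f x" "eventually (\<lambda>y. f y = g y) (nhds x)"
  shows "real_analytic_at g x"
proof -
  obtain A where A: "(\<lambda>y. f (x + y)) has_fps_expansion A"
    using assms(1) by (rule real_analytic_at_fpsE)
  have lim: "filterlim (\<lambda>y. x + y) (nhds x) (nhds 0)"
    by (rule tendsto_eq_intros filterlim_ident | simp)+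
  have "eventually (\<lambda>y. f (x + y) = g (x + y)) (nhds 0)"
    using filterlim_iff[THEN iffD1, OF lim] assms(2) by auto
  then have "(\<lambda>y. g (x + y)) has_fps_expansion A"
    using A by (auto simp: has_fps_expansion_def elim: eventually_elim2)
  then show ?thesis using real_analytic_at_iff_fps by blast
qed

lemma real_analytic_at_const [simp]: "real_analytic_at (\<lambda>_. c) x"
  and real_analytic_at_ident [simp]: "real_analytic_at (\<lambda>y. y) x"
  unfolding real_analytic_at_iff_fps
  by (rule exI fps_expansion_intros)+

lemma real_analytic_at_add:
  "real_analytic_at f x \<Longrightarrow> real_analytic_at g x \<Longrightarrow> real_analytic_at (\<lambda>y. f y + g y) x"
  and real_analytic_at_diff:
  "real_analytic_at f x \<Longrightarrow> real_analytic_at g x \<Longrightarrow> real_analytic_at (\<lambda>y. f y - g y) x"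
  and real_analytic_at_mult:
  "real_analytic_at f x \<Longrightarrow> real_analytic_at g x \<Longrightarrow> real_analytic_at (\<lambda>y. f y * g y) x"
  and real_analytic_at_minus: "real_analytic_at f x \<Longrightarrow> real_analytic_at (\<lambda>y. - f y) x"
  unfolding real_analytic_at_iff_fps
  by (elim exE, rule exI, rule fps_expansion_intros, assumption+)+

lemma real_analytic_at_inverse:
  assumes "real_analytic_at f x" "f x \<noteq> 0"
  shows "real_analytic_at (\<lambda>y. inverse (f y)) x"
proof -
  obtain A where A: "(\<lambda>y. f (x + y)) has_fps_expansion A"
    using assms(1) by (rule real_analytic_at_fpsE)
  moreover have "fps_nth A 0 \<noteq> 0"
    using has_fps_expansion_imp_0_eq_fps_nth_0[OF A] assms(2) by simp
  ultimately show ?thesis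
    using has_fps_expansion_inverse[of "\<lambda>y. f (x + y)" A]
    unfolding real_analytic_at_iff_fps by auto
qed

lemma real_analytic_at_divide:
  assumes "real_analytic_at f x" "real_analytic_at g x" "g x \<noteq> 0"
  shows "real_analytic_at (\<lambda>y. f y / g y) x"
  using real_analytic_at_mult[OF assms(1) real_analytic_at_inverse[OF assms(2,3)]]
  by (simp add: divide_inverse)

lemma real_analytic_at_compose:
  assumes f: "real_analytic_at f (g x)" and g: "real_analytic_at g x"
  shows "real_analytic_at (\<lambda>y. f (g y)) x"
proof -
  obtain A where A: "(\<lambda>y. f (g x + y)) has_fps_expansion A"
    using f by (rule real_analytic_at_fpsE)
  obtain B where B: "(\<lambda>y. g (x + y)) has_fps_expansion B"
    using g by (rule real_analytic_at_fpsE)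
  have "(\<lambda>y. g (x + y) - g x) has_fps_expansion B - fps_const (g x)"
    using B by (intro fps_expansion_intros)
  moreover have "fps_nth (B - fps_const (g x)) 0 = 0"
    using has_fps_expansion_imp_0_eq_fps_nth_0[OF B] by simp
  ultimately have "(\<lambda>y. f (g x + (g (x + y) - g x))) has_fps_expansion
      fps_compose A (B - fps_const (g x))"
    by (rule has_fps_expansion_compose_real[OF A])
  then show ?thesis
    by (auto simp: real_analytic_at_iff_fps)
qed

lemma has_real_derivative_fps:
  assumes "(\<lambda>y. f (x + y)) has_fps_expansion A"
  shows "(f has_real_derivative fps_nth A 1) (at x)"
proof -
  have R: "fps_conv_radius A > 0" and ev: "eventually (\<lambda>y. eval_fps A y = f (x + y)) (nhds 0)"
    using assms by (auto simp: has_fps_expansion_def)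
  have "(eval_fps A has_real_derivative eval_fps (fps_deriv A) 0) (at 0)"
    using R by (intro has_field_derivative_eval_fps) (auto simp: zero_ereal_def)
  then have "((\<lambda>y. f (x + y)) has_real_derivative fps_nth A 1) (at 0)"
    using DERIV_cong_ev[OF refl ev refl] by (simp add: eval_fps_at_0)
  then show ?thesis
    using DERIV_shift[of f "fps_nth A 1" 0 x] by (simp add: add.commute)
qed

lemma real_analytic_at_has_derivative:
  assumes "real_analytic_at f x"
  shows "(f has_real_derivative deriv f x) (at x)"
  using assms by (metis real_analytic_at_fpsE has_real_derivative_fps DERIV_imp_deriv)

lemma real_analytic_at_isCont: "real_analytic_at f x \<Longrightarrow> isCont f x"
  using real_analytic_at_has_derivative DERIV_isCont by blast

lemma real_analytic_power_series:
  assumes r: "\<And>y. \<bar>y - x\<bar> < r \<Longrightarrow> (\<lambda>n. a n * (y - x) ^ n) sums (f y :: real)" and z: "\<bar>z - x\<bar> < r"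
  shows "real_analytic_at f z"
proof -
  obtain b where b: "\<And>y. \<bar>y - z\<bar> < r - \<bar>z - x\<bar> \<Longrightarrow> (\<lambda>n. b n * (y - z) ^ n) sums f y"
    using real_power_series_reexpand[OF r z] by blast
  have "r - \<bar>z - x\<bar> > 0" using z by simp
  with b show ?thesis
    unfolding real_analytic_on_def by blast
qed

lemma real_analytic_at_eventually:
  assumes "real_analytic_at f x"
  shows "eventually (real_analytic_at f) (nhds x)"
proof -
  obtain r a where r: "r > 0"
    and a: "\<And>y. \<bar>y - x\<bar> < r \<Longrightarrow> (\<lambda>n. a n * (y - x) ^ n) sums f y"
    using assms by (auto simp: real_analytic_on_def)
  have "real_analytic_at f z" if "\<bar>z - x\<bar> < r" for z
    using a that by (rule real_analytic_power_series)
  with r show ?thesis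
    unfolding eventually_nhds_metric by (auto simp: dist_norm)
qed

lemma real_analytic_at_deriv:
  assumes "real_analytic_at f x"
  shows "real_analytic_at (deriv f) x"
proof -
  obtain A where A: "(\<lambda>y. f (x + y)) has_fps_expansion A"
    using assms by (rule real_analytic_at_fpsE)
  have lim: "filterlim (\<lambda>y. x + y) (nhds x) (nhds 0)"
    by (rule tendsto_eq_intros filterlim_ident | simp)+
  have "eventually (\<lambda>y. real_analytic_at f (x + y)) (nhds 0)"
    using filterlim_iff[THEN iffD1, OF lim] real_analytic_at_eventually[OF assms] by auto
  then have "eventually (\<lambda>y. deriv (\<lambda>y. f (x + y)) y = deriv f (x + y)) (nhds 0)"
  proof eventually_elim
    case (elim y)
    have "((\<lambda>y. f (x + y)) has_real_derivative deriv f (x + y)) (at y)"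
      using real_analytic_at_has_derivative[OF elim] DERIV_shift[of f "deriv f (x + y)" y x]
      by (simp add: add.commute)
    then show ?case by (rule DERIV_imp_deriv)
  qed
  with has_fps_expansion_deriv[OF A] have "(\<lambda>y. deriv f (x + y)) has_fps_expansion fps_deriv A"
    by (auto simp: has_fps_expansion_def elim: eventually_elim2)
  then show ?thesis using real_analytic_at_iff_fps by blast
qed

section \<open>Isolated zeros, uniqueness of coefficients and the identity theorem\<close>

lemma real_power_series_zero:
  assumes r: "0 < r" and a: "\<And>y. \<bar>y - x\<bar> < r \<Longrightarrow> (\<lambda>n. a n * (y - x) ^ n) sums (f y :: real)"
    and fr: "frequently (\<lambda>y. f y = 0) (at x)"
  shows "a n = 0"
proof -
  have f0: "f x = 0"
  proof (rule ccontr)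
    assume "f x \<noteq> 0"
    have "real_analytic_at f x" unfolding real_analytic_on_def using r a by blast
    then have "(f \<longlongrightarrow> f x) (at x)" using real_analytic_at_isCont isCont_def by blast
    from tendsto_imp_eventually_ne[OF this \<open>f x \<noteq> 0\<close>] fr show False
      by (simp add: frequently_def)
  qed
  show ?thesis
  proof (cases "n = 0")
    case True
    have "(\<lambda>n. a n * 0 ^ n) sums a 0" using powser_sums_zero[of a] by simp
    moreover have "(\<lambda>n. a n * 0 ^ n) sums f x" using a[of x] r by simp
    ultimately show ?thesis using True f0 sums_unique2 by metis
  next
    case False
    show ?thesis
    proof (rule ccontr)
      assume "a n \<noteq> 0"
      with False obtain s where s: "0 < s" "\<And>z. z \<in> cball x s - {x} \<Longrightarrow> f z \<noteq> 0"
        using powser_0_nonzero[OF r, of x a f n] a f0 by auto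
      have "eventually (\<lambda>z. f z \<noteq> 0) (at x)"
        unfolding eventually_at by (rule exI[of _ s]) (use s in \<open>auto simp: dist_commute\<close>)
      with fr show False by (simp add: frequently_def)
    qed
  qed
qed

lemma real_power_series_unique:
  assumes r: "0 < r" and a: "\<And>y. \<bar>y - x\<bar> < r \<Longrightarrow> (\<lambda>n. a n * (y - x) ^ n) sums (f y :: real)"
    and s: "0 < s" and b: "\<And>y. \<bar>y - x\<bar> < s \<Longrightarrow> (\<lambda>n. b n * (y - x) ^ n) sums f y"
  shows "a n = b n"
proof -
  have "(\<lambda>n. (a n - b n) * (y - x) ^ n) sums (\<lambda>_. 0) y" if "\<bar>y - x\<bar> < min r s" for y
    using sums_diff[OF a[of y] b[of y]] that by (simp add: algebra_simps)
  then have "a n - b n = 0"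
    by (rule real_power_series_zero[where r = "min r s", rotated]) (use r s in auto)
  then show ?thesis by simp
qed

lemma fps_expansion_unique_real:
  fixes f :: "real \<Rightarrow> real"
  assumes "f has_fps_expansion A" "f has_fps_expansion B"
  shows "A = B"
proof (rule fps_ext)
  fix n
  have *: "(\<lambda>y. f (0 + y)) has_fps_expansion A" "(\<lambda>y. f (0 + y)) has_fps_expansion B"
    using assms by simp_all
  obtain r where r: "r > 0" "\<And>y. \<bar>y - 0\<bar> < r \<Longrightarrow> (\<lambda>n. fps_nth A n * (y - 0) ^ n) sums f y"
    using real_fps_expansionD[OF *(1)] by blast
  obtain s where s: "s > 0" "\<And>y. \<bar>y - 0\<bar> < s \<Longrightarrow> (\<lambda>n. fps_nth B n * (y - 0) ^ n) sums f y"
    using real_fps_expansionD[OF *(2)] by blast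
  show "fps_nth A n = fps_nth B n"
    by (rule real_power_series_unique[OF r s])
qed

lemma real_analytic_at_frequently_zero:
  assumes "real_analytic_at f x" "frequently (\<lambda>y. f y = 0) (at x)"
  shows "eventually (\<lambda>y. f y = 0) (nhds x)"
proof -
  obtain r a where r: "r > 0"
    and a: "\<And>y. \<bar>y - x\<bar> < r \<Longrightarrow> (\<lambda>n. a n * (y - x) ^ n) sums f y"
    using assms(1) by (auto simp: real_analytic_on_def)
  have "f y = 0" if "\<bar>y - x\<bar> < r" for y
    using a[OF that] real_power_series_zero[OF r a assms(2)] sums_unique2[OF _ sums_zero] by simp
  with r show ?thesis
    unfolding eventually_nhds_metric by (auto simp: dist_norm)
qed

text \<open>At every point the zeros of f - g either accumulate, and then the germs agree throughout
  a neighbourhood, or they are isolated, and then the germs agree at no nearby point. Equality of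
  germs is thus locally constant, and connectedness spreads it.\<close>

lemma real_analytic_identity:
  assumes f: "real_analytic_on f I" and g: "real_analytic_on g I"
    and I: "open I" "connected I" and a: "a \<in> I" and ev: "eventually (\<lambda>y. f y = g y) (nhds a)"
    and x: "x \<in> I"
  shows "f x = g x"
proof -
  let ?P = "\<lambda>x. eventually (\<lambda>y. f y = g y) (nhds x)"
  have d: "real_analytic_at (\<lambda>y. f y - g y) x" if "x \<in> I" for x
    using that by (intro real_analytic_at_diff real_analytic_onD[OF f] real_analytic_onD[OF g])
  have step: "\<exists>T. openin (top_of_set I) T \<and> z \<in> T \<and> (\<forall>x\<in>T. \<forall>y\<in>T. ?P x \<longrightarrow> ?P y)" if "z \<in> I" for z
  proof (cases "frequently (\<lambda>y. f y - g y = 0) (at z)")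
    case True
    then have "?P z"
      using real_analytic_at_frequently_zero[OF d[OF that]] by simp
    then obtain T where T: "open T" "z \<in> T" "\<And>y. y \<in> T \<Longrightarrow> f y = g y"
      unfolding eventually_nhds by blast
    then have "?P y" if "y \<in> T" for y
      using that unfolding eventually_nhds by blast
    with T that show ?thesis
      by (intro exI[of _ "I \<inter> T"]) (auto intro: openin_open_Int)
  next
    case False
    then have ne: "eventually (\<lambda>y. f y \<noteq> g y) (at z)"
      by (simp add: frequently_def)
    then obtain T where T: "open T" "z \<in> T" "\<And>y. y \<in> T \<Longrightarrow> y \<noteq> z \<Longrightarrow> f y \<noteq> g y"
      unfolding eventually_at_topological by blast
    have "\<not> ?P y" if y: "y \<in> T" for y
    proof
      assume P: "?P y"
      then have "f y = g y" by (rule eventually_nhds_x_imp_x)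
      with T(3) y have "y = z" by blast
      with P have "eventually (\<lambda>y. f y = g y) (at z)"
        by (simp add: eventually_at_filter eventually_mono)
      with ne have "eventually (\<lambda>_. False) (at z)"
        by eventually_elim simp
      then show False by simp
    qed
    with T that show ?thesis
      by (intro exI[of _ "I \<inter> T"]) (auto intro: openin_open_Int)
  qed
  have "?P x"
    by (rule connected_induction_simple[where P = ?P, OF I(2) a x ev step])
  then show ?thesis by (rule eventually_nhds_x_imp_x)
qed

text \<open>The complexified function has a holomorphic local inverse h. Since h recovers y from f y
  for real y, it is real on the values of f near f x, so its real part is an analytic
  inverse.\<close>

lemma real_analytic_local_inverse:
  assumes f: "real_analytic_at f x" and d: "deriv f x \<noteq> 0"
  obtains \<phi> where "real_analytic_at \<phi> (f x)" "\<phi> (f x) = x"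
    "eventually (\<lambda>y. \<phi> (f y) = y) (nhds x)" "eventually (\<lambda>t. f (\<phi> t) = t) (nhds (f x))"
proof -
  obtain A where A: "(\<lambda>y. f (x + y)) has_fps_expansion A"
    using f by (rule real_analytic_at_fpsE)
  have A1: "fps_nth A 1 \<noteq> 0"
    using d has_real_derivative_fps[OF A] DERIV_imp_deriv by metis
  have A0: "fps_nth A 0 = f x"
    using has_fps_expansion_imp_0_eq_fps_nth_0[OF A] by simp
  have R: "fps_conv_radius A > 0" using A by (simp add: has_fps_expansion_def)
  define g where "g = (\<lambda>w. eval_fps (cfps A) w - of_real (f x))"
  have hol: "g holomorphic_on eball 0 (fps_conv_radius A)"
    unfolding g_def by (intro holomorphic_intros) auto
  have dg: "deriv g 0 \<noteq> 0"
  proof -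
    have "(eval_fps (cfps A) has_field_derivative eval_fps (fps_deriv (cfps A)) 0) (at 0)"
      using R by (intro has_field_derivative_eval_fps) (simp add: zero_ereal_def[symmetric])
    from DERIV_diff[OF this DERIV_const[of "of_real (f x)"]]
    have "(g has_field_derivative fps_nth (cfps A) 1) (at 0)"
      by (simp add: g_def eval_fps_at_0)
    then show ?thesis using A1 by (simp add: DERIV_imp_deriv)
  qed
  have z0: "(0::complex) \<in> eball 0 (fps_conv_radius A)"
    using R by (simp add: zero_ereal_def)
  obtain r where r: "r > 0" "ball (0::complex) r \<subseteq> eball 0 (fps_conv_radius A)" "open (g ` ball 0 r)"
      "inj_on g (ball 0 r)"
    by (rule has_complex_derivative_locally_invertible[OF hol z0 open_eball dg])
  have "g holomorphic_on ball 0 r" using hol r(2) holomorphic_on_subset by blast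
  then obtain h where h: "h holomorphic_on g ` ball 0 r" "\<And>z. z \<in> ball 0 r \<Longrightarrow> h (g z) = z"
    using holomorphic_has_inverse[OF _ open_ball r(4)] by metis
  have g0: "g 0 = 0" by (simp add: g_def eval_fps_at_0 A0)
  have h_fps: "h has_fps_expansion fps_expansion h 0"
    using h(1) r g0 by (intro has_fps_expansion_fps_expansion[OF r(3)]) (auto intro!: image_eqI[of _ _ 0])
  define \<phi> where "\<phi> = (\<lambda>t. x + Re (h (of_real (t - f x))))"
  have "eventually (\<lambda>y. y \<in> ball 0 r) (nhds (0::real))"
    using r(1) by (intro eventually_nhds_in_open) auto
  with has_fps_expansion_complexify[OF A]
  have "eventually (\<lambda>y. h (of_real (f (x + y) - f x)) = of_real y) (nhds 0)"
  proof eventually_elim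
    case (elim y)
    then have "g (of_real y) = of_real (f (x + y) - f x)" by (simp add: g_def)
    then show ?case using h(2)[of "of_real y"] elim by auto
  qed
  then have "eventually (\<lambda>y. h (of_real (f y - f x)) = of_real (y - x)) (nhds x)"
    unfolding eventually_nhds_metric dist_norm
    by (metis add_diff_cancel_left' diff_zero add.commute diff_add_cancel)
  then obtain s where s: "s > 0"
      "\<And>y. \<bar>y - x\<bar> < s \<Longrightarrow> h (of_real (f y - f x)) = of_real (y - x)"
    unfolding eventually_nhds_metric by (auto simp: dist_norm)
  obtain s' where s': "s' > 0" "\<And>y. \<bar>y - x\<bar> < s' \<Longrightarrow> real_analytic_at f y"
    using real_analytic_at_eventually[OF f] unfolding eventually_nhds_metric by (auto simp: dist_norm)
  define U where "U = ball x (min s s')"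
  have \<phi>f: "\<phi> (f y) = y" if "y \<in> U" for y
    using that s(2)[of y] by (simp add: U_def \<phi>_def dist_norm abs_minus_commute)
  \<comment> \<open>Invariance of domain makes the image a neighbourhood of f x; hence the left
    inverse is also a right inverse, and h is real at all real arguments near 0.\<close>
  have "open (f ` U)"
  proof (rule invariance_of_domain)
    show "continuous_on U f"
      using s'(2) by (intro continuous_at_imp_continuous_on ballI real_analytic_at_isCont)
        (auto simp: U_def dist_norm abs_minus_commute)
    show "inj_on f U" using \<phi>f by (metis inj_onI)
  qed (simp add: U_def)
  moreover have xU: "x \<in> U" using s(1) s'(1) by (simp add: U_def)
  ultimately have evU: "eventually (\<lambda>t. t \<in> f ` U) (nhds (f x))"
    by (intro eventually_nhds_in_open) auto
  show ?thesis
  proof (rule that[of \<phi>])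
    show "\<phi> (f x) = x" using \<phi>f xU by blast
    show "eventually (\<lambda>y. \<phi> (f y) = y) (nhds x)"
      using xU \<phi>f unfolding eventually_nhds U_def by blast
    show "eventually (\<lambda>t. f (\<phi> t) = t) (nhds (f x))"
      using evU by eventually_elim (use \<phi>f in auto)
    have "eventually (\<lambda>t. h (of_real (t - f x)) = of_real (\<phi> t - x)) (nhds (f x))"
      using evU by eventually_elim (use s(2) in \<open>auto simp: \<phi>f U_def dist_norm abs_minus_commute\<close>)
    then have "eventually (\<lambda>t. h (of_real t) = of_real (\<phi> (f x + t) - x)) (nhds 0)"
      unfolding eventually_nhds_metric dist_norm
      by (metis add_diff_cancel_left' diff_zero)
    from has_fps_expansion_real_part[OF h_fps this]
    obtain B where "(\<lambda>t. \<phi> (f x + t) - x) has_fps_expansion B" by blast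
    from has_fps_expansion_add[OF this has_fps_expansion_const[of x]]
    show "real_analytic_at \<phi> (f x)" by (auto simp: real_analytic_at_iff_fps)
  qed
qed

lemma real_analytic_at_factor:
  assumes f: "real_analytic_at f x" and "f x = 0"
  obtains g where "real_analytic_at g x" "\<And>y. f y = (y - x) * g y" "g x = deriv f x"
proof -
  obtain A where A: "(\<lambda>y. f (x + y)) has_fps_expansion A"
    using f by (rule real_analytic_at_fpsE)
  have A0: "fps_nth A 0 = 0"
    using has_fps_expansion_imp_0_eq_fps_nth_0[OF A] assms(2) by simp
  define g where "g = (\<lambda>y. if y = x then deriv f x else f y / (y - x))"
  have "deriv f x = fps_nth A 1"
    using has_real_derivative_fps[OF A] DERIV_imp_deriv by blast
  have "real_analytic_at g x"
  proof (cases "A = 0")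
    case True
    then have "eventually (\<lambda>y. f (x + y) = 0) (nhds 0)" and "deriv f x = 0"
      using A \<open>deriv f x = fps_nth A 1\<close> by (auto simp: has_fps_expansion_def elim: eventually_mono)
    then have "(\<lambda>y. g (x + y)) has_fps_expansion 0"
      by (auto simp: has_fps_expansion_def g_def elim: eventually_mono)
    then show ?thesis by (auto simp: real_analytic_at_iff_fps)
  next
    case False
    then have "1 \<le> subdegree A"
      using A0 by (intro subdegree_geI) auto
    from has_fps_expansion_shift[OF A this \<open>deriv f x = fps_nth A 1\<close>]
    have "(\<lambda>y. g (x + y)) has_fps_expansion fps_shift 1 A"
      by (simp add: g_def cong: if_cong)
    then show ?thesis by (auto simp: real_analytic_at_iff_fps)
  qed
  then show ?thesis using assms(2) by (intro that[of g]) (auto simp: g_def)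
qed

subsection \<open>Power series with monotone coefficients\<close>

lemma fps_inverse_nth_1:
  assumes "fps_nth (A :: real fps) 0 \<noteq> 0"
  shows "fps_nth (inverse A) 1 = - fps_nth A 1 / (fps_nth A 0)\<^sup>2"
proof -
  have "fps_nth (inverse A * A) 1 = fps_nth 1 1"
    using inverse_mult_eq_1[OF assms] by simp
  then have "inverse (fps_nth A 0) * fps_nth A 1 + fps_nth (inverse A) 1 * fps_nth A 0 = 0"
    by (simp add: fps_mult_nth)
  then have "fps_nth (inverse A) 1 * fps_nth A 0 = - (inverse (fps_nth A 0) * fps_nth A 1)"
    by linarith
  then show ?thesis using assms by (simp add: field_simps power2_eq_square)
qed

text \<open>Kaluza's theorem. Log-convexity makes the ratios of consecutive coefficients increase.
  Let q be the last ratio a(m+1) / a(m). Combining q times the convolution identity of order m with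
  the one of order m+1 gives b(m+1) * a(0) as the sum over k of b(k) * (q * a(m-k) - a(m+1-k)): the
  term k = 0 vanishes, and the others are nonpositive by induction. Order 1 is separate because the
  identity of order 0 has right hand side 1.\<close>

lemma fps_inverse_log_convex:
  fixes A :: "real fps"
  assumes pos: "\<And>n. fps_nth A n > 0"
    and lc: "\<And>n. (fps_nth A (Suc n))\<^sup>2 \<le> fps_nth A n * fps_nth A (Suc (Suc n))"
    and n: "n \<ge> 1"
  shows "fps_nth (inverse A) n \<le> 0"
  using n
proof (induction n rule: less_induct)
  case (less n)
  let ?a = "fps_nth A" and ?b = "fps_nth (inverse A)"
  have conv: "(\<Sum>k=0..m. ?b k * ?a (m - k)) = (if m = 0 then 1 else 0)" for m
  proof -
    have "inverse A * A = 1" using pos[of 0] by (intro inverse_mult_eq_1) simp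
    then have "fps_nth (inverse A * A) m = fps_nth 1 m" by simp
    then show ?thesis by (simp add: fps_mult_nth)
  qed
  show ?case
  proof (cases "n = 1")
    case True
    have "?b 1 = - ?a 1 / (?a 0)\<^sup>2"
      using pos[of 0] by (intro fps_inverse_nth_1) auto
    then show ?thesis using True pos[of 0] pos[of 1] by (simp add: divide_nonpos_pos)
  next
    case False
    then obtain m where m: "n = Suc m" "m \<ge> 1" using less.prems by (cases n) auto
    have ratio: "?a (Suc i) / ?a i \<le> ?a (Suc j) / ?a j" if "i \<le> j" for i j
    proof (rule lift_Suc_mono_le[of "\<lambda>i. ?a (Suc i) / ?a i", OF _ that])
      show "?a (Suc i) / ?a i \<le> ?a (Suc (Suc i)) / ?a (Suc i)" for i
        using lc[of i] pos[of i] pos[of "Suc i"] by (simp add: divide_simps power2_eq_square mult.commute)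
    qed
    define q where "q = ?a (Suc m) / ?a m"
    have "(\<Sum>k=0..m. q * (?b k * ?a (m - k))) = 0"
      using conv[of m] m(2) by (simp flip: sum_distrib_left)
    then have q0: "(\<Sum>k=0..m. ?b k * (q * ?a (m - k))) = 0"
      by (simp add: mult.left_commute)
    have "?b (Suc m) * ?a 0 = - (\<Sum>k=0..m. ?b k * ?a (Suc m - k))"
      using conv[of "Suc m"] by simp
    also have "\<dots> = (\<Sum>k=0..m. ?b k * (q * ?a (m - k) - ?a (Suc m - k)))"
      by (simp add: right_diff_distrib sum_subtractf q0)
    also have "\<dots> \<le> 0"
    proof (rule sum_nonpos)
      fix k assume k: "k \<in> {0..m}"
      show "?b k * (q * ?a (m - k) - ?a (Suc m - k)) \<le> 0"
      proof (cases "k = 0")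
        case True
        then show ?thesis using pos[of m] by (simp add: q_def)
      next
        case False
        have "?a (Suc (m - k)) / ?a (m - k) \<le> q" unfolding q_def by (rule ratio) simp
        then have "q * ?a (m - k) - ?a (Suc m - k) \<ge> 0"
          using k pos[of "m - k"] by (simp add: Suc_diff_le pos_divide_le_eq)
        moreover have "?b k \<le> 0" using less.IH[of k] False k m by auto
        ultimately show ?thesis by (intro mult_nonpos_nonneg)
      qed
    qed
    finally show ?thesis using pos[of 0] m(1) by (simp add: mult_le_0_iff not_le)
  qed
qed

text \<open>Without constant term and with at least two factors, order n of the power only involves
  coefficients of C of order below n. This is the information that an induction on n has at
  hand.\<close>

lemma fps_power_nth_nonneg:
  fixes C :: "real fps"
  assumes C0: "fps_nth C 0 = 0" and nn: "\<And>k. 1 \<le> k \<Longrightarrow> k < n \<Longrightarrow> fps_nth C k \<ge> 0"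
    and i: "i \<ge> 2"
  shows "fps_nth (C ^ i) n \<ge> 0"
proof -
  have nn0: "fps_nth C k \<ge> 0" if "k < n" for k
    using nn[of k] C0 that by (cases k) auto
  have low: "fps_nth (C ^ i) m \<ge> 0" if "m < n" for i m
    using that
  proof (induction i arbitrary: m)
    case (Suc i)
    then show ?case
      by (auto simp: fps_mult_nth intro!: sum_nonneg mult_nonneg_nonneg nn0)
  qed (auto simp: fps_one_nth)
  obtain j where j: "i = Suc (Suc j)" using i by (metis add_2_eq_Suc le_Suc_ex)
  have "fps_nth C k * fps_nth (C ^ Suc j) (n - k) \<ge> 0" if k: "k \<in> {0..n}" for k
  proof -
    consider "k = 0" | "k = n" | "0 < k" "k < n" using k by force
    then show ?thesis
    proof cases
      case 1
      then show ?thesis using C0 by simp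
    next
      case 2
      then show ?thesis using C0 by simp
    next
      case 3
      then show ?thesis by (intro mult_nonneg_nonneg nn0 low) auto
    qed
  qed
  then show "fps_nth (C ^ i) n \<ge> 0"
    unfolding j power_Suc[of C "Suc j"] fps_mult_nth by (intro sum_nonneg)
qed

text \<open>The subordination functions solve \<open>D = X + A \<circ> C\<close> and \<open>C = X + B \<circ> D\<close>; the
  coefficients of order \<open>n\<close> enter this system linearly with determinant \<open>1 - A\<^sub>1 B\<^sub>1\<close>.\<close>

lemma fps_subordination_nonneg:
  fixes A B C D :: "real fps"
  assumes C0: "fps_nth C 0 = 0" and D0: "fps_nth D 0 = 0"
    and A: "\<And>n. n \<ge> 1 \<Longrightarrow> fps_nth A n \<ge> 0" and B: "\<And>n. n \<ge> 1 \<Longrightarrow> fps_nth B n \<ge> 0"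
    and det: "fps_nth A 1 * fps_nth B 1 < 1"
    and D: "\<And>n. n \<ge> 1 \<Longrightarrow> fps_nth D n = fps_nth fps_X n + fps_nth (A oo C) n"
    and C: "\<And>n. n \<ge> 1 \<Longrightarrow> fps_nth C n = fps_nth fps_X n + fps_nth (B oo D) n"
    and n: "n \<ge> 1"
  shows "fps_nth C n \<ge> 0 \<and> fps_nth D n \<ge> 0"
  using n
proof (induction n rule: less_induct)
  case (less n)
  \<comment> \<open>The unknown coefficient of order n enters a composition only through the linear
    term; everything else is a nonnegative remainder fixed by lower orders.\<close>
  have split: "\<exists>P\<ge>0. fps_nth (E oo H) n = fps_nth E 1 * fps_nth H n + P"
    if E: "\<And>n. n \<ge> 1 \<Longrightarrow> fps_nth E n \<ge> 0" and H0: "fps_nth H 0 = 0"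
      and H: "\<And>k. 1 \<le> k \<Longrightarrow> k < n \<Longrightarrow> fps_nth H k \<ge> 0" for E H :: "real fps"
  proof (intro exI conjI)
    have "{0..n} = {0, 1} \<union> {2..n}" using less.prems by auto
    then have "fps_nth (E oo H) n = fps_nth E 0 * fps_nth (H ^ 0) n + fps_nth E 1 * fps_nth (H ^ 1) n
        + (\<Sum>i=2..n. fps_nth E i * fps_nth (H ^ i) n)"
      unfolding fps_compose_nth by (subst \<open>{0..n} = _\<close>, subst sum.union_disjoint) auto
    then show "fps_nth (E oo H) n = fps_nth E 1 * fps_nth H n + (\<Sum>i=2..n. fps_nth E i * fps_nth (H ^ i) n)"
      using less.prems by (simp add: fps_one_nth)
    show "0 \<le> (\<Sum>i=2..n. fps_nth E i * fps_nth (H ^ i) n)"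
      by (intro sum_nonneg mult_nonneg_nonneg E fps_power_nth_nonneg[OF H0 H]) auto
  qed
  have IH: "fps_nth C k \<ge> 0" "fps_nth D k \<ge> 0" if "1 \<le> k" "k < n" for k
    using less.IH that by auto
  obtain P where P: "P \<ge> 0" "fps_nth (A oo C) n = fps_nth A 1 * fps_nth C n + P"
    using split[OF A C0 IH(1)] by blast
  obtain Q where Q: "Q \<ge> 0" "fps_nth (B oo D) n = fps_nth B 1 * fps_nth D n + Q"
    using split[OF B D0 IH(2)] by blast
  define x where "x = (fps_nth fps_X n :: real)"
  have x: "x \<ge> 0" by (simp add: x_def fps_X_def)
  have d: "fps_nth D n = x + fps_nth A 1 * fps_nth C n + P"
    and c: "fps_nth C n = x + fps_nth B 1 * fps_nth D n + Q"
    using D[OF less.prems] C[OF less.prems] P Q by (simp_all add: x_def)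
  have nn: "fps_nth A 1 \<ge> 0" "fps_nth B 1 \<ge> 0" using A B by auto
  \<comment> \<open>Elimination of the coefficient of D from the two linear equations;
    \<open>det\<close> makes the factor on the left positive.\<close>
  have "(1 - fps_nth A 1 * fps_nth B 1) * fps_nth C n =
      (fps_nth C n - fps_nth B 1 * fps_nth D n) + fps_nth B 1 * (fps_nth D n - fps_nth A 1 * fps_nth C n)"
    by (simp add: algebra_simps)
  also have "fps_nth C n - fps_nth B 1 * fps_nth D n = x + Q" using c by simp
  also have "fps_nth D n - fps_nth A 1 * fps_nth C n = x + P" using d by simp
  also have "x + Q + fps_nth B 1 * (x + P) \<ge> 0" using x P(1) Q(1) nn by simp
  finally have "fps_nth C n \<ge> 0" using det by (simp add: zero_le_mult_iff)
  moreover from this have "fps_nth D n \<ge> 0" unfolding d using x nn P(1) by simp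
  ultimately show ?case by blast
qed

text \<open>A Pringsheim-type argument: the nonnegative coefficients of \<open>w\<close> are dominated by those of
  the sum, whose radius of convergence at points close to \<open>z0\<close> stays bounded from below.\<close>

lemma analytic_extension_of_monotone_summand:
  assumes e: "real_analytic_at e z0" and \<eta>: "\<eta> > 0"
    and sum: "\<And>z. z0 - \<eta> < z \<Longrightarrow> z < z0 \<Longrightarrow> w z + v z = e z"
    and C: "\<And>z. z0 - \<eta> < z \<Longrightarrow> z < z0 \<Longrightarrow>
      \<exists>C D. (\<lambda>y. w (z + y)) has_fps_expansion C \<and> (\<lambda>y. v (z + y)) has_fps_expansion D \<and>
        (\<forall>n\<ge>1. fps_nth C n \<ge> 0 \<and> fps_nth D n \<ge> 0)"
  obtains W where "real_analytic_at W z0" "eventually (\<lambda>z. W z = w z) (at_left z0)"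
proof -
  obtain r0 a where r0: "r0 > 0"
    and a: "\<And>y. \<bar>y - z0\<bar> < r0 \<Longrightarrow> (\<lambda>n. a n * (y - z0) ^ n) sums e y"
    using e by (auto simp: real_analytic_on_def)
  define r where "r = min r0 \<eta>"
  have r: "r > 0" "r \<le> r0" "r \<le> \<eta>" using r0 \<eta> by (auto simp: r_def)
  define z where "z = z0 - r / 4"
  have z: "\<bar>z - z0\<bar> < r" "z0 - \<eta> < z" "z < z0" using r by (auto simp: z_def)
  have "\<And>y. \<bar>y - z0\<bar> < r \<Longrightarrow> (\<lambda>n. a n * (y - z0) ^ n) sums e y"
    using a r by simp
  from real_power_series_reexpand[OF this z(1)]
  obtain b where "\<And>y. \<bar>y - z\<bar> < r - \<bar>z - z0\<bar> \<Longrightarrow> (\<lambda>n. b n * (y - z) ^ n) sums e y" by blast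
  then have b: "\<And>y. \<bar>y - z\<bar> < 3 * r / 4 \<Longrightarrow> (\<lambda>n. b n * (y - z) ^ n) sums e y"
    using r by (simp add: z_def)
  obtain C D where CD: "(\<lambda>y. w (z + y)) has_fps_expansion C" "(\<lambda>y. v (z + y)) has_fps_expansion D"
    "\<And>n. n \<ge> 1 \<Longrightarrow> fps_nth C n \<ge> 0" "\<And>n. n \<ge> 1 \<Longrightarrow> fps_nth D n \<ge> 0"
    using C[OF z(2,3)] by blast
  obtain s where s: "s > 0" "\<And>y. \<bar>y - z\<bar> < s \<Longrightarrow> (\<lambda>n. fps_nth C n * (y - z) ^ n) sums w y"
    using real_fps_expansionD[OF CD(1)] by blast
  obtain t where t: "t > 0" "\<And>y. \<bar>y - z\<bar> < t \<Longrightarrow> (\<lambda>n. fps_nth D n * (y - z) ^ n) sums v y"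
    using real_fps_expansionD[OF CD(2)] by blast
  define q where "q = min (min s t) (r / 4)"
  have q: "q > 0" "q \<le> s" "q \<le> t" "q \<le> r / 4" using s t r by (auto simp: q_def)
  have bn: "fps_nth C n + fps_nth D n = b n" for n
  proof (rule real_power_series_unique)
    show "0 < q" "0 < 3 * r / 4" using q r by auto
    show "(\<lambda>n. b n * (y - z) ^ n) sums e y" if "\<bar>y - z\<bar> < 3 * r / 4" for y by (rule b[OF that])
    fix y assume y: "\<bar>y - z\<bar> < q"
    then have "\<bar>y - z\<bar> < r / 4" using q by simp
    then have "z0 - \<eta> < y" "y < z0" using r unfolding z_def abs_less_iff by linarith+
    then have "e y = w y + v y" using sum[of y] by simp
    then show "(\<lambda>n. (fps_nth C n + fps_nth D n) * (y - z) ^ n) sums e y"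
      using sums_add[OF s(2)[of y] t(2)[of y]] y q by (simp add: distrib_right)
  qed
  define W where "W = (\<lambda>y. \<Sum>n. fps_nth C n * (y - z) ^ n)"
  have W: "(\<lambda>n. fps_nth C n * (y - z) ^ n) sums W y" if y: "\<bar>y - z\<bar> < 3 * r / 4" for y
  proof -
    obtain p where p: "\<bar>y - z\<bar> < p" "p < 3 * r / 4" using dense[OF y] by blast
    have "summable (\<lambda>n. b n * p ^ n)"
      using b[of "z + p"] p by (auto simp: sums_iff)
    then have "summable (\<lambda>n. fps_nth C n * p ^ n)"
    \<comment> \<open>The constant coefficients may be negative, so the comparison starts at index
      1.\<close>
    proof (rule summable_comparison_test'[where N = 1])
      fix n :: nat assume n: "n \<ge> 1"
      have "p \<ge> 0" using p by linarith
      then have "norm (fps_nth C n * p ^ n) = fps_nth C n * p ^ n" using CD(3)[OF n] by simp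
      also have "\<dots> \<le> b n * p ^ n"
        using bn[of n] CD(4)[OF n] \<open>p \<ge> 0\<close> by (intro mult_right_mono) auto
      finally show "norm (fps_nth C n * p ^ n) \<le> b n * p ^ n" .
    qed
    then have "summable (\<lambda>n. fps_nth C n * (y - z) ^ n)"
      by (rule powser_inside) (use p in auto)
    then show ?thesis unfolding W_def by (rule summable_sums)
  qed
  show ?thesis
  proof (rule that[of W])
    show "real_analytic_at W z0"
      by (rule real_analytic_power_series[where r = "3 * r / 4", OF W]) (use r in \<open>auto simp: z_def\<close>)
    have "W y = w y" if y: "y \<in> {z0 - 3 * r / 4<..<z0}" for y
    proof (rule real_analytic_identity[of W "{z0 - 3 * r / 4<..<z0}" w z])
      show "real_analytic_on W {z0 - 3 * r / 4<..<z0}"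
        by (rule real_analytic_onI, rule real_analytic_power_series[where r = "3 * r / 4", OF W]) (auto simp: z_def abs_less_iff field_simps)
      show "real_analytic_on w {z0 - 3 * r / 4<..<z0}"
      proof (rule real_analytic_onI)
        fix x assume x: "x \<in> {z0 - 3 * r / 4<..<z0}"
        then have "z0 - \<eta> < x" "x < z0" using r by auto
        from C[OF this] show "real_analytic_at w x" unfolding real_analytic_at_iff_fps by blast
      qed
      show "eventually (\<lambda>y. W y = w y) (nhds z)"
        unfolding eventually_nhds_metric
      proof (intro exI[of _ q] conjI allI impI)
        fix y assume "dist y z < q"
        then have "\<bar>y - z\<bar> < s" "\<bar>y - z\<bar> < 3 * r / 4" using q by (auto simp: dist_norm)
        then show "W y = w y" using s(2) W sums_unique2 by blast
      qed (rule q(1))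
    qed (use y r in \<open>auto simp: z_def\<close>)
    then show "eventually (\<lambda>z. W z = w z) (at_left z0)"
      using r by (intro eventually_at_leftI[of "z0 - 3 * r / 4"]) auto
  qed
qed

subsection \<open>Stieltjes transforms outside the support\<close>

lemma tendsto_at_left_SUP:
  fixes f :: "real \<Rightarrow> ereal"
  assumes "c < a" and mono: "\<And>x y. c < x \<Longrightarrow> x \<le> y \<Longrightarrow> y < a \<Longrightarrow> f x \<le> f y"
  shows "(f \<longlongrightarrow> (SUP x\<in>{c<..<a}. f x)) (at_left a)"
proof (rule order_tendstoI)
  fix y assume "y < (SUP x\<in>{c<..<a}. f x)"
  then obtain z where z: "c < z" "z < a" "y < f z" by (auto simp: less_SUP_iff)
  have "eventually (\<lambda>x. x \<in> {z<..<a}) (at_left a)"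
    using z by (intro eventually_at_leftI[of z]) auto
  then show "eventually (\<lambda>x. y < f x) (at_left a)"
  proof eventually_elim
    case (elim x)
    then show ?case using z mono[of z x] by (auto intro: less_le_trans)
  qed
next
  fix y assume y: "(SUP x\<in>{c<..<a}. f x) < y"
  have "eventually (\<lambda>x. x \<in> {c<..<a}) (at_left a)"
    using \<open>c < a\<close> by (intro eventually_at_leftI[of c]) auto
  then show "eventually (\<lambda>x. f x < y) (at_left a)"
    by eventually_elim (use y in \<open>meson SUP_upper le_less_trans\<close>)
qed

lemma tendsto_at_right_INF:
  fixes f :: "real \<Rightarrow> ereal"
  assumes "a < c" and mono: "\<And>x y. a < x \<Longrightarrow> x \<le> y \<Longrightarrow> y < c \<Longrightarrow> f x \<le> f y"
  shows "(f \<longlongrightarrow> (INF x\<in>{a<..<c}. f x)) (at_right a)"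
proof (rule order_tendstoI)
  fix y assume "(INF x\<in>{a<..<c}. f x) < y"
  then obtain z where z: "a < z" "z < c" "f z < y" by (auto simp: INF_less_iff)
  have "eventually (\<lambda>x. x \<in> {a<..<z}) (at_right a)"
    using z by (intro eventually_at_rightI[of _ z]) auto
  then show "eventually (\<lambda>x. f x < y) (at_right a)"
  proof eventually_elim
    case (elim x)
    then show ?case using z mono[of x z] by (auto intro: le_less_trans)
  qed
next
  fix y assume y: "y < (INF x\<in>{a<..<c}. f x)"
  have "eventually (\<lambda>x. x \<in> {a<..<c}) (at_right a)"
    using \<open>a < c\<close> by (intro eventually_at_rightI[of _ c]) auto
  then show "eventually (\<lambda>x. y < f x) (at_right a)"
    by eventually_elim (use y in \<open>meson INF_lower less_le_trans\<close>)
qed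

text \<open>With index \<open>Suc n\<close> this is the Taylor coefficient of order n of
  \<open>stieltjes \<rho>\<close> at z. Index 0 is the total mass 1 and starts the log-convex
  sequence.\<close>

definition inverse_moment :: "real measure \<Rightarrow> nat \<Rightarrow> real \<Rightarrow> real" where
  "inverse_moment \<rho> k z = (\<integral>x. 1 / (x - z) ^ k \<partial>\<rho>)"

lemma stieltjes_eq_inverse_moment: "stieltjes \<rho> z = inverse_moment \<rho> 1 z"
  by (simp add: stieltjes_def inverse_moment_def)

lemma integral_linear_comb3:
  fixes f g h :: "'a \<Rightarrow> real"
  assumes "integrable M f" "integrable M g" "integrable M h"
  shows "(\<integral>x. a * f x + b * g x + c * h x \<partial>M) = a * integral\<^sup>L M f + b * integral\<^sup>L M g + c * integral\<^sup>L M h"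
  using assms by simp

text \<open>Termwise integration under a geometric bound; it serves the expansion of the Stieltjes
  transform at finite points as well as at infinity.\<close>

lemma (in prob_space) integral_sums_geometric:
  fixes f :: "nat \<Rightarrow> 'a \<Rightarrow> real"
  assumes int: "\<And>n. integrable M (f n)" and q: "0 \<le> q" "q < 1"
    and bound: "AE x in M. \<forall>n. \<bar>f n x\<bar> \<le> C * q ^ n"
    and g: "g \<in> borel_measurable M" and sums: "AE x in M. (\<lambda>n. f n x) sums g x"
  shows "(\<lambda>n. integral\<^sup>L M (f n)) sums integral\<^sup>L M g"
proof -
  have geo: "summable (\<lambda>n. C * q ^ n)" using q by (intro summable_mult summable_geometric) auto
  have "(\<lambda>n. integral\<^sup>L M (f n)) sums (\<integral>x. (\<Sum>n. f n x) \<partial>M)"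
  proof (rule sums_integral[OF int])
    show "AE x in M. summable (\<lambda>n. norm (f n x))"
      using bound
    proof eventually_elim
      case (elim x)
      show ?case
        by (rule summable_comparison_test'[OF geo, of 0]) (use elim in auto)
    qed
    show "summable (\<lambda>n. \<integral>x. norm (f n x) \<partial>M)"
    proof (rule summable_comparison_test'[OF geo, of 0])
      fix n
      have "(\<integral>x. norm (f n x) \<partial>M) \<le> C * q ^ n"
        using bound int[of n] by (intro integral_le_const integrable_norm) (auto elim: eventually_mono)
      then show "norm (\<integral>x. norm (f n x) \<partial>M) \<le> C * q ^ n" by simp
    qed
  qed
  also have "(\<integral>x. (\<Sum>n. f n x) \<partial>M) = integral\<^sup>L M g"
    using sums g int by (intro integral_cong_AE borel_measurable_suminf) (auto simp: sums_iff)
  finally show ?thesis .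
qed

section \<open>Support and edges of a compactly supported probability measure\<close>

locale compact_prob = prob_space \<rho> for \<rho> :: "real measure" +
  assumes sets_eq [measurable_cong, simp]: "sets \<rho> = sets borel"
    and compact_support: "compact (measure_support \<rho>)"

lemma compact_prob_iff: "compact_prob \<rho> \<longleftrightarrow> compactly_supported_prob \<rho>"
  by (auto simp: compact_prob_def compact_prob_axioms_def compactly_supported_prob_def)

context compact_prob
begin

lemma space_eq [simp]: "space \<rho> = UNIV"
  using sets_eq_imp_space_eq[OF sets_eq] by simp

text \<open>Every point off the support has a basic open neighbourhood of measure zero, and a
  countable basis has only countably many of these.\<close>

lemma AE_support: "AE x in \<rho>. x \<in> measure_support \<rho>"
proof -
  obtain B :: "real set set" where B: "countable B" "topological_basis B"
    using ex_countable_basis by blast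
  define N where "N = (\<Union>U\<in>{U\<in>B. emeasure \<rho> U = 0}. U)"
  have "N \<in> null_sets \<rho>"
    unfolding N_def
  proof (rule null_sets_UN')
    fix U assume "U \<in> {U\<in>B. emeasure \<rho> U = 0}"
    then show "U \<in> null_sets \<rho>"
      using topological_basis_open[OF B(2)] by (auto intro!: null_setsI)
  qed (use B(1) in auto)
  moreover have "{x \<in> space \<rho>. x \<notin> measure_support \<rho>} \<subseteq> N"
  proof safe
    fix x assume "x \<notin> measure_support \<rho>"
    then obtain U where "open U" "x \<in> U" "emeasure \<rho> U = 0"
      by (auto simp: measure_support_def zero_less_iff_neq_zero)
    moreover from this obtain V where V: "V \<in> B" "x \<in> V" "V \<subseteq> U"
      using B(2) topological_basisE by blast
    ultimately have "emeasure \<rho> V = 0"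
      by (metis emeasure_mono borel_open sets_eq le_zero_eq)
    with V show "x \<in> N" by (auto simp: N_def)
  qed
  ultimately show ?thesis by (rule AE_I')
qed

lemma support_nonempty: "measure_support \<rho> \<noteq> {}"
  using AE_support AE_False by fastforce

lemma AE_bounds: "AE x in \<rho>. supp_minus \<rho> \<le> x \<and> x \<le> supp_plus \<rho>"
  using AE_support
proof eventually_elim
  case (elim x)
  then show ?case
    using compact_imp_bounded[OF compact_support]
    by (auto simp: supp_minus_def supp_plus_def intro!: cInf_lower cSup_upper
        bounded_imp_bdd_below bounded_imp_bdd_above)
qed

lemma supp_minus_le_plus: "supp_minus \<rho> \<le> supp_plus \<rho>"
proof -
  have "AE x in \<rho>. supp_minus \<rho> \<le> supp_plus \<rho>"
    using AE_bounds by eventually_elim simp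
  then show ?thesis by simp
qed

text \<open>A compact nonempty support contains its infimum, so every interval about the edge has
  mass, and none of it lies to the left. This positive mass is what prevents an analytic extension
  across the edge.\<close>

lemma prob_edge_pos:
  assumes "e > 0"
  shows "prob {supp_minus \<rho>..<supp_minus \<rho> + e} > 0"
proof -
  let ?a = "supp_minus \<rho>"
  have "?a \<in> measure_support \<rho>"
    unfolding supp_minus_def
    using compact_support support_nonempty
    by (intro closed_contains_Inf) (auto intro: compact_imp_closed bounded_imp_bdd_below compact_imp_bounded)
  then have "emeasure \<rho> {?a - e<..<?a + e} > 0"
    using assms by (auto simp: measure_support_def)
  also have "emeasure \<rho> {?a - e<..<?a + e} = emeasure \<rho> {?a..<?a + e}"
    using AE_bounds by (intro emeasure_eq_AE) (auto elim: eventually_mono)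
  finally show ?thesis by (simp add: emeasure_eq_measure)
qed

section \<open>Taylor expansion and inverse moments\<close>

lemma integrable_inverse_power:
  assumes "d > 0" "AE x in \<rho>. d \<le> \<bar>x - z\<bar>"
  shows "integrable \<rho> (\<lambda>x. 1 / (x - z) ^ k)"
proof (rule integrable_const_bound)
  show "AE x in \<rho>. norm (1 / (x - z) ^ k) \<le> (1 / d) ^ k"
    using assms(2)
  proof eventually_elim
    case (elim x)
    then have "1 / \<bar>x - z\<bar> \<le> 1 / d" using assms(1) by (intro divide_left_mono) auto
    then have "(1 / \<bar>x - z\<bar>) ^ k \<le> (1 / d) ^ k" by (intro power_mono) auto
    then show ?case by (simp add: power_one_over power_abs abs_divide)
  qed
qed measurable

text \<open>Expand 1 / (x - y) as a geometric series in (y - z) / (x - z) and integrate; the gap d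
  between z and the measure bounds the ratio.\<close>

lemma stieltjes_sums:
  assumes d: "d > 0" "AE x in \<rho>. d \<le> \<bar>x - z\<bar>" and y: "\<bar>y - z\<bar> < d"
  shows "(\<lambda>n. inverse_moment \<rho> (Suc n) z * (y - z) ^ n) sums stieltjes \<rho> y"
proof -
  define q where "q = \<bar>y - z\<bar> / d"
  have q: "0 \<le> q" "q < 1" using d(1) y by (auto simp: q_def)
  let ?f = "\<lambda>n x. (y - z) ^ n * (1 / (x - z) ^ Suc n)"
  have "(\<lambda>n. integral\<^sup>L \<rho> (?f n)) sums stieltjes \<rho> y"
    unfolding stieltjes_def
  proof (rule integral_sums_geometric[OF _ q])
    show "integrable \<rho> (?f n)" for n
      by (intro integrable_mult_right integrable_inverse_power[OF d])
    show "AE x in \<rho>. \<forall>n. \<bar>?f n x\<bar> \<le> 1 / d * q ^ n"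
      using d(2)
    proof eventually_elim
      case (elim x)
      show ?case
      proof
        fix n
        have "\<bar>?f n x\<bar> = \<bar>y - z\<bar> ^ n / \<bar>x - z\<bar> ^ Suc n"
          by (simp add: abs_mult power_abs abs_divide)
        also have "\<dots> \<le> \<bar>y - z\<bar> ^ n / d ^ Suc n"
          using elim d(1) by (intro divide_left_mono power_mono mult_pos_pos zero_less_power) auto
        finally show "\<bar>?f n x\<bar> \<le> 1 / d * q ^ n" by (simp add: q_def power_divide mult.commute)
      qed
    qed
    show "AE x in \<rho>. (\<lambda>n. ?f n x) sums (1 / (x - y))"
      using d(2)
    proof eventually_elim
      case (elim x)
      let ?r = "(y - z) / (x - z)"
      have "x \<noteq> z" "\<bar>y - z\<bar> < \<bar>x - z\<bar>" using elim d(1) y by auto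
      then have "norm ?r < 1" by (simp add: abs_divide)
      from sums_mult[OF geometric_sums[OF this], of "1 / (x - z)"]
      have "(\<lambda>n. 1 / (x - z) * ?r ^ n) sums (1 / (x - z) * (1 / (1 - ?r)))" .
      moreover have "1 / (x - z) * (1 / (1 - ?r)) = 1 / (x - y)"
        using \<open>x \<noteq> z\<close> by (simp add: divide_simps)
      moreover have "(\<lambda>n. 1 / (x - z) * ?r ^ n) = (\<lambda>n. ?f n x)"
        by (simp add: power_divide)
      ultimately show ?case by simp
    qed
  qed measurable
  also have "(\<lambda>n. integral\<^sup>L \<rho> (?f n)) = (\<lambda>n. inverse_moment \<rho> (Suc n) z * (y - z) ^ n)"
    by (subst integral_mult_right_zero) (simp add: inverse_moment_def mult.commute)
  finally show ?thesis .
qed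

lemma AE_dist_left: "AE x in \<rho>. supp_minus \<rho> - z \<le> \<bar>x - z\<bar>"
  and AE_dist_right: "AE x in \<rho>. z - supp_plus \<rho> \<le> \<bar>x - z\<bar>"
  using AE_bounds by (eventually_elim; linarith)+

lemma outside_gap:
  assumes "z \<notin> {supp_minus \<rho>..supp_plus \<rho>}"
  obtains d where "d > 0" "AE x in \<rho>. d \<le> \<bar>x - z\<bar>"
proof (cases "z < supp_minus \<rho>")
  case True
  then show ?thesis by (intro that[OF _ AE_dist_left]) auto
next
  case False
  then show ?thesis using assms by (intro that[OF _ AE_dist_right]) auto
qed

lemma real_analytic_stieltjes:
  assumes "z \<notin> {supp_minus \<rho>..supp_plus \<rho>}"
  shows "real_analytic_at (stieltjes \<rho>) z"
proof -
  obtain d where d: "d > 0" "AE x in \<rho>. d \<le> \<bar>x - z\<bar>" using outside_gap[OF assms] .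
  have "\<forall>y. \<bar>y - z\<bar> < d \<longrightarrow> (\<lambda>n. inverse_moment \<rho> (Suc n) z * (y - z) ^ n) sums stieltjes \<rho> y"
    using stieltjes_sums[OF d] by blast
  then have "\<exists>r>0. \<exists>a. \<forall>y. \<bar>y - z\<bar> < r \<longrightarrow> (\<lambda>n. a n * (y - z) ^ n) sums stieltjes \<rho> y"
    using d(1) by (intro exI[of _ d] conjI exI[of _ "\<lambda>n. inverse_moment \<rho> (Suc n) z"])
  then show ?thesis by (simp add: real_analytic_on_def)
qed

lemma has_fps_expansion_stieltjes:
  assumes "z \<notin> {supp_minus \<rho>..supp_plus \<rho>}"
  shows "(\<lambda>y. stieltjes \<rho> (z + y)) has_fps_expansion Abs_fps (\<lambda>n. inverse_moment \<rho> (Suc n) z)"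
proof (rule has_fps_expansionI)
  obtain d where d: "d > 0" "AE x in \<rho>. d \<le> \<bar>x - z\<bar>" using outside_gap[OF assms] .
  have "eventually (\<lambda>u. u \<in> ball 0 d) (nhds (0::real))"
    using d by (intro eventually_nhds_in_open) auto
  then show "eventually (\<lambda>u. (\<lambda>n. fps_nth (Abs_fps (\<lambda>n. inverse_moment \<rho> (Suc n) z)) n * u ^ n)
      sums stieltjes \<rho> (z + u)) (nhds 0)"
    by eventually_elim (use stieltjes_sums[OF d, of "z + u" for u] in simp)
qed

lemma stieltjes_has_derivative:
  assumes "z \<notin> {supp_minus \<rho>..supp_plus \<rho>}"
  shows "(stieltjes \<rho> has_real_derivative inverse_moment \<rho> 2 z) (at z)"
  using has_real_derivative_fps[OF has_fps_expansion_stieltjes[OF assms]] by (simp add: numeral_2_eq_2)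

lemma inverse_moment_2_pos:
  assumes "z \<notin> {supp_minus \<rho>..supp_plus \<rho>}"
  shows "inverse_moment \<rho> 2 z > 0"
proof -
  obtain d where d: "d > 0" "AE x in \<rho>. d \<le> \<bar>x - z\<bar>" using outside_gap[OF assms] .
  define D where "D = max \<bar>supp_plus \<rho> - z\<bar> \<bar>supp_minus \<rho> - z\<bar>"
  have D: "AE x in \<rho>. 1 / D\<^sup>2 \<le> 1 / (x - z) ^ 2"
    using AE_bounds d(2)
  proof eventually_elim
    case (elim x)
    then have "\<bar>x - z\<bar> \<le> D" unfolding D_def by linarith
    then have "(x - z)\<^sup>2 \<le> D\<^sup>2" by (metis abs_ge_zero power2_abs power_mono)
    moreover have "(x - z)\<^sup>2 > 0" using elim d(1) by auto
    ultimately show ?case by (intro divide_left_mono mult_pos_pos) auto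
  qed
  have "D > 0" using assms supp_minus_le_plus by (auto simp: D_def)
  then have "0 < 1 / D\<^sup>2" by simp
  also have "\<dots> \<le> inverse_moment \<rho> 2 z"
    unfolding inverse_moment_def
    by (intro integral_ge_const integrable_inverse_power[OF d] D)
  finally show ?thesis .
qed

lemma inverse_moment_pos:
  assumes "z < supp_minus \<rho>"
  shows "inverse_moment \<rho> k z > 0"
proof -
  let ?D = "supp_plus \<rho> - z"
  have "?D > 0" using assms supp_minus_le_plus by simp
  then have "0 < 1 / ?D ^ k" by simp
  also have "\<dots> \<le> inverse_moment \<rho> k z"
    unfolding inverse_moment_def
  proof (intro integral_ge_const integrable_inverse_power[OF _ AE_dist_left])
    show "AE x in \<rho>. 1 / ?D ^ k \<le> 1 / (x - z) ^ k"
      using AE_bounds by eventually_elim (use assms in \<open>auto intro!: divide_left_mono power_mono mult_pos_pos\<close>)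
  qed (use assms in auto)
  finally show ?thesis .
qed

lemma inverse_moment_0 [simp]: "inverse_moment \<rho> 0 z = 1"
  using prob_space by (simp add: inverse_moment_def)

text \<open>Cauchy-Schwarz, read off from the integral of u^k * (a - b * u)^2 >= 0 with u = 1 / (x -
  z), where a and b are the moments of index k + 1 and k. For k = 0 it says that the square of
  \<open>stieltjes \<rho> z\<close> is at most the second inverse moment.\<close>

lemma inverse_moment_log_convex:
  assumes z: "z < supp_minus \<rho>"
  shows "(inverse_moment \<rho> (Suc k) z)\<^sup>2 \<le> inverse_moment \<rho> k z * inverse_moment \<rho> (Suc (Suc k)) z"
proof -
  have int: "integrable \<rho> (\<lambda>x. 1 / (x - z) ^ j)" for j
    using z by (intro integrable_inverse_power[OF _ AE_dist_left]) auto
  let ?M = "\<lambda>j. inverse_moment \<rho> j z"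
  define a where "a = ?M (Suc k)"
  define b where "b = ?M k"
  have b: "b > 0" using inverse_moment_pos[OF z] by (simp add: b_def)
  have "0 \<le> (\<integral>x. a\<^sup>2 * (1 / (x - z) ^ k) - 2 * a * b * (1 / (x - z) ^ Suc k)
      + b\<^sup>2 * (1 / (x - z) ^ Suc (Suc k)) \<partial>\<rho>)"
  proof (rule integral_nonneg_AE)
    show "AE x in \<rho>. 0 \<le> a\<^sup>2 * (1 / (x - z) ^ k) - 2 * a * b * (1 / (x - z) ^ Suc k)
      + b\<^sup>2 * (1 / (x - z) ^ Suc (Suc k))"
      using AE_bounds
    proof eventually_elim
      case (elim x)
      define u where "u = 1 / (x - z)"
      have "u \<ge> 0" using elim z by (simp add: u_def)
      then have "0 \<le> u ^ k * (a - b * u)\<^sup>2" by simp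
      also have "\<dots> = a\<^sup>2 * u ^ k - 2 * a * b * u ^ Suc k + b\<^sup>2 * u ^ Suc (Suc k)"
        by (simp add: algebra_simps power2_eq_square)
      finally show ?case by (simp only: u_def power_one_over)
    qed
  qed
  also have "\<dots> = a\<^sup>2 * ?M k - 2 * a * b * ?M (Suc k) + b\<^sup>2 * ?M (Suc (Suc k))"
    unfolding inverse_moment_def
    using integral_linear_comb3[OF int int int, of "a\<^sup>2" k "- 2 * a * b" "Suc k" "b\<^sup>2" "Suc (Suc k)"]
    by simp
  also have "\<dots> = b * (b * ?M (Suc (Suc k)) - a\<^sup>2)"
    by (simp add: a_def[symmetric] b_def[symmetric] algebra_simps power2_eq_square)
  finally show ?thesis using b by (simp add: zero_le_mult_iff a_def b_def)
qed

section \<open>Sign, monotonicity and bounds on the two outer branches\<close>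

lemma stieltjes_pos: "z < supp_minus \<rho> \<Longrightarrow> stieltjes \<rho> z > 0"
  by (simp add: stieltjes_eq_inverse_moment inverse_moment_pos)

lemma stieltjes_neg:
  assumes "supp_plus \<rho> < z"
  shows "stieltjes \<rho> z < 0"
proof -
  let ?D = "supp_minus \<rho> - z"
  have "?D < 0" using assms supp_minus_le_plus by simp
  have "stieltjes \<rho> z \<le> 1 / ?D"
    unfolding stieltjes_def
  proof (intro integral_le_const integrable_inverse_power[OF _ AE_dist_right, of _ 1, simplified])
    show "AE x in \<rho>. 1 / (x - z) \<le> 1 / ?D"
      using AE_bounds by eventually_elim (use assms in \<open>auto simp: divide_simps mult_neg_neg\<close>)
  qed (use assms in auto)
  also have "1 / ?D < 0" using \<open>?D < 0\<close> by simp
  finally show ?thesis .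
qed

lemma stieltjes_less_left:
  assumes "x < y" "y < supp_minus \<rho>"
  shows "stieltjes \<rho> x < stieltjes \<rho> y"
proof (rule DERIV_pos_imp_increasing[OF assms(1)])
  fix t assume "x \<le> t" "t \<le> y"
  then have "t \<notin> {supp_minus \<rho>..supp_plus \<rho>}" using assms by auto
  then show "\<exists>d. (stieltjes \<rho> has_real_derivative d) (at t) \<and> 0 < d"
    using stieltjes_has_derivative inverse_moment_2_pos by blast
qed

lemma stieltjes_less_right:
  assumes "x < y" "supp_plus \<rho> < x"
  shows "stieltjes \<rho> x < stieltjes \<rho> y"
proof (rule DERIV_pos_imp_increasing[OF assms(1)])
  fix t assume "x \<le> t" "t \<le> y"
  then have "t \<notin> {supp_minus \<rho>..supp_plus \<rho>}" using assms by auto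
  then show "\<exists>d. (stieltjes \<rho> has_real_derivative d) (at t) \<and> 0 < d"
    using stieltjes_has_derivative inverse_moment_2_pos by blast
qed

lemma stieltjes_inj_on: "inj_on (stieltjes \<rho>) (- {supp_minus \<rho>..supp_plus \<rho>})"
proof (rule linorder_inj_onI')
  fix x y assume "x \<in> - {supp_minus \<rho>..supp_plus \<rho>}" "y \<in> - {supp_minus \<rho>..supp_plus \<rho>}" "x < y"
  then consider "y < supp_minus \<rho>" | "supp_plus \<rho> < x" | "x < supp_minus \<rho>" "supp_plus \<rho> < y"
    by force
  then show "stieltjes \<rho> x \<noteq> stieltjes \<rho> y"
  proof cases
    case 1
    then show ?thesis using stieltjes_less_left[OF \<open>x < y\<close>] by simp
  next
    case 2
    then show ?thesis using stieltjes_less_right[OF \<open>x < y\<close>] by simp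
  next
    case 3
    then show ?thesis using stieltjes_pos[of x] stieltjes_neg[of y] by simp
  qed
qed

lemma stieltjes_inv_stieltjes:
  "z \<notin> {supp_minus \<rho>..supp_plus \<rho>} \<Longrightarrow> stieltjes_inv \<rho> (stieltjes \<rho> z) = z"
  unfolding stieltjes_inv_def by (intro inv_into_f_f stieltjes_inj_on) auto

lemma continuous_on_stieltjes:
  "S \<inter> {supp_minus \<rho>..supp_plus \<rho>} = {} \<Longrightarrow> continuous_on S (stieltjes \<rho>)"
  by (intro continuous_at_imp_continuous_on ballI DERIV_isCont[OF stieltjes_has_derivative]) auto

lemma stieltjes_le_left:
  assumes "z < supp_minus \<rho>"
  shows "stieltjes \<rho> z \<le> 1 / (supp_minus \<rho> - z)"
  unfolding stieltjes_def
proof (intro integral_le_const integrable_inverse_power[OF _ AE_dist_left, of _ 1, simplified])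
  show "AE x in \<rho>. 1 / (x - z) \<le> 1 / (supp_minus \<rho> - z)"
    using AE_bounds
  proof eventually_elim
    case (elim x)
    with assms show ?case by (intro divide_left_mono) auto
  qed
qed (use assms in auto)

lemma stieltjes_ge_right:
  assumes "supp_plus \<rho> < z"
  shows "- (1 / (z - supp_plus \<rho>)) \<le> stieltjes \<rho> z"
  unfolding stieltjes_def
proof (intro integral_ge_const integrable_inverse_power[OF _ AE_dist_right, of _ 1, simplified])
  show "AE x in \<rho>. - (1 / (z - supp_plus \<rho>)) \<le> 1 / (x - z)"
    using AE_bounds
  proof eventually_elim
    case (elim x)
    with assms have "1 / (z - x) \<le> 1 / (z - supp_plus \<rho>)" by (intro divide_left_mono) auto
    moreover have "1 / (x - z) = - (1 / (z - x))" using elim assms by (simp add: divide_simps)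
    ultimately show ?case by simp
  qed
qed (use assms in auto)

subsection \<open>The R-transform\<close>

text \<open>\<open>Lim\<close> in the definition carries information only once a limit exists;
  monotonicity provides it, as a supremum. The length 1 of the window is arbitrary.\<close>

lemma stieltjes_left_tendsto:
  "((\<lambda>z. ereal (stieltjes \<rho> z)) \<longlongrightarrow> stieltjes_left \<rho> (supp_minus \<rho>)) (at_left (supp_minus \<rho>))"
  and stieltjes_left_eq_SUP:
  "stieltjes_left \<rho> (supp_minus \<rho>) = (SUP z\<in>{supp_minus \<rho> - 1<..<supp_minus \<rho>}. ereal (stieltjes \<rho> z))"
proof -
  let ?a = "supp_minus \<rho>"
  have *: "((\<lambda>z. ereal (stieltjes \<rho> z)) \<longlongrightarrow> (SUP z\<in>{?a - 1<..<?a}. ereal (stieltjes \<rho> z))) (at_left ?a)"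
    using stieltjes_less_left by (intro tendsto_at_left_SUP) (auto simp: le_less)
  then show eq: "stieltjes_left \<rho> ?a = (SUP z\<in>{?a - 1<..<?a}. ereal (stieltjes \<rho> z))"
    unfolding stieltjes_left_def by (simp add: tendsto_Lim)
  show "((\<lambda>z. ereal (stieltjes \<rho> z)) \<longlongrightarrow> stieltjes_left \<rho> ?a) (at_left ?a)"
    using * eq by simp
qed

lemma stieltjes_right_eq_INF:
  "stieltjes_right \<rho> (supp_plus \<rho>) = (INF z\<in>{supp_plus \<rho><..<supp_plus \<rho> + 1}. ereal (stieltjes \<rho> z))"
proof -
  let ?b = "supp_plus \<rho>"
  have "((\<lambda>z. ereal (stieltjes \<rho> z)) \<longlongrightarrow> (INF z\<in>{?b<..<?b + 1}. ereal (stieltjes \<rho> z))) (at_right ?b)"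
    using stieltjes_less_right by (intro tendsto_at_right_INF) (auto simp: le_less)
  then show ?thesis
    unfolding stieltjes_right_def by (simp add: tendsto_Lim)
qed

lemma stieltjes_less_stieltjes_left:
  assumes "z < supp_minus \<rho>"
  shows "ereal (stieltjes \<rho> z) < stieltjes_left \<rho> (supp_minus \<rho>)"
proof -
  let ?a = "supp_minus \<rho>"
  \<comment> \<open>A point strictly between z and the edge that also lies in the window of the
    supremum.\<close>
  define y where "y = max ((z + ?a) / 2) (?a - 1 / 2)"
  have y: "z < y" "?a - 1 < y" "y < ?a" using assms by (auto simp: y_def max_def field_simps)
  have "ereal (stieltjes \<rho> z) < ereal (stieltjes \<rho> y)"
    using stieltjes_less_left[OF y(1,3)] by simp
  also have "\<dots> \<le> stieltjes_left \<rho> ?a"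
    unfolding stieltjes_left_eq_SUP using y by (intro SUP_upper) auto
  finally show ?thesis .
qed

lemma stieltjes_right_less_stieltjes:
  assumes "supp_plus \<rho> < z"
  shows "stieltjes_right \<rho> (supp_plus \<rho>) < ereal (stieltjes \<rho> z)"
proof -
  let ?b = "supp_plus \<rho>"
  define y where "y = min ((z + ?b) / 2) (?b + 1 / 2)"
  have y: "y < z" "y < ?b + 1" "?b < y" using assms by (auto simp: y_def min_def field_simps)
  have "stieltjes_right \<rho> ?b \<le> ereal (stieltjes \<rho> y)"
    unfolding stieltjes_right_eq_INF using y by (intro INF_lower) auto
  also have "\<dots> < ereal (stieltjes \<rho> z)"
    using stieltjes_less_right[OF y(1,3)] by simp
  finally show ?thesis .
qed

lemma stieltjes_left_pos: "0 < stieltjes_left \<rho> (supp_minus \<rho>)"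
proof -
  let ?z = "supp_minus \<rho> - 1"
  have "(0::ereal) < ereal (stieltjes \<rho> ?z)"
    using stieltjes_pos[of ?z] by simp
  also have "\<dots> < stieltjes_left \<rho> (supp_minus \<rho>)"
    by (rule stieltjes_less_stieltjes_left) simp
  finally show ?thesis .
qed

lemma stieltjes_right_neg: "stieltjes_right \<rho> (supp_plus \<rho>) < 0"
proof -
  let ?z = "supp_plus \<rho> + 1"
  have "stieltjes_right \<rho> (supp_plus \<rho>) < ereal (stieltjes \<rho> ?z)"
    by (rule stieltjes_right_less_stieltjes) simp
  also have "\<dots> < 0"
    using stieltjes_neg[of ?z] by simp
  finally show ?thesis .
qed

lemma stieltjes_attains_left:
  assumes "0 < t" "ereal t < stieltjes_left \<rho> (supp_minus \<rho>)"
  obtains z where "z < supp_minus \<rho>" "stieltjes \<rho> z = t"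
proof -
  let ?a = "supp_minus \<rho>"
  obtain y where y: "y < ?a" "t < stieltjes \<rho> y"
    using assms(2) by (auto simp: stieltjes_left_eq_SUP less_SUP_iff)
  \<comment> \<open>At distance at least 1 / t from the edge, the bound of
    \<open>stieltjes_le_left\<close> is at most t; this is the lower end for the intermediate value
    theorem.\<close>
  define x where "x = min y (?a - 1 / t)"
  have "x < ?a" using assms(1) y by (simp add: x_def min_def)
  have "stieltjes \<rho> x \<le> 1 / (?a - x)" by (rule stieltjes_le_left[OF \<open>x < ?a\<close>])
  also have "\<dots> \<le> 1 / (1 / t)"
    using assms(1) \<open>x < ?a\<close> by (intro divide_left_mono mult_pos_pos) (auto simp: x_def)
  finally have "stieltjes \<rho> x \<le> t" by simp
  moreover have "x \<le> y" by (simp add: x_def)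
  moreover have "continuous_on {x..y} (stieltjes \<rho>)"
    using y by (intro continuous_on_stieltjes) auto
  ultimately obtain z where "x \<le> z" "z \<le> y" "stieltjes \<rho> z = t"
    using IVT'[of "stieltjes \<rho>" x t y] y by auto
  with y show ?thesis by (intro that[of z]) auto
qed

lemma stieltjes_attains_right:
  assumes "t < 0" "stieltjes_right \<rho> (supp_plus \<rho>) < ereal t"
  obtains z where "supp_plus \<rho> < z" "stieltjes \<rho> z = t"
proof -
  let ?b = "supp_plus \<rho>"
  obtain y where y: "?b < y" "stieltjes \<rho> y < t"
    using assms(2) by (auto simp: stieltjes_right_eq_INF INF_less_iff)
  define x where "x = max y (?b - 1 / t)"
  have xb: "?b < x" using assms(1) y by (simp add: x_def max_def)
  have "t = - (1 / (- 1 / t))" by simp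
  also have "\<dots> \<le> - (1 / (x - ?b))"
    using assms(1) xb by (intro le_imp_neg_le divide_left_mono mult_pos_pos) (auto simp: x_def divide_pos_neg)
  also have "\<dots> \<le> stieltjes \<rho> x" by (rule stieltjes_ge_right[OF xb])
  finally have "t \<le> stieltjes \<rho> x" .
  moreover have "y \<le> x" by (simp add: x_def)
  moreover have "continuous_on {y..x} (stieltjes \<rho>)"
    using y by (intro continuous_on_stieltjes) auto
  ultimately obtain z where "y \<le> z" "z \<le> x" "stieltjes \<rho> z = t"
    using IVT'[of "stieltjes \<rho>" y t x] y by auto
  with y show ?thesis by (intro that[of z]) auto
qed

section \<open>The interval where the R-transform is prescribed, and analyticity there\<close>

lemma open_Rhat_domain: "open (Rhat_domain \<rho>)"
  unfolding Rhat_domain_def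
  by (intro open_Collect_conj open_Collect_less continuous_intros continuous_on_ereal)

lemma connected_Rhat_domain: "connected (Rhat_domain \<rho>)"
proof -
  have "is_interval (Rhat_domain \<rho>)"
    unfolding is_interval_1 Rhat_domain_def
    by (auto intro: less_le_trans le_less_trans)
       (meson ereal_less_eq(3) less_le_trans le_less_trans)+
  then show ?thesis by (rule is_interval_connected)
qed

lemma zero_in_Rhat_domain: "0 \<in> Rhat_domain \<rho>"
  using stieltjes_left_pos stieltjes_right_neg
  by (auto simp: Rhat_domain_def ereal_uminus_less_reorder ereal_less_uminus_reorder zero_ereal_def[symmetric])

lemma uminus_stieltjes_in_Rhat_domain:
  assumes "z < supp_minus \<rho>"
  shows "- stieltjes \<rho> z \<in> Rhat_domain \<rho>"
proof -
  have "ereal (- stieltjes \<rho> z) < 0" using stieltjes_pos[OF assms] by simp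
  also have "0 < - stieltjes_right \<rho> (supp_plus \<rho>)"
    using stieltjes_right_neg by (simp add: ereal_less_uminus_reorder)
  finally have "ereal (- stieltjes \<rho> z) < - stieltjes_right \<rho> (supp_plus \<rho>)" .
  then show ?thesis
    using stieltjes_less_stieltjes_left[OF assms]
    by (auto simp: Rhat_domain_def ereal_uminus_less_reorder)
qed

lemma Rhat_domain_nonzeroE:
  assumes "t \<in> Rhat_domain \<rho>" "t \<noteq> 0"
  obtains z where "z \<notin> {supp_minus \<rho>..supp_plus \<rho>}" "stieltjes \<rho> z = - t"
proof (cases "t < 0")
  case True
  with assms have "0 < - t" "ereal (- t) < stieltjes_left \<rho> (supp_minus \<rho>)"
    by (auto simp: Rhat_domain_def ereal_uminus_less_reorder)
  then show ?thesis
    by (rule stieltjes_attains_left) (rule that, auto)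
next
  case False
  with assms have "- t < 0" "stieltjes_right \<rho> (supp_plus \<rho>) < ereal (- t)"
    by (auto simp: Rhat_domain_def ereal_less_uminus_reorder simp flip: uminus_ereal.simps)
  then show ?thesis
    by (rule stieltjes_attains_right) (rule that, auto)
qed

text \<open>The analytic local inverse stays outside the support interval by continuity, and
  injectivity of the transform there identifies it with the globally chosen inverse.\<close>

lemma real_analytic_stieltjes_inv:
  assumes z: "z \<notin> {supp_minus \<rho>..supp_plus \<rho>}"
  shows "real_analytic_at (stieltjes_inv \<rho>) (stieltjes \<rho> z)"
proof -
  have "deriv (stieltjes \<rho>) z \<noteq> 0"
    using stieltjes_has_derivative[OF z] inverse_moment_2_pos[OF z] by (metis DERIV_imp_deriv less_irrefl)
  from real_analytic_local_inverse[OF real_analytic_stieltjes[OF z] this]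
  obtain \<phi> where \<phi>: "real_analytic_at \<phi> (stieltjes \<rho> z)" "\<phi> (stieltjes \<rho> z) = z"
    "eventually (\<lambda>t. stieltjes \<rho> (\<phi> t) = t) (nhds (stieltjes \<rho> z))" by blast
  have "(\<phi> \<longlongrightarrow> z) (nhds (stieltjes \<rho> z))"
    using real_analytic_at_isCont[OF \<phi>(1)] \<phi>(2) by (metis continuous_at tendsto_at_iff_tendsto_nhds)
  then have "eventually (\<lambda>t. \<phi> t \<in> - {supp_minus \<rho>..supp_plus \<rho>}) (nhds (stieltjes \<rho> z))"
    by (rule topological_tendstoD) (use z in auto)
  with \<phi>(3) have "eventually (\<lambda>t. \<phi> t = stieltjes_inv \<rho> t) (nhds (stieltjes \<rho> z))"
    by eventually_elim (metis stieltjes_inv_stieltjes ComplD)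
  with \<phi>(1) show ?thesis by (rule real_analytic_at_cong)
qed

lemma real_analytic_Rhat:
  assumes "t \<in> Rhat_domain \<rho>" "t \<noteq> 0"
  shows "real_analytic_at (Rhat \<rho>) t"
proof -
  obtain z where "z \<notin> {supp_minus \<rho>..supp_plus \<rho>}" "stieltjes \<rho> z = - t"
    using Rhat_domain_nonzeroE[OF assms] .
  then have "real_analytic_at (stieltjes_inv \<rho>) (- t)"
    using real_analytic_stieltjes_inv by metis
  then have "real_analytic_at (\<lambda>t. stieltjes_inv \<rho> (- t)) t"
    using real_analytic_at_compose[of "stieltjes_inv \<rho>" uminus t]
      real_analytic_at_minus[OF real_analytic_at_ident[of t]] by simp
  then show ?thesis
    unfolding Rhat_def using assms(2)
    by (intro real_analytic_at_diff real_analytic_at_divide) auto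
qed

text \<open>In the coordinate \<open>w = 1 / z\<close> at infinity, \<open>- stieltjes \<rho> (1 / w)\<close> is analytic at \<open>0\<close>
  with derivative \<open>1\<close>; its inverse yields the removable singularity of the \<open>R\<close>-transform.\<close>

lemma stieltjes_at_infinity:
  obtains k where "real_analytic_at k 0" "k 0 = 0" "deriv k 0 = 1"
    "\<And>w. w \<noteq> 0 \<Longrightarrow> k w = - stieltjes \<rho> (1 / w)"
proof -
  define k where "k = (\<lambda>w. \<integral>x. w / (1 - x * w) \<partial>\<rho>)"
  \<comment> \<open>The added 1 keeps B positive when both edges are 0.\<close>
  define B where "B = max \<bar>supp_minus \<rho>\<bar> \<bar>supp_plus \<rho>\<bar> + 1"
  have B: "B > 0" "AE x in \<rho>. \<bar>x\<bar> \<le> B"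
  proof -
    show "AE x in \<rho>. \<bar>x\<bar> \<le> B"
      using AE_bounds by eventually_elim (auto simp: B_def)
  qed (simp add: B_def)
  \<comment> \<open>Since k starts with the power w, the coefficient of order \<open>Suc n\<close>
    is the moment of order n.\<close>
  define m where "m = (\<lambda>n. case n of 0 \<Rightarrow> 0 | Suc n \<Rightarrow> (\<integral>x. x ^ n \<partial>\<rho>))"
  have int: "integrable \<rho> (\<lambda>x. x ^ n)" for n
    using B(2) by (intro integrable_const_bound[of _ "B ^ n"])
      (auto elim!: eventually_mono simp: power_abs intro!: power_mono)
  have sums: "(\<lambda>n. fps_nth (Abs_fps m) n * w ^ n) sums k (0 + w)" if w: "\<bar>w\<bar> < 1 / B" for w
  proof -
    define q where "q = \<bar>w\<bar> * B"
    have q: "0 \<le> q" "q < 1" using w B(1) by (auto simp: q_def field_simps)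
    let ?f = "\<lambda>n x. w ^ Suc n * x ^ n"
    have "(\<lambda>n. integral\<^sup>L \<rho> (?f n)) sums k w"
      unfolding k_def
    proof (rule integral_sums_geometric[OF _ q])
      show "integrable \<rho> (?f n)" for n by (intro integrable_mult_right int)
      show "AE x in \<rho>. \<forall>n. \<bar>?f n x\<bar> \<le> \<bar>w\<bar> * q ^ n"
        using B(2) by eventually_elim (auto simp: abs_mult power_abs q_def power_mult_distrib mult.assoc
            intro!: mult_left_mono power_mono)
      show "AE x in \<rho>. (\<lambda>n. ?f n x) sums (w / (1 - x * w))"
        using B(2)
      proof eventually_elim
        case (elim x)
        have "\<bar>x\<bar> * \<bar>w\<bar> \<le> B * \<bar>w\<bar>" using elim by (intro mult_right_mono) auto
        then have "norm (x * w) < 1" using q(2) by (simp add: abs_mult q_def mult.commute)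
        from sums_mult[OF geometric_sums[OF this], of w]
        show ?case by (simp add: power_mult_distrib mult.commute mult.left_commute)
      qed
    qed measurable
    also have "(\<lambda>n. integral\<^sup>L \<rho> (?f n)) = (\<lambda>n. fps_nth (Abs_fps m) (Suc n) * w ^ Suc n)"
      by (simp add: m_def mult.commute)
    finally show ?thesis
      using sums_Suc_iff[of "\<lambda>n. fps_nth (Abs_fps m) n * w ^ n" "k w"] by (simp add: m_def)
  qed
  have "eventually (\<lambda>w. w \<in> ball 0 (1 / B)) (nhds (0::real))"
    using B(1) by (intro eventually_nhds_in_open) auto
  then have "eventually (\<lambda>w. (\<lambda>n. fps_nth (Abs_fps m) n * w ^ n) sums k (0 + w)) (nhds 0)"
    by eventually_elim (use sums in auto)
  then have fps: "(\<lambda>w. k (0 + w)) has_fps_expansion Abs_fps m"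
    by (rule has_fps_expansionI)
  show ?thesis
  proof (rule that[of k])
    show "real_analytic_at k 0" using fps real_analytic_at_iff_fps by blast
    show "k 0 = 0" by (simp add: k_def)
    have "(k has_real_derivative fps_nth (Abs_fps m) 1) (at 0)"
      by (rule has_real_derivative_fps[OF fps])
    moreover have "fps_nth (Abs_fps m) 1 = 1" using prob_space by (simp add: m_def)
    ultimately show "deriv k 0 = 1" by (metis DERIV_imp_deriv)
    show "k w = - stieltjes \<rho> (1 / w)" if "w \<noteq> 0" for w
      unfolding k_def stieltjes_def Bochner_Integration.integral_minus[symmetric]
    proof (rule Bochner_Integration.integral_cong[OF refl])
      fix x
      have "x - 1 / w = - ((1 - x * w) / w)" using that by (simp add: field_simps)
      then show "w / (1 - x * w) = - (1 / (x - 1 / w))"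
        by (simp add: divide_inverse)
    qed
  qed
qed

text \<open>The local inverse l of k at 0 has the form t * u t with u 0 = 1, and 1 / l t is the
  value of \<open>stieltjes_inv\<close> at - t. Hence \<open>Rhat\<close> equals (1 - u t) / (t * u
  t) near 0, and a second factorization 1 - u t = t * v t cancels the pole, leaving v / u.\<close>

lemma R_extension_Rhat_domain: "\<exists>f. R_extension \<rho> (Rhat_domain \<rho>) f"
proof -
  obtain k where k: "real_analytic_at k 0" "k 0 = 0" "deriv k 0 = 1"
    "\<And>w. w \<noteq> 0 \<Longrightarrow> k w = - stieltjes \<rho> (1 / w)" using stieltjes_at_infinity by blast
  from real_analytic_local_inverse[OF k(1)] k(2,3)
  obtain l where l: "real_analytic_at l 0" "l 0 = 0" "eventually (\<lambda>t. k (l t) = t) (nhds 0)"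
    by (metis zero_neq_one)
  have dl: "deriv l 0 = 1"
  proof -
    have "((\<lambda>t. k (l t)) has_real_derivative deriv k (l 0) * deriv l 0) (at 0)"
      using l(1,2) k(1) by (intro DERIV_chain2 real_analytic_at_has_derivative) auto
    then have "((\<lambda>t. t) has_real_derivative deriv k (l 0) * deriv l 0) (at 0)"
      using DERIV_cong_ev[OF refl l(3) refl] by simp
    then show ?thesis using k(3) l(2) DERIV_unique[OF _ DERIV_ident] by auto
  qed
  obtain u where u: "real_analytic_at u 0" "\<And>t. l t = (t - 0) * u t" "u 0 = deriv l 0"
    using real_analytic_at_factor[OF l(1,2)] by blast
  have u1: "real_analytic_at (\<lambda>t. 1 - u t) 0"
    by (rule real_analytic_at_diff[OF real_analytic_at_const u(1)])
  have "1 - u 0 = 0" using u(3) dl by simp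
  obtain v where v: "real_analytic_at v 0" "\<And>t. 1 - u t = (t - 0) * v t"
    using real_analytic_at_factor[OF u1 \<open>1 - u 0 = 0\<close>] by blast
  define f where "f = (\<lambda>t. if t = 0 then v 0 / u 0 else Rhat \<rho> t)"
  define B where "B = max \<bar>supp_minus \<rho>\<bar> \<bar>supp_plus \<rho>\<bar> + 1"
  have B: "B > 0" by (simp add: B_def)
  have lim: "(u \<longlongrightarrow> 1) (nhds 0)" "(l \<longlongrightarrow> 0) (nhds 0)"
    using real_analytic_at_isCont[OF u(1)] real_analytic_at_isCont[OF l(1)] u(3) dl l(2)
    by (metis continuous_at tendsto_at_iff_tendsto_nhds)+
  have "eventually (\<lambda>t. u t \<in> - {0}) (nhds 0)"
    by (rule topological_tendstoD[OF lim(1)]) auto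
  \<comment> \<open>This forces |1 / l t| > B, so 1 / l t lies outside the support interval, where
    \<open>stieltjes_inv\<close> inverts.\<close>
  moreover have "eventually (\<lambda>t. l t \<in> ball 0 (1 / B)) (nhds 0)"
    by (rule topological_tendstoD[OF lim(2)]) (use B in auto)
  ultimately have "eventually (\<lambda>t. v t / u t = f t) (nhds 0)"
    using l(3)
  proof eventually_elim
    case (elim t)
    show ?case
    proof (cases "t = 0")
      case False
      then have l0: "l t \<noteq> 0" using u(2)[of t] elim by simp
      have "B < 1 / \<bar>l t\<bar>"
        using elim l0 B by (simp add: field_simps)
      then have "B < \<bar>1 / l t\<bar>" by simp
      then have "1 / l t \<notin> {supp_minus \<rho>..supp_plus \<rho>}"
        unfolding B_def by auto
      moreover have "stieltjes \<rho> (1 / l t) = - t" using k(4)[OF l0] elim by simp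
      ultimately have "stieltjes_inv \<rho> (- t) = 1 / l t"
        using stieltjes_inv_stieltjes by metis
      then have "f t = 1 / (t * u t) - 1 / t" using False u(2)[of t] by (simp add: f_def Rhat_def)
      also have "\<dots> = (1 - u t) / (t * u t)" using False elim by (simp add: field_simps)
      also have "\<dots> = v t / u t" using v(2)[of t] False by simp
      finally show ?thesis by simp
    qed (simp add: f_def)
  qed
  moreover have "real_analytic_at (\<lambda>t. v t / u t) 0"
    using u v dl by (intro real_analytic_at_divide) auto
  ultimately have "real_analytic_at f 0" by (metis real_analytic_at_cong)
  moreover have "real_analytic_at f t" if "t \<in> Rhat_domain \<rho>" "t \<noteq> 0" for t
  proof (rule real_analytic_at_cong[OF real_analytic_Rhat[OF that]])
    have "eventually (\<lambda>s. s \<in> - {0}) (nhds t)"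
      using that by (intro eventually_nhds_in_open) auto
    then show "eventually (\<lambda>s. Rhat \<rho> s = f s) (nhds t)"
      by eventually_elim (simp add: f_def)
  qed
  ultimately have "real_analytic_on f (Rhat_domain \<rho>)"
    by (metis real_analytic_onI)
  then have "R_extension \<rho> (Rhat_domain \<rho>) f"
    unfolding R_extension_def
    using open_Rhat_domain connected_Rhat_domain by (auto simp: is_interval_connected_1 f_def)
  then show ?thesis by blast
qed

section \<open>Gluing all extensions to the maximal one\<close>

lemma R_extension_agree:
  assumes "R_extension \<rho> I f" "R_extension \<rho> J g" "t \<in> I" "t \<in> J"
  shows "f t = g t"
proof (rule real_analytic_identity[of f "I \<inter> J" g])
  show "real_analytic_on f (I \<inter> J)" "real_analytic_on g (I \<inter> J)"
    using assms by (auto simp: R_extension_def real_analytic_on_def)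
  show "open (I \<inter> J)" using assms by (auto simp: R_extension_def)
  show "connected (I \<inter> J)"
    using assms is_interval_Int unfolding R_extension_def is_interval_connected_1[symmetric] by blast
  \<comment> \<open>A nonzero point of \<open>Rhat_domain \<rho>\<close>: both extensions equal
    \<open>Rhat\<close> in its neighbourhood, whereas at 0 nothing is prescribed.\<close>
  show "- stieltjes \<rho> (supp_minus \<rho> - 1) \<in> I \<inter> J"
    using assms uminus_stieltjes_in_Rhat_domain[of "supp_minus \<rho> - 1"] by (auto simp: R_extension_def)
  have "eventually (\<lambda>s. s \<in> Rhat_domain \<rho> - {0}) (nhds (- stieltjes \<rho> (supp_minus \<rho> - 1)))"
    using uminus_stieltjes_in_Rhat_domain[of "supp_minus \<rho> - 1"] stieltjes_pos[of "supp_minus \<rho> - 1"]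
    by (intro eventually_nhds_in_open open_Diff open_Rhat_domain) auto
  then show "eventually (\<lambda>s. f s = g s) (nhds (- stieltjes \<rho> (supp_minus \<rho> - 1)))"
    by eventually_elim (use assms in \<open>simp add: R_extension_def\<close>)
qed (use assms in auto)

text \<open>All admissible intervals contain 0, so their union is an interval, and since the
  extensions agree on overlaps the value at t may be taken from any interval around t. This exhibits
  a witness for the choice in \<open>R_transform\<close>.\<close>

lemma R_extension_R_transform: "R_extension \<rho> (R_domain \<rho>) (R_transform \<rho>)"
proof -
  define \<I> where "\<I> = {I. \<exists>f. R_extension \<rho> I f}"
  define ext where "ext = (\<lambda>I. SOME f. R_extension \<rho> I f)"
  have ext: "R_extension \<rho> I (ext I)" if "I \<in> \<I>" for I
    using that someI_ex[of "R_extension \<rho> I"] unfolding \<I>_def ext_def by simp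
  define pick where "pick = (\<lambda>t. SOME I. I \<in> \<I> \<and> t \<in> I)"
  define f where "f = (\<lambda>t. ext (pick t) t)"
  have dom: "R_domain \<rho> = \<Union>\<I>" by (simp add: R_domain_def \<I>_def)
  have feq: "f t = ext I t" if "I \<in> \<I>" "t \<in> I" for I t
  proof -
    have "pick t \<in> \<I> \<and> t \<in> pick t"
      using someI[of "\<lambda>I. I \<in> \<I> \<and> t \<in> I" I] that unfolding pick_def by simp
    then show ?thesis unfolding f_def using that R_extension_agree[OF ext ext] by blast
  qed
  have props: "open I" "is_interval I" "Rhat_domain \<rho> \<subseteq> I" "real_analytic_on (ext I) I"
    "\<And>t. t \<in> Rhat_domain \<rho> - {0} \<Longrightarrow> ext I t = Rhat \<rho> t" if "I \<in> \<I>" for I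
    using ext[OF that] by (auto simp: R_extension_def)
  have ne: "Rhat_domain \<rho> \<in> \<I>" using R_extension_Rhat_domain by (simp add: \<I>_def)
  have "R_extension \<rho> (R_domain \<rho>) f"
    unfolding R_extension_def dom
  proof (intro conjI ballI)
    show "open (\<Union>\<I>)" using props(1) by blast
    have "0 \<in> \<Inter>\<I>" using props(3) zero_in_Rhat_domain by blast
    then have "connected (\<Union>\<I>)"
      using props(2) by (intro connected_Union) (auto simp: is_interval_connected_1)
    then show "is_interval (\<Union>\<I>)" by (simp add: is_interval_connected_1)
    show "Rhat_domain \<rho> \<subseteq> \<Union>\<I>" using ne by blast
    show "real_analytic_on f (\<Union>\<I>)"
    proof (rule real_analytic_onI, elim UnionE)
      fix t I assume I: "t \<in> I" "I \<in> \<I>"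
      have "real_analytic_at (ext I) t"
        using props(4)[OF I(2)] I(1) by (rule real_analytic_onD)
      moreover have "eventually (\<lambda>s. s \<in> I) (nhds t)"
        using I props(1) by (intro eventually_nhds_in_open) auto
      then have "eventually (\<lambda>s. ext I s = f s) (nhds t)"
        by eventually_elim (simp add: feq[OF I(2)])
      ultimately show "real_analytic_at f t" by (rule real_analytic_at_cong)
    qed
    show "f t = Rhat \<rho> t" if "t \<in> Rhat_domain \<rho> - {0}" for t
      using feq[OF ne] props(5)[OF ne] that by auto
  qed
  then show ?thesis
    using someI[of "R_extension \<rho> (R_domain \<rho>)" f] by (simp add: R_transform_def)
qed

lemma open_R_domain: "open (R_domain \<rho>)"
  and connected_R_domain: "connected (R_domain \<rho>)"
  and Rhat_domain_subset: "Rhat_domain \<rho> \<subseteq> R_domain \<rho>"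
  and R_transform_eq_Rhat: "t \<in> Rhat_domain \<rho> \<Longrightarrow> t \<noteq> 0 \<Longrightarrow> R_transform \<rho> t = Rhat \<rho> t"
  using R_extension_R_transform by (auto simp: R_extension_def is_interval_connected_1)

lemma real_analytic_R_transform: "t \<in> R_domain \<rho> \<Longrightarrow> real_analytic_at (R_transform \<rho>) t"
  using R_extension_R_transform real_analytic_onD by (auto simp: R_extension_def)

text \<open>Glued to the R-transform along the overlap, f gives an admissible extension to the
  union, and \<open>R_domain\<close> contains every such interval.\<close>

lemma R_domain_maximal:
  assumes J: "open J" "connected J" and f: "real_analytic_on f J"
    and ne: "J \<inter> R_domain \<rho> \<noteq> {}" and eq: "\<And>t. t \<in> J \<inter> R_domain \<rho> \<Longrightarrow> f t = R_transform \<rho> t"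
  shows "J \<subseteq> R_domain \<rho>"
proof -
  define g where "g = (\<lambda>t. if t \<in> R_domain \<rho> then R_transform \<rho> t else f t)"
  have "R_extension \<rho> (R_domain \<rho> \<union> J) g"
    unfolding R_extension_def
  proof (intro conjI ballI)
    show "open (R_domain \<rho> \<union> J)" using J open_R_domain by auto
    have "connected (R_domain \<rho> \<union> J)"
      using J connected_R_domain ne by (intro connected_Un) auto
    then show "is_interval (R_domain \<rho> \<union> J)" by (simp add: is_interval_connected_1)
    show "Rhat_domain \<rho> \<subseteq> R_domain \<rho> \<union> J" using Rhat_domain_subset by blast
    show "g t = Rhat \<rho> t" if "t \<in> Rhat_domain \<rho> - {0}" for t
      using that Rhat_domain_subset R_transform_eq_Rhat by (auto simp: g_def)
    have "real_analytic_at g t" if t: "t \<in> R_domain \<rho>" for t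
    proof (rule real_analytic_at_cong[OF real_analytic_R_transform[OF t]])
      show "eventually (\<lambda>s. R_transform \<rho> s = g s) (nhds t)"
        using eventually_nhds_in_open[OF open_R_domain t] by eventually_elim (simp add: g_def)
    qed
    moreover have "real_analytic_at g t" if t: "t \<in> J" for t
    proof (rule real_analytic_at_cong)
      show "real_analytic_at f t" using f t by (rule real_analytic_onD)
      show "eventually (\<lambda>s. f s = g s) (nhds t)"
        using eventually_nhds_in_open[OF J(1) t] by eventually_elim (simp add: g_def eq)
    qed
    ultimately show "real_analytic_on g (R_domain \<rho> \<union> J)"
      by (metis UnE real_analytic_onI)
  qed
  then show ?thesis unfolding R_domain_def by blast
qed

section \<open>The R-transform and its derivative at values of the Stieltjes transform\<close>

lemma uminus_stieltjes_in_R_domain: "z < supp_minus \<rho> \<Longrightarrow> - stieltjes \<rho> z \<in> R_domain \<rho>"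
  using uminus_stieltjes_in_Rhat_domain Rhat_domain_subset by blast

lemma R_transform_stieltjes:
  assumes "z < supp_minus \<rho>"
  shows "R_transform \<rho> (- stieltjes \<rho> z) = z + 1 / stieltjes \<rho> z"
  using assms stieltjes_pos[OF assms]
  by (simp add: R_transform_eq_Rhat uminus_stieltjes_in_Rhat_domain Rhat_def stieltjes_inv_stieltjes)

lemma deriv_R_transform_stieltjes:
  assumes z: "z < supp_minus \<rho>"
  shows "deriv (R_transform \<rho>) (- stieltjes \<rho> z) = 1 / (stieltjes \<rho> z)\<^sup>2 - 1 / inverse_moment \<rho> 2 z"
proof -
  let ?G = "stieltjes \<rho>" and ?d = "inverse_moment \<rho> 2 z"
  have G: "(?G has_real_derivative ?d) (at z)" and d: "?d > 0"
    using z stieltjes_has_derivative inverse_moment_2_pos by auto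
  have "((\<lambda>z. R_transform \<rho> (- ?G z)) has_real_derivative deriv (R_transform \<rho>) (- ?G z) * - ?d) (at z)"
    using real_analytic_at_has_derivative[OF real_analytic_R_transform[OF uminus_stieltjes_in_R_domain[OF z]]] G
    by (intro DERIV_chain2[where g = "\<lambda>z. - ?G z"] DERIV_minus)
  moreover have "((\<lambda>z. z + 1 / ?G z) has_real_derivative 1 - ?d / (?G z)\<^sup>2) (at z)"
    using G stieltjes_pos[OF z] by (auto intro!: derivative_eq_intros simp: power2_eq_square)
  moreover have "eventually (\<lambda>y. R_transform \<rho> (- ?G y) = y + 1 / ?G y) (nhds z)"
    using eventually_nhds_in_open[of "{..<supp_minus \<rho>}" z] z
    by (auto elim!: eventually_mono simp: R_transform_stieltjes)
  ultimately have "deriv (R_transform \<rho>) (- ?G z) * - ?d = 1 - ?d / (?G z)\<^sup>2"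
    by (metis DERIV_cong_ev DERIV_unique)
  then show ?thesis using d stieltjes_pos[OF z] by (simp add: field_simps)
qed

text \<open>Given the formula for the derivative, this is Cauchy-Schwarz. It holds only at genuine
  values of the transform, not on the analytic continuation; that distinction drives the last step
  of \<open>no_critical_gstar\<close>.\<close>

lemma deriv_R_transform_nonneg:
  assumes z: "z < supp_minus \<rho>"
  shows "0 \<le> deriv (R_transform \<rho>) (- stieltjes \<rho> z)"
proof -
  have "(stieltjes \<rho> z)\<^sup>2 \<le> inverse_moment \<rho> 2 z"
    using inverse_moment_log_convex[OF z, of 0] by (simp add: stieltjes_eq_inverse_moment numeral_2_eq_2)
  then show ?thesis
    using stieltjes_pos[OF z] by (simp add: deriv_R_transform_stieltjes[OF z] frac_le)
qed

subsection \<open>The edge of the support\<close>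

lemma inverse_moment_2_le:
  assumes "z < supp_minus \<rho>"
  shows "inverse_moment \<rho> 2 z \<le> 1 / (supp_minus \<rho> - z)\<^sup>2"
  unfolding inverse_moment_def
proof (intro integral_le_const integrable_inverse_power[OF _ AE_dist_left])
  show "AE x in \<rho>. 1 / (x - z)\<^sup>2 \<le> 1 / (supp_minus \<rho> - z)\<^sup>2"
    using AE_bounds by eventually_elim (use assms in \<open>auto intro!: divide_left_mono power_mono mult_pos_pos\<close>)
qed (use assms in auto)

lemma stieltjes_less_iff:
  "x < supp_minus \<rho> \<Longrightarrow> y < supp_minus \<rho> \<Longrightarrow> stieltjes \<rho> x < stieltjes \<rho> y \<longleftrightarrow> x < y"
  using stieltjes_less_left[of x y] stieltjes_less_left[of y x] by (cases x y rule: linorder_cases) auto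

lemma R_domain_interval: "s \<in> R_domain \<rho> \<Longrightarrow> t \<in> R_domain \<rho> \<Longrightarrow> s \<le> u \<Longrightarrow> u \<le> t \<Longrightarrow> u \<in> R_domain \<rho>"
  using connected_R_domain unfolding is_interval_connected_1[symmetric] is_interval_1 by blast

lemma zero_in_R_domain: "0 \<in> R_domain \<rho>"
  using zero_in_Rhat_domain Rhat_domain_subset by blast

text \<open>A ball around s meets the domain in an interval, so agreement on the right of s spreads
  to the whole overlap and the ball can be glued on. In the applications s is minus a limit of
  Stieltjes values, approached from the right.\<close>

lemma R_domain_extend:
  assumes f: "real_analytic_at f s" and "s < u"
    and eq: "\<And>t. s < t \<Longrightarrow> t < u \<Longrightarrow> t \<in> R_domain \<rho> \<and> f t = R_transform \<rho> t"
  shows "s \<in> R_domain \<rho>"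
proof -
  obtain r where r: "r > 0" "\<And>t. \<bar>t - s\<bar> < r \<Longrightarrow> real_analytic_at f t"
    using real_analytic_at_eventually[OF f] unfolding eventually_nhds_metric by (auto simp: dist_norm)
  define J where "J = ball s r"
  define c where "c = s + min r (u - s) / 2"
  have c: "s < c" "c < u" "c \<in> J" using r(1) \<open>s < u\<close> by (auto simp: c_def J_def dist_norm min_def field_simps)
  have fJ: "real_analytic_on f J"
    by (rule real_analytic_onI) (use r in \<open>auto simp: J_def dist_norm abs_minus_commute\<close>)
  have "J \<subseteq> R_domain \<rho>"
  proof (rule R_domain_maximal[OF _ _ fJ])
    show "J \<inter> R_domain \<rho> \<noteq> {}" using c eq by blast
    fix t assume t: "t \<in> J \<inter> R_domain \<rho>"
    show "f t = R_transform \<rho> t"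
    proof (rule real_analytic_identity[of f "J \<inter> R_domain \<rho>" "R_transform \<rho>" c])
      show "real_analytic_on f (J \<inter> R_domain \<rho>)" using fJ by (auto simp: real_analytic_on_def)
      show "real_analytic_on (R_transform \<rho>) (J \<inter> R_domain \<rho>)"
        by (rule real_analytic_onI) (use real_analytic_R_transform in auto)
      show "connected (J \<inter> R_domain \<rho>)"
        using connected_R_domain is_interval_Int[of J "R_domain \<rho>"]
        unfolding is_interval_connected_1[symmetric] by (auto simp: J_def is_interval_ball_real)
      show "c \<in> J \<inter> R_domain \<rho>" using c eq by blast
      have "eventually (\<lambda>t. t \<in> {s<..<u}) (nhds c)"
        using c by (intro eventually_nhds_in_open) auto
      then show "eventually (\<lambda>t. f t = R_transform \<rho> t) (nhds c)"
        by eventually_elim (use eq in auto)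
    qed (use t open_R_domain in \<open>auto simp: J_def\<close>)
  qed (auto simp: J_def)
  then show ?thesis using r(1) by (auto simp: J_def)
qed

text \<open>Seen from \<open>supp_minus \<rho> - \<delta>\<close>, the mass within \<delta> of the
  edge is at distance less than 2 * \<delta>.\<close>

lemma inverse_moment_ge:
  assumes "\<delta> > 0"
  shows "prob {supp_minus \<rho>..<supp_minus \<rho> + \<delta>} / (2 * \<delta>) ^ k \<le> inverse_moment \<rho> k (supp_minus \<rho> - \<delta>)"
proof -
  let ?a = "supp_minus \<rho>" and ?z = "supp_minus \<rho> - \<delta>"
  have "prob {?a..<?a + \<delta>} / (2 * \<delta>) ^ k = (\<integral>x. indicator {?a..<?a + \<delta>} x * (1 / (2 * \<delta>) ^ k) \<partial>\<rho>)"
    by simp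
  also have "\<dots> \<le> (\<integral>x. 1 / (x - ?z) ^ k \<partial>\<rho>)"
  proof (rule integral_mono_AE)
    show "integrable \<rho> (\<lambda>x. indicator {?a..<?a + \<delta>} x * (1 / (2 * \<delta>) ^ k))"
      by (intro integrable_mult_left integrable_real_indicator) (auto simp: emeasure_eq_measure)
    show "integrable \<rho> (\<lambda>x. 1 / (x - ?z) ^ k)"
      using assms by (intro integrable_inverse_power[OF _ AE_dist_left]) auto
    show "AE x in \<rho>. indicator {?a..<?a + \<delta>} x * (1 / (2 * \<delta>) ^ k) \<le> 1 / (x - ?z) ^ k"
      using AE_bounds
    proof eventually_elim
      case (elim x)
      have "1 / (2 * \<delta>) ^ k \<le> 1 / (x - ?z) ^ k" if "x < ?a + \<delta>"
        using elim that assms by (intro divide_left_mono power_mono mult_pos_pos zero_less_power) auto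
      then show ?case using elim assms by (auto simp: indicator_def)
    qed
  qed
  finally show ?thesis by (simp add: inverse_moment_def)
qed

text \<open>A quantitative form of Pringsheim's theorem. If h is given by a series of radius 4 *
  \<delta> at the edge, its series at z = \<open>supp_minus \<rho> - \<delta>\<close> converges with
  radius 3 * \<delta>. But its coefficients are inverse moments, at least p / (2 * \<delta>)^(n+1)
  with p > 0 the mass near the edge, so the terms at distance 2 * \<delta> do not tend to 0.\<close>

lemma stieltjes_no_extension:
  assumes h: "real_analytic_at h (supp_minus \<rho>)"
    and eq: "eventually (\<lambda>z. h z = stieltjes \<rho> z) (at_left (supp_minus \<rho>))"
  shows False
proof -
  let ?a = "supp_minus \<rho>"
  obtain r0 c where r0: "r0 > 0"
    and c: "\<And>y. \<bar>y - ?a\<bar> < r0 \<Longrightarrow> (\<lambda>n. c n * (y - ?a) ^ n) sums h y"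
    using h by (auto simp: real_analytic_on_def)
  obtain s where s: "s < ?a" "\<And>y. s < y \<Longrightarrow> y < ?a \<Longrightarrow> h y = stieltjes \<rho> y"
    using eq unfolding eventually_at_left_field by blast
  define r where "r = min r0 (?a - s)"
  have r: "r > 0" "r \<le> r0" "r \<le> ?a - s" using r0 s by (auto simp: r_def)
  define \<delta> where "\<delta> = r / 4"
  define z where "z = ?a - \<delta>"
  have \<delta>: "\<delta> > 0" "r = 4 * \<delta>" using r by (auto simp: \<delta>_def)
  have "\<bar>z - ?a\<bar> < r" using \<delta> by (simp add: z_def)
  moreover have "\<And>y. \<bar>y - ?a\<bar> < r \<Longrightarrow> (\<lambda>n. c n * (y - ?a) ^ n) sums h y" using c r by simp
  ultimately obtain b where "\<And>y. \<bar>y - z\<bar> < r - \<bar>z - ?a\<bar> \<Longrightarrow> (\<lambda>n. b n * (y - z) ^ n) sums h y"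
    using real_power_series_reexpand by blast
  then have b: "\<And>y. \<bar>y - z\<bar> < 3 * \<delta> \<Longrightarrow> (\<lambda>n. b n * (y - z) ^ n) sums h y"
    using \<delta> by (simp add: z_def)
  have bn: "inverse_moment \<rho> (Suc n) z = b n" for n
  proof (rule real_power_series_unique)
    show "0 < \<delta>" "0 < 3 * \<delta>" using \<delta> by auto
    show "(\<lambda>n. b n * (y - z) ^ n) sums h y" if "\<bar>y - z\<bar> < 3 * \<delta>" for y by (rule b[OF that])
    fix y assume y: "\<bar>y - z\<bar> < \<delta>"
    have "(\<lambda>n. inverse_moment \<rho> (Suc n) z * (y - z) ^ n) sums stieltjes \<rho> y"
      by (rule stieltjes_sums[OF \<delta>(1) _ y]) (use AE_dist_left[of z] in \<open>simp add: z_def\<close>)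
    moreover have "h y = stieltjes \<rho> y"
      using y r \<delta> by (intro s(2)) (auto simp: z_def abs_less_iff)
    ultimately show "(\<lambda>n. inverse_moment \<rho> (Suc n) z * (y - z) ^ n) sums h y" by simp
  qed
  define p where "p = prob {?a..<?a + \<delta>}"
  have p: "p > 0" using prob_edge_pos[OF \<delta>(1)] by (simp add: p_def)
  have "(\<lambda>n. b n * (2 * \<delta>) ^ n) \<longlonglongrightarrow> 0"
    using b[of "z + 2 * \<delta>"] \<delta> by (intro summable_LIMSEQ_zero) (auto simp: sums_iff)
  moreover have "p / (2 * \<delta>) \<le> b n * (2 * \<delta>) ^ n" for n
  proof -
    have "p / (2 * \<delta>) = p / (2 * \<delta>) ^ Suc n * (2 * \<delta>) ^ n" using \<delta> by simp
    also have "\<dots> \<le> b n * (2 * \<delta>) ^ n"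
      using inverse_moment_ge[OF \<delta>(1), of "Suc n"] \<delta> bn[of n]
      by (intro mult_right_mono) (auto simp: p_def z_def)
    finally show ?thesis .
  qed
  ultimately have "p / (2 * \<delta>) \<le> 0" by (intro LIMSEQ_le_const) auto
  then show False using p \<delta> by (simp add: divide_le_0_iff)
qed

lemma stieltjes_tendsto_edge:
  assumes "stieltjes_left \<rho> (supp_minus \<rho>) = ereal g"
  shows "(stieltjes \<rho> \<longlongrightarrow> g) (at_left (supp_minus \<rho>))"
  using stieltjes_left_tendsto assms by simp

text \<open>The point - g is the boundary of the prescribed interval, so \<open>dom\<close> says
  that the R-transform continues analytically past it. The first conclusion is K' = 0 at - g,
  written out for K t = R t + 1 / t; the second is the limit of K (- stieltjes z) = z.\<close>

lemma edge_critical: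
  assumes g: "stieltjes_left \<rho> (supp_minus \<rho>) = ereal g" and dom: "- g \<in> R_domain \<rho>"
  shows "deriv (R_transform \<rho>) (- g) = 1 / g\<^sup>2" and "R_transform \<rho> (- g) - 1 / g = supp_minus \<rho>"
proof -
  let ?a = "supp_minus \<rho>" and ?R = "R_transform \<rho>"
  define K where "K = (\<lambda>t. ?R t + 1 / t)"
  have g0: "g > 0" using stieltjes_left_pos g by simp
  have lim: "((\<lambda>z. - stieltjes \<rho> z) \<longlongrightarrow> - g) (at_left ?a)"
    by (intro tendsto_minus stieltjes_tendsto_edge g)
  have K: "real_analytic_at K (- g)"
    unfolding K_def using real_analytic_R_transform[OF dom] g0
    by (intro real_analytic_at_add real_analytic_at_divide) auto
  have Kz: "K (- stieltjes \<rho> z) = z" if "z < ?a" for z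
    using that by (simp add: K_def R_transform_stieltjes)
  have evK: "eventually (\<lambda>z. K (- stieltjes \<rho> z) = z) (at_left ?a)"
    using Kz by (intro eventually_at_leftI[of "?a - 1"]) auto
  have "((\<lambda>z. K (- stieltjes \<rho> z)) \<longlongrightarrow> K (- g)) (at_left ?a)"
    using isCont_tendsto_compose[OF real_analytic_at_isCont[OF K] lim] .
  then have "((\<lambda>z. z) \<longlongrightarrow> K (- g)) (at_left ?a)"
    using tendsto_cong[OF evK] by simp
  then have Kg: "K (- g) = ?a"
    using tendsto_unique[OF _ _ tendsto_ident_at] by (metis trivial_limit_at_left_real)
  then show "?R (- g) - 1 / g = ?a" by (simp add: K_def)
  have "deriv K (- g) = 0"
  proof (rule ccontr)
    assume "deriv K (- g) \<noteq> 0"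
    from real_analytic_local_inverse[OF K this]
    obtain \<phi> where \<phi>: "real_analytic_at \<phi> ?a" "eventually (\<lambda>t. \<phi> (K t) = t) (nhds (- g))"
      using Kg by metis
    have "eventually (\<lambda>z. \<phi> (K (- stieltjes \<rho> z)) = - stieltjes \<rho> z) (at_left ?a)"
      using filterlim_iff[THEN iffD1, OF lim] \<phi>(2) by auto
    with evK have "eventually (\<lambda>z. - \<phi> z = stieltjes \<rho> z) (at_left ?a)"
      by eventually_elim simp
    with real_analytic_at_minus[OF \<phi>(1)] show False by (rule stieltjes_no_extension)
  qed
  moreover have "(K has_real_derivative deriv ?R (- g) - 1 / g\<^sup>2) (at (- g))"
    unfolding K_def using g0
    by (auto intro!: derivative_eq_intros real_analytic_at_has_derivative[OF real_analytic_R_transform[OF dom]]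
        simp: power2_eq_square divide_inverse)
  ultimately show "deriv ?R (- g) = 1 / g\<^sup>2" using DERIV_imp_deriv by fastforce
qed

text \<open>Subtracting the identity affects only the orders 0 and 1. From order 2 on, Kaluza's
  theorem gives the sign; order 1 is Cauchy-Schwarz.\<close>

lemma has_fps_expansion_H:
  assumes z: "z < supp_minus \<rho>"
  obtains A where "(\<lambda>y. - 1 / stieltjes \<rho> (z + y) - (z + y)) has_fps_expansion A"
    "\<And>n. n \<ge> 1 \<Longrightarrow> fps_nth A n \<ge> 0" "fps_nth A 1 = inverse_moment \<rho> 2 z / (stieltjes \<rho> z)\<^sup>2 - 1"
proof -
  define M where "M = Abs_fps (\<lambda>n. inverse_moment \<rho> (Suc n) z)"
  have M: "(\<lambda>y. stieltjes \<rho> (z + y)) has_fps_expansion M"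
    unfolding M_def by (rule has_fps_expansion_stieltjes) (use z in auto)
  have M0: "fps_nth M n > 0" for n using inverse_moment_pos[OF z] by (simp add: M_def)
  define A where "A = - inverse M - (fps_const z + fps_X)"
  have "(\<lambda>y. - inverse (stieltjes \<rho> (z + y)) - (z + y)) has_fps_expansion A"
    unfolding A_def using M0[of 0] M by (intro fps_expansion_intros) auto
  then have A: "(\<lambda>y. - 1 / stieltjes \<rho> (z + y) - (z + y)) has_fps_expansion A"
    by (simp add: divide_inverse)
  have A1: "fps_nth A 1 = inverse_moment \<rho> 2 z / (stieltjes \<rho> z)\<^sup>2 - 1"
    using fps_inverse_nth_1[of M] M0[of 0]
    by (simp add: A_def M_def stieltjes_eq_inverse_moment numeral_2_eq_2)
  have cs: "(stieltjes \<rho> z)\<^sup>2 \<le> inverse_moment \<rho> 2 z"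
    using inverse_moment_log_convex[OF z, of 0] by (simp add: stieltjes_eq_inverse_moment numeral_2_eq_2)
  show ?thesis
  proof (rule that[OF A _ A1])
    fix n :: nat assume n: "n \<ge> 1"
    show "fps_nth A n \<ge> 0"
    proof (cases "n = 1")
      case True
      then show ?thesis using A1 cs stieltjes_pos[OF z] by simp
    next
      case False
      have "fps_nth (inverse M) n \<le> 0"
        using M0 n inverse_moment_log_convex[OF z] by (intro fps_inverse_log_convex) (auto simp: M_def)
      then show ?thesis using n False by (simp add: A_def fps_X_def)
    qed
  qed
qed

text \<open>Dyadic decomposition at the edge: on the shell of scale v the integrand is of order
  v^(-7/5), and the mass is at most c1 * v^(3/2), so each contribution is of order v^(1/10). These
  are dominated by a geometric series of ratio (1/2)^(1/10).\<close>

lemma integrable_edge_power: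
  assumes c2: "c2 > 0"
    and growth: "\<And>\<epsilon>. 0 < \<epsilon> \<Longrightarrow> \<epsilon> < c2 \<Longrightarrow> prob {supp_minus \<rho><..<supp_minus \<rho> + \<epsilon>} \<le> c1 * \<epsilon> powr (3/2)"
  shows "integrable \<rho> (\<lambda>x. indicator {supp_minus \<rho><..} x * (x - supp_minus \<rho>) powr (- 7/5))"
proof -
  let ?a = "supp_minus \<rho>"
  \<comment> \<open>All scales, including the one of index 0, must lie strictly below c2.\<close>
  define c where "c = c2 / 2"
  have c: "0 < c" "c < c2" using c2 by (auto simp: c_def)
  define v where "v = (\<lambda>k::nat. c * (1/2) ^ k)"
  have v: "0 < v k" "v k < c2" for k
  proof -
    have "v k \<le> c * 1" unfolding v_def using c by (intro mult_left_mono power_le_one) auto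
    then show "v k < c2" using c by simp
    show "0 < v k" using c by (simp add: v_def)
  qed
  have c1: "c1 \<ge> 0"
  proof -
    have "0 \<le> c1 * c powr (3/2)" using growth[OF c] measure_nonneg order_trans by blast
    then show ?thesis using c by (simp add: zero_le_mult_iff)
  qed
  define f where "f = (\<lambda>x. indicator {?a<..} x * (x - ?a) powr (- 7/5))"
  let ?I = "\<lambda>k. {?a<..<?a + v k}"
  define d where "d = (\<lambda>k. (v k / 2) powr (- 7/5))"
  have pt: "ennreal (f x) \<le> ennreal (c powr (- 7/5)) + (\<Sum>k. ennreal (d k) * indicator (?I k) x)" for x
  proof (cases "?a < x \<and> x < ?a + c")
    case True
    define u where "u = x - ?a"
    have u: "0 < u" "u < c" using True by (auto simp: u_def)
    have "\<exists>n. v n \<le> u"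
    proof -
      obtain n where "(1/2) ^ n < u / c"
        using real_arch_pow_inv[of "u / c" "1/2"] u c by auto
      then have "v n \<le> u" using c by (simp add: v_def field_simps)
      then show ?thesis ..
    qed
    \<comment> \<open>The shell of x: index 0 is excluded by u < c, so v (Suc k) <= u < v k for the
      predecessor k. The bound then uses the whole interval up to v k, which only
      overestimates.\<close>
    define n where "n = (LEAST n. v n \<le> u)"
    have n: "v n \<le> u" unfolding n_def using \<open>\<exists>n. v n \<le> u\<close> by (rule LeastI_ex)
    have "n \<noteq> 0"
    proof
      assume "n = 0"
      then show False using n u(2) by (simp add: v_def)
    qed
    then obtain k where k: "n = Suc k" by (cases n) auto
    have "\<not> v k \<le> u" using not_less_Least[of k "\<lambda>n. v n \<le> u"] k n_def by auto
    then have xk: "x \<in> ?I k" using True by (auto simp: u_def)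
    have "v k / 2 \<le> u" using n k by (simp add: v_def)
    then have "u powr (- 7/5) \<le> d k"
      unfolding d_def using v(1)[of k] by (intro powr_mono2') auto
    then have "ennreal (f x) \<le> ennreal (d k) * indicator (?I k) x"
      using True xk by (simp add: f_def u_def ennreal_leI)
    also have "\<dots> \<le> (\<Sum>k. ennreal (d k) * indicator (?I k) x)"
    proof -
      define e where "e = (\<lambda>k. ennreal (d k) * indicator (?I k) x)"
      have "sum e {k} \<le> suminf e" by (rule sum_le_suminf) auto
      then have "e k \<le> suminf e" by simp
      then show ?thesis unfolding e_def .
    qed
    also have "\<dots> \<le> ennreal (c powr (- 7/5)) + (\<Sum>k. ennreal (d k) * indicator (?I k) x)"
      by simp
    finally show ?thesis .
  next
    case False
    have "f x \<le> c powr (- 7/5)"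
    proof (cases "?a < x")
      case True
      then have "c \<le> x - ?a" using False by simp
      then show ?thesis using True c by (auto simp: f_def intro!: powr_mono2')
    qed (simp add: f_def)
    then have "ennreal (f x) \<le> ennreal (c powr (- 7/5))" by (rule ennreal_leI)
    then show ?thesis by (rule order_trans) simp
  qed
  define q where "q = (1/2 :: real) powr (1/10)"
  have q: "0 < q" "q < 1" using powr_less_mono2[of "1/10" "1/2" 1] by (auto simp: q_def)
  define A where "A = 2 powr (7/5) * c1 * c powr (1/10)"
  have A: "A \<ge> 0" using c1 by (simp add: A_def)
  have term_le: "d k * prob (?I k) \<le> A * q ^ k" for k
  proof -
    have dk: "d k = 2 powr (7/5) * v k powr (- 7/5)"
      using v(1)[of k] by (simp add: d_def powr_divide powr_minus_divide)
    have "d k * prob (?I k) \<le> 2 powr (7/5) * v k powr (- 7/5) * (c1 * v k powr (3/2))"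
      unfolding dk using growth[OF v] by (intro mult_left_mono) auto
    also have "2 powr (7/5) * v k powr (- 7/5) * (c1 * v k powr (3/2)) =
        2 powr (7/5) * c1 * (v k powr (- 7/5) * v k powr (3/2))" by simp
    also have "v k powr (- 7/5) * v k powr (3/2) = v k powr (1/10)"
      using v(1)[of k] by (simp flip: powr_add)
    also have "v k powr (1/10) = c powr (1/10) * q ^ k"
    proof -
      have "((1/2::real) ^ k) powr (1/10) = q ^ k"
        by (simp add: q_def powr_powr mult.commute flip: powr_realpow)
      then show ?thesis using c by (simp add: v_def powr_mult)
    qed
    finally show ?thesis by (simp add: A_def mult.assoc)
  qed
  have "(\<integral>\<^sup>+x. ennreal (f x) \<partial>\<rho>) \<le>
      (\<integral>\<^sup>+x. ennreal (c powr (- 7/5)) + (\<Sum>k. ennreal (d k) * indicator (?I k) x) \<partial>\<rho>)"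
    by (intro nn_integral_mono pt)
  also have "\<dots> = ennreal (c powr (- 7/5)) + (\<Sum>k. ennreal (d k) * emeasure \<rho> (?I k))"
    by (subst nn_integral_add) (auto simp: nn_integral_suminf nn_integral_cmult emeasure_eq_measure prob_space[simplified])
  also have "(\<Sum>k. ennreal (d k) * emeasure \<rho> (?I k)) \<le> (\<Sum>k. ennreal (A * q ^ k))"
    using term_le by (intro suminf_le) (auto simp: emeasure_eq_measure d_def ennreal_mult' [symmetric] intro!: ennreal_leI)
  also have "(\<Sum>k. ennreal (A * q ^ k)) = ennreal (\<Sum>k. A * q ^ k)"
    using A q by (intro suminf_ennreal2 summable_mult summable_geometric) auto
  finally have "(\<integral>\<^sup>+x. ennreal (f x) \<partial>\<rho>) \<le> ennreal (c powr (- 7/5)) + ennreal (\<Sum>k. A * q ^ k)"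
    by (simp add: add_left_mono)
  also have "\<dots> < \<infinity>" by (simp add: ennreal_add_eq_top less_top)
  finally have fin: "(\<integral>\<^sup>+x. ennreal (f x) \<partial>\<rho>) < \<infinity>" .
  have "integrable \<rho> f"
    using fin by (intro integrableI_nonneg) (auto simp: f_def)
  then show ?thesis by (simp add: f_def)
qed

text \<open>An atom of mass p at the edge forces the value at distance \<delta> to be at least p /
  (2 * \<delta>). With \<delta> = p / (2 * g) this is g, which the transform does not reach to the
  left of the edge.\<close>

lemma prob_edge_zero:
  assumes g: "stieltjes_left \<rho> (supp_minus \<rho>) = ereal g"
  shows "prob {supp_minus \<rho>} = 0"
proof (rule ccontr)
  let ?a = "supp_minus \<rho>"
  define p where "p = prob {?a}"
  assume "prob {?a} \<noteq> 0"
  then have p: "p > 0" by (simp add: p_def zero_less_measure_iff)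
  have g0: "g > 0" using stieltjes_left_pos g by simp
  define \<delta> where "\<delta> = p / (2 * g)"
  have \<delta>: "\<delta> > 0" using p g0 by (simp add: \<delta>_def)
  have "p / (2 * \<delta>) \<le> prob {?a..<?a + \<delta>} / (2 * \<delta>)"
    unfolding p_def using \<delta> by (intro divide_right_mono finite_measure_mono) auto
  also have "\<dots> \<le> stieltjes \<rho> (?a - \<delta>)"
    using inverse_moment_ge[OF \<delta>, of 1] by (simp add: stieltjes_eq_inverse_moment)
  also have "\<dots> < g"
    using stieltjes_less_stieltjes_left[of "?a - \<delta>"] \<delta> g by simp
  finally show False using p g0 by (simp add: \<delta>_def)
qed

text \<open>The increment of the integrand is at most \<eta> / (u * (u + \<eta>)), where u is the
  distance of x from the edge and \<eta> that of z. Interpolation bounds it by \<eta>^(2/5) *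
  u^(-7/5), which is integrable. Absence of an atom ensures u > 0 almost everywhere.\<close>

lemma stieltjes_edge_increment:
  assumes c2: "c2 > 0"
    and growth: "\<And>\<epsilon>. 0 < \<epsilon> \<Longrightarrow> \<epsilon> < c2 \<Longrightarrow> prob {supp_minus \<rho><..<supp_minus \<rho> + \<epsilon>} \<le> c1 * \<epsilon> powr (3/2)"
    and g: "stieltjes_left \<rho> (supp_minus \<rho>) = ereal g"
  obtains M where "M \<ge> 0" "\<And>z. z < supp_minus \<rho> \<Longrightarrow> g - stieltjes \<rho> z \<le> M * (supp_minus \<rho> - z) powr (2/5)"
proof -
  let ?a = "supp_minus \<rho>"
  let ?f = "\<lambda>x. indicator {?a<..} x * (x - ?a) powr (- 7/5)"
  define M where "M = (\<integral>x. ?f x \<partial>\<rho>)"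
  note int = integrable_edge_power[OF c2 growth]
  have "AE x in \<rho>. x \<noteq> ?a"
    using prob_edge_zero[OF g] AE_not_in[of "{?a}" \<rho>] by (auto simp: null_sets_def emeasure_eq_measure)
  with AE_bounds have AE: "AE x in \<rho>. ?a < x" by eventually_elim auto
  have le: "stieltjes \<rho> y - stieltjes \<rho> z \<le> M * (?a - z) powr (2/5)" if yz: "z < y" "y < ?a" for y z
  proof -
    define \<eta> where "\<eta> = ?a - z"
    have \<eta>: "\<eta> > 0" using yz by (simp add: \<eta>_def)
    have inty: "integrable \<rho> (\<lambda>x. 1 / (x - t))" if "t < ?a" for t
      using integrable_inverse_power[OF _ AE_dist_left, of t 1] that by simp
    have "stieltjes \<rho> y - stieltjes \<rho> z = (\<integral>x. 1 / (x - y) - 1 / (x - z) \<partial>\<rho>)"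
      unfolding stieltjes_def using yz by (intro Bochner_Integration.integral_diff[symmetric] inty) auto
    also have "\<dots> \<le> (\<integral>x. \<eta> powr (2/5) * ?f x \<partial>\<rho>)"
    proof (rule integral_mono_AE)
      show "integrable \<rho> (\<lambda>x. 1 / (x - y) - 1 / (x - z))"
        using yz by (intro Bochner_Integration.integrable_diff inty) auto
      show "integrable \<rho> (\<lambda>x. \<eta> powr (2/5) * ?f x)" by (intro integrable_mult_right int)
      show "AE x in \<rho>. 1 / (x - y) - 1 / (x - z) \<le> \<eta> powr (2/5) * ?f x"
        using AE
      proof eventually_elim
        case (elim x)
        define u where "u = x - ?a"
        have u: "u > 0" using elim by (simp add: u_def)
        have x: "x - z = u + \<eta>" "u < x - y" using yz by (auto simp: u_def \<eta>_def)
        \<comment> \<open>The point y is moved to the edge, which makes the bound independent of y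
          and lets y tend to the edge at the end.\<close>
        have "1 / (x - y) \<le> 1 / u" using x(2) u by (intro divide_left_mono mult_pos_pos) auto
        then have "1 / (x - y) - 1 / (x - z) \<le> 1 / u - 1 / (u + \<eta>)" using x(1) by simp
        also have "\<dots> = \<eta> / (u * (u + \<eta>))" using u \<eta> by (simp add: field_simps)
        \<comment> \<open>Both u and \<eta> are below u + \<eta>, so the weights 2/5 and 3/5 can be
          split between them.\<close>
        also have "\<dots> \<le> \<eta> / (u * (u powr (2/5) * \<eta> powr (3/5)))"
        proof (intro divide_left_mono mult_left_mono)
          have "u powr (2/5) * \<eta> powr (3/5) \<le> (u + \<eta>) powr (2/5) * (u + \<eta>) powr (3/5)"
            using u \<eta> by (intro mult_mono powr_mono2) auto
          also have "\<dots> = u + \<eta>" using u \<eta> by (simp flip: powr_add)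
          finally show "u powr (2/5) * \<eta> powr (3/5) \<le> u + \<eta>" .
        qed (use u \<eta> in auto)
        also have "\<dots> = \<eta> powr (2/5) * u powr (- 7/5)"
        proof -
          have "\<eta> = \<eta> powr (2/5) * \<eta> powr (3/5)" using \<eta> by (simp flip: powr_add)
          moreover have "u * u powr (2/5) = u powr (7/5)"
            using u powr_add[of u 1 "2/5"] by simp
          ultimately have "\<eta> / (u * (u powr (2/5) * \<eta> powr (3/5))) =
              \<eta> powr (2/5) * \<eta> powr (3/5) / (u powr (7/5) * \<eta> powr (3/5))"
            by (simp add: mult.assoc[symmetric])
          also have "\<dots> = \<eta> powr (2/5) * u powr (- 7/5)"
            using \<eta> by (simp add: powr_minus_divide)
          finally show ?thesis .
        qed
        finally show ?case using elim by (simp add: u_def)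
      qed
    qed
    also have "\<dots> = M * (?a - z) powr (2/5)" by (simp add: M_def \<eta>_def mult.commute)
    finally show ?thesis .
  qed
  show ?thesis
  proof (rule that[of M])
    show "M \<ge> 0" unfolding M_def by (intro integral_nonneg_AE) auto
    fix z assume z: "z < ?a"
    have "((\<lambda>y. stieltjes \<rho> y - stieltjes \<rho> z) \<longlongrightarrow> g - stieltjes \<rho> z) (at_left ?a)"
      by (intro tendsto_diff stieltjes_tendsto_edge g tendsto_const)
    moreover have "eventually (\<lambda>y. stieltjes \<rho> y - stieltjes \<rho> z \<le> M * (?a - z) powr (2/5)) (at_left ?a)"
      using z le by (intro eventually_at_leftI[of z]) auto
    ultimately show "g - stieltjes \<rho> z \<le> M * (?a - z) powr (2/5)"
      by (intro tendsto_upperbound) auto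
  qed
qed

text \<open>Vanishing of the second order term of the inverse function at the edge would make
  \<open>g - stieltjes \<rho> z\<close> at least of order \<open>1/3\<close> in the distance to the edge, which the
  bound of order \<open>2/5\<close> forbids.\<close>

lemma edge_local_max:
  assumes c2: "c2 > 0"
    and growth: "\<And>\<epsilon>. 0 < \<epsilon> \<Longrightarrow> \<epsilon> < c2 \<Longrightarrow> prob {supp_minus \<rho><..<supp_minus \<rho> + \<epsilon>} \<le> c1 * \<epsilon> powr (3/2)"
    and g: "stieltjes_left \<rho> (supp_minus \<rho>) = ereal g" and dom: "- g \<in> R_domain \<rho>"
  shows "eventually (\<lambda>t. R_transform \<rho> t + 1 / t \<le> supp_minus \<rho>) (nhds (- g))"
proof -
  let ?a = "supp_minus \<rho>"
  define k where "k = (\<lambda>t. R_transform \<rho> t + 1 / t - ?a)"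
  have g0: "g > 0" using stieltjes_left_pos g by simp
  have k: "real_analytic_at k (- g)"
    unfolding k_def using real_analytic_R_transform[OF dom] g0
    by (intro real_analytic_at_add real_analytic_at_diff real_analytic_at_divide) auto
  have k0: "k (- g) = 0" using edge_critical(2)[OF g dom] by (simp add: k_def)
  have "(k has_real_derivative deriv (R_transform \<rho>) (- g) - 1 / g\<^sup>2) (at (- g))"
    unfolding k_def using g0
    by (auto intro!: derivative_eq_intros real_analytic_at_has_derivative[OF real_analytic_R_transform[OF dom]]
        simp: power2_eq_square divide_inverse)
  then have dk: "deriv k (- g) = 0"
    using edge_critical(1)[OF g dom] DERIV_imp_deriv by fastforce
  obtain k1 where k1: "real_analytic_at k1 (- g)" "\<And>t. k t = (t - - g) * k1 t" "k1 (- g) = deriv k (- g)"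
    using real_analytic_at_factor[OF k k0] by blast
  have k10: "k1 (- g) = 0" using k1(3) dk by simp
  obtain k2 where k2: "real_analytic_at k2 (- g)" "\<And>t. k1 t = (t - - g) * k2 t"
    using real_analytic_at_factor[OF k1(1) k10] by blast
  have kk2: "k t = (t + g)\<^sup>2 * k2 t" for t
    using k1(2)[of t] k2(2)[of t] by (simp add: power2_eq_square)
  have kz: "k (- stieltjes \<rho> z) = z - ?a" if "z < ?a" for z
    using that by (simp add: k_def R_transform_stieltjes)
  have lim: "((\<lambda>z. - stieltjes \<rho> z) \<longlongrightarrow> - g) (at_left ?a)"
    by (intro tendsto_minus stieltjes_tendsto_edge g)
  have Gg: "stieltjes \<rho> z < g" if "z < ?a" for z
    using stieltjes_less_stieltjes_left[OF that] g by simp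
  have "((\<lambda>z. k2 (- stieltjes \<rho> z)) \<longlongrightarrow> k2 (- g)) (at_left ?a)"
    by (rule isCont_tendsto_compose[OF real_analytic_at_isCont[OF k2(1)] lim])
  \<comment> \<open>Along the values - \<open>stieltjes \<rho> z\<close> one has k = z -
    \<open>supp_minus \<rho>\<close> < 0, so the quadratic factor k2 cannot be positive in the
    limit.\<close>
  moreover have "eventually (\<lambda>z. k2 (- stieltjes \<rho> z) \<le> 0) (at_left ?a)"
  proof (intro eventually_at_leftI[of "?a - 1"])
    fix z assume "z \<in> {?a - 1<..<?a}"
    then have "(- stieltjes \<rho> z + g)\<^sup>2 * k2 (- stieltjes \<rho> z) < 0"
      using kz[of z] kk2[of "- stieltjes \<rho> z"] by simp
    then show "k2 (- stieltjes \<rho> z) \<le> 0"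
      by (simp add: mult_less_0_iff not_less)
  qed simp
  ultimately have "k2 (- g) \<le> 0" by (intro tendsto_upperbound) auto
  moreover have "k2 (- g) \<noteq> 0"
  proof
    assume "k2 (- g) = 0"
    from real_analytic_at_factor[OF k2(1) this]
    obtain k3 where k3: "real_analytic_at k3 (- g)" "\<And>t. k2 t = (t - - g) * k3 t" by blast
    \<comment> \<open>A third order zero gives, at distance \<eta> from the edge, \<eta> = |k| <=
      |k3| * M^3 * \<eta>^(6/5), hence 1 <= |k3| * M^3 * \<eta>^(1/5), whose right hand side tends
      to 0.\<close>
    have kk3: "k t = (t + g) ^ 3 * k3 t" for t
      using kk2[of t] k3(2)[of t] by (simp add: power2_eq_square power3_eq_cube)
    obtain M where M: "M \<ge> 0" "\<And>z. z < ?a \<Longrightarrow> g - stieltjes \<rho> z \<le> M * (?a - z) powr (2/5)"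
      using stieltjes_edge_increment[OF c2 growth g] by blast
    \<comment> \<open>The limit is left unevaluated; its last factor is 0 \<open>powr\<close> (1/5),
      that is 0.\<close>
    have l3: "((\<lambda>z. \<bar>k3 (- stieltjes \<rho> z)\<bar> * M ^ 3 * (?a - z) powr (1/5)) \<longlongrightarrow>
        \<bar>k3 (- g)\<bar> * M ^ 3 * (?a - ?a) powr (1/5)) (at_left ?a)"
      by (intro tendsto_mult tendsto_const tendsto_rabs isCont_tendsto_compose[OF real_analytic_at_isCont[OF k3(1)] lim]
          tendsto_powr' tendsto_diff tendsto_ident_at)
        (auto simp: eventually_at_filter intro!: always_eventually)
    moreover have "eventually (\<lambda>z. 1 \<le> \<bar>k3 (- stieltjes \<rho> z)\<bar> * M ^ 3 * (?a - z) powr (1/5)) (at_left ?a)"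
    proof (intro eventually_at_leftI[of "?a - 1"])
      fix z assume "z \<in> {?a - 1<..<?a}"
      then have z: "z < ?a" by simp
      define \<eta> where "\<eta> = ?a - z"
      have \<eta>: "\<eta> > 0" using z by (simp add: \<eta>_def)
      define s where "s = g - stieltjes \<rho> z"
      have s: "0 \<le> s" "s \<le> M * \<eta> powr (2/5)" using Gg[OF z] M(2)[OF z] by (auto simp: s_def \<eta>_def)
      have "\<eta> = \<bar>k (- stieltjes \<rho> z)\<bar>" using kz[OF z] z by (simp add: \<eta>_def)
      also have "\<dots> = s ^ 3 * \<bar>k3 (- stieltjes \<rho> z)\<bar>"
        unfolding kk3 abs_mult using s by (simp add: s_def power_abs)
      also have "\<dots> \<le> (M * \<eta> powr (2/5)) ^ 3 * \<bar>k3 (- stieltjes \<rho> z)\<bar>"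
        using s by (intro mult_right_mono power_mono) auto
      also have "(M * \<eta> powr (2/5)) ^ 3 = M ^ 3 * (\<eta> * \<eta> powr (1/5))"
      proof -
        have "(\<eta> powr (2/5)) ^ 3 = \<eta> powr (6/5)"
          using \<eta> by (simp add: powr_power)
        also have "\<dots> = \<eta> * \<eta> powr (1/5)" using \<eta> powr_add[of \<eta> 1 "1/5"] by simp
        finally show ?thesis by (simp add: power_mult_distrib)
      qed
      finally have "\<eta> * 1 \<le> \<eta> * (\<bar>k3 (- stieltjes \<rho> z)\<bar> * M ^ 3 * \<eta> powr (1/5))"
        by (simp add: mult_ac)
      then show "1 \<le> \<bar>k3 (- stieltjes \<rho> z)\<bar> * M ^ 3 * (?a - z) powr (1/5)"
        using \<eta> unfolding \<eta>_def by (simp only: mult_le_cancel_left_pos)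
    qed simp
    ultimately have "1 \<le> \<bar>k3 (- g)\<bar> * M ^ 3 * (?a - ?a) powr (1/5)"
      by (intro tendsto_lowerbound) auto
    then show False by simp
  qed
  ultimately have "k2 (- g) < 0" by simp
  moreover have "(k2 \<longlongrightarrow> k2 (- g)) (nhds (- g))"
    using real_analytic_at_isCont[OF k2(1)] by (metis continuous_at tendsto_at_iff_tendsto_nhds)
  ultimately have "eventually (\<lambda>t. k2 t < 0) (nhds (- g))"
    using order_tendstoD(2) by blast
  then show ?thesis
  proof eventually_elim
    case (elim t)
    then have "k t \<le> 0" unfolding kk2 by (simp add: mult_nonneg_nonpos)
    then show ?case by (simp add: k_def)
  qed
qed

end

subsection \<open>The function F and its first critical point\<close>

locale compact_pair = mu: compact_prob \<mu> + nu: compact_prob \<nu> for \<mu> \<nu> :: "real measure"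
begin

section \<open>Domain, analyticity and derivative of F\<close>

lemma domF_below: "h \<in> domF \<mu> \<nu> \<Longrightarrow> h < supp_minus \<nu>"
  by (simp add: domF_def)

text \<open>As \<open>stieltjes \<nu>\<close> is positive and increasing, -
  \<open>stieltjes \<nu> t\<close> lies between - \<open>stieltjes \<nu> h\<close> and 0, both in
  the interval \<open>R_domain \<mu>\<close>.\<close>

lemma domF_down:
  assumes "h \<in> domF \<mu> \<nu>" "t \<le> h"
  shows "t \<in> domF \<mu> \<nu>"
proof -
  have h: "h < supp_minus \<nu>" "- stieltjes \<nu> h \<in> R_domain \<mu>" using assms by (auto simp: domF_def)
  then have "t < supp_minus \<nu>" using assms by simp
  moreover have "stieltjes \<nu> t \<le> stieltjes \<nu> h"
    using nu.stieltjes_less_iff[of h t] h assms(2) by (auto simp: not_less)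
  then have "- stieltjes \<nu> t \<in> R_domain \<mu>"
    using nu.stieltjes_pos[OF \<open>t < _\<close>] by (intro mu.R_domain_interval[OF h(2) mu.zero_in_R_domain]) auto
  ultimately show ?thesis by (simp add: domF_def)
qed

lemma open_domF: "open (domF \<mu> \<nu>)"
proof -
  have "continuous_on {..<supp_minus \<nu>} (\<lambda>h. - stieltjes \<nu> h)"
    by (intro continuous_on_minus nu.continuous_on_stieltjes) auto
  then have "open ((\<lambda>h. - stieltjes \<nu> h) -` R_domain \<mu> \<inter> {..<supp_minus \<nu>})"
    using mu.open_R_domain by (simp add: continuous_on_open_vimage)
  moreover have "(\<lambda>h. - stieltjes \<nu> h) -` R_domain \<mu> \<inter> {..<supp_minus \<nu>} = domF \<mu> \<nu>"
    by (auto simp: domF_def)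
  ultimately show ?thesis by simp
qed

lemma F_analytic:
  assumes "h \<in> domF \<mu> \<nu>"
  shows "real_analytic_at (F \<mu> \<nu>) h"
proof -
  have h: "h < supp_minus \<nu>" "- stieltjes \<nu> h \<in> R_domain \<mu>" using assms by (auto simp: domF_def)
  have "real_analytic_at (\<lambda>h. - stieltjes \<nu> h) h"
    by (rule real_analytic_at_minus[OF nu.real_analytic_stieltjes]) (use h in auto)
  then have "real_analytic_at (\<lambda>h. R_transform \<mu> (- stieltjes \<nu> h)) h"
    by (rule real_analytic_at_compose[where g = "\<lambda>h. - stieltjes \<nu> h", OF mu.real_analytic_R_transform[OF h(2)]])
  then have "real_analytic_at (\<lambda>h. R_transform \<mu> (- stieltjes \<nu> h) + h) h"
    by (rule real_analytic_at_add[OF _ real_analytic_at_ident])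
  then show ?thesis
    by (rule real_analytic_at_cong) (simp add: F_def)
qed

lemma F_has_derivative:
  assumes "h \<in> domF \<mu> \<nu>"
  shows "(F \<mu> \<nu> has_real_derivative deriv (F \<mu> \<nu>) h) (at h)"
  and deriv_F: "deriv (F \<mu> \<nu>) h = 1 - deriv (R_transform \<mu>) (- stieltjes \<nu> h) * inverse_moment \<nu> 2 h"
proof -
  show "(F \<mu> \<nu> has_real_derivative deriv (F \<mu> \<nu>) h) (at h)"
    by (rule real_analytic_at_has_derivative[OF F_analytic[OF assms]])
  have h: "h < supp_minus \<nu>" "- stieltjes \<nu> h \<in> R_domain \<mu>" using assms by (auto simp: domF_def)
  have "(stieltjes \<nu> has_real_derivative inverse_moment \<nu> 2 h) (at h)"
    by (rule nu.stieltjes_has_derivative) (use h in auto)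
  then have "((\<lambda>h. R_transform \<mu> (- stieltjes \<nu> h)) has_real_derivative
      deriv (R_transform \<mu>) (- stieltjes \<nu> h) * - inverse_moment \<nu> 2 h) (at h)"
    by (intro DERIV_chain2[where g = "\<lambda>h. - stieltjes \<nu> h", OF real_analytic_at_has_derivative[OF mu.real_analytic_R_transform[OF h(2)]]] DERIV_minus)
  then have "((\<lambda>h. R_transform \<mu> (- stieltjes \<nu> h) + h) has_real_derivative
      deriv (R_transform \<mu>) (- stieltjes \<nu> h) * - inverse_moment \<nu> 2 h + 1) (at h)"
    by (intro DERIV_add DERIV_ident)
  moreover have "(\<lambda>h. R_transform \<mu> (- stieltjes \<nu> h) + h) = F \<mu> \<nu>"
    by (simp add: F_def fun_eq_iff)
  ultimately show "deriv (F \<mu> \<nu>) h = 1 - deriv (R_transform \<mu>) (- stieltjes \<nu> h) * inverse_moment \<nu> 2 h"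
    using DERIV_imp_deriv by fastforce
qed

lemma continuous_on_deriv_F: "S \<subseteq> domF \<mu> \<nu> \<Longrightarrow> continuous_on S (deriv (F \<mu> \<nu>))"
  by (intro continuous_at_imp_continuous_on ballI real_analytic_at_isCont real_analytic_at_deriv F_analytic)
    auto

text \<open>Far to the left the argument of the R-transform is close to 0, where its derivative is
  bounded, while the second inverse moment tends to 0; so the derivative of F is close to 1.\<close>

lemma deriv_F_pos_near_minus_infinity:
  obtains b where "b \<in> domF \<mu> \<nu>" "\<And>t. t \<le> b \<Longrightarrow> deriv (F \<mu> \<nu>) t > 0"
proof -
  let ?a = "supp_minus \<nu>" and ?R' = "deriv (R_transform \<mu>)"
  define C where "C = \<bar>?R' 0\<bar> + 1"
  have "(?R' \<longlongrightarrow> ?R' 0) (nhds 0)"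
    using real_analytic_at_isCont[OF real_analytic_at_deriv[OF mu.real_analytic_R_transform[OF mu.zero_in_R_domain]]]
    by (metis continuous_at tendsto_at_iff_tendsto_nhds)
  then have "eventually (\<lambda>t. ?R' t \<in> {..<C}) (nhds 0)"
    by (rule topological_tendstoD) (auto simp: C_def)
  moreover have "eventually (\<lambda>t. t \<in> R_domain \<mu>) (nhds 0)"
    by (rule eventually_nhds_in_open[OF mu.open_R_domain mu.zero_in_R_domain])
  ultimately have "eventually (\<lambda>t. ?R' t \<in> {..<C} \<and> t \<in> R_domain \<mu>) (nhds 0)"
    by eventually_elim auto
  then obtain e where e: "e > 0" "\<And>t. \<bar>t\<bar> < e \<Longrightarrow> ?R' t < C \<and> t \<in> R_domain \<mu>"
    unfolding eventually_nhds_metric by (auto simp: dist_norm)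
  \<comment> \<open>The entry 2 / e gives 1 / N < e, which keeps the argument in the controlled
    neighbourhood of 0; N >= C >= 1 gives C / N <= 1 and 1 / N^2 <= 1 / N.\<close>
  define N where "N = max (2 / e) C"
  have N: "N \<ge> 1" "N > 0" "N > 1 / e" "N \<ge> C"
  proof -
    have "1 / e < 2 / e" using e(1) by (intro divide_strict_right_mono) auto
    then show "N > 1 / e" unfolding N_def by linarith
  qed (auto simp: N_def C_def)
  define b where "b = ?a - N"
  have *: "t \<in> domF \<mu> \<nu> \<and> deriv (F \<mu> \<nu>) t > 0" if t: "t \<le> b" for t
  proof -
    have ta: "t < ?a" "N \<le> ?a - t" using t N by (auto simp: b_def)
    have "stieltjes \<nu> t \<le> 1 / (?a - t)" by (rule nu.stieltjes_le_left[OF ta(1)])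
    also have "\<dots> \<le> 1 / N" using ta N by (intro divide_left_mono mult_pos_pos) auto
    also have "1 / N < e" using N e(1) by (simp add: field_simps)
    finally have "\<bar>- stieltjes \<nu> t\<bar> < e" using nu.stieltjes_pos[OF ta(1)] by simp
    note R = e(2)[OF this]
    then have dom: "t \<in> domF \<mu> \<nu>" using ta by (simp add: domF_def)
    have "inverse_moment \<nu> 2 t \<le> 1 / (?a - t)\<^sup>2" by (rule nu.inverse_moment_2_le[OF ta(1)])
    also have "\<dots> \<le> 1 / N\<^sup>2" using ta N by (intro divide_left_mono mult_pos_pos power_mono) auto
    also have "\<dots> \<le> 1 / N" using N by (simp add: field_simps power2_eq_square)
    finally have M: "inverse_moment \<nu> 2 t \<le> 1 / N" .
    have M0: "inverse_moment \<nu> 2 t > 0" by (rule nu.inverse_moment_2_pos) (use ta in auto)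
    have "?R' (- stieltjes \<nu> t) * inverse_moment \<nu> 2 t < C * inverse_moment \<nu> 2 t"
      using R M0 by (intro mult_strict_right_mono) auto
    also have "\<dots> \<le> N * (1 / N)" using N M M0 by (intro mult_mono) (auto simp: C_def)
    finally show ?thesis using dom N by (simp add: deriv_F)
  qed
  then show ?thesis by (intro that[of b]) auto
qed

lemma domF_nonempty: "domF \<mu> \<nu> \<noteq> {}"
  using deriv_F_pos_near_minus_infinity by blast

lemma bdd_above_domF: "bdd_above (domF \<mu> \<nu>)"
  using domF_below by (intro bdd_aboveI[of _ "supp_minus \<nu>"]) (auto intro: less_imp_le)

lemma domF_eq: "domF \<mu> \<nu> = {..<Sup (domF \<mu> \<nu>)}"
proof (intro equalityI subsetI)
  fix h assume h: "h \<in> domF \<mu> \<nu>"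
  then obtain e where "e > 0" "ball h e \<subseteq> domF \<mu> \<nu>" using open_domF open_contains_ball by blast
  then have "h + e / 2 \<in> domF \<mu> \<nu>" by (auto simp: dist_norm subset_eq)
  then have "h + e / 2 \<le> Sup (domF \<mu> \<nu>)" by (intro cSup_upper bdd_above_domF)
  with \<open>e > 0\<close> show "h \<in> {..<Sup (domF \<mu> \<nu>)}" by auto
next
  fix h assume "h \<in> {..<Sup (domF \<mu> \<nu>)}"
  then show "h \<in> domF \<mu> \<nu>"
    using less_cSupE[of h "domF \<mu> \<nu>"] domF_nonempty domF_down by (metis lessThan_iff less_imp_le)
qed

lemma Sup_domF_le: "Sup (domF \<mu> \<nu>) \<le> supp_minus \<nu>"
  using domF_nonempty domF_below by (intro cSup_least) (auto intro: less_imp_le)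

text \<open>The derivative is positive far to the left, so by the intermediate value theorem it
  cannot cease to be positive without a zero.\<close>

lemma no_critical_point_left:
  assumes h: "h \<in> domF \<mu> \<nu>" and nc: "\<And>c. critical_point \<mu> \<nu> c \<Longrightarrow> h < c"
  shows "deriv (F \<mu> \<nu>) h > 0"
proof (rule ccontr)
  assume neg: "\<not> deriv (F \<mu> \<nu>) h > 0"
  obtain b where b: "b \<in> domF \<mu> \<nu>" "\<And>t. t \<le> b \<Longrightarrow> deriv (F \<mu> \<nu>) t > 0"
    using deriv_F_pos_near_minus_infinity by blast
  have "b \<le> h" using b(2)[of h] neg by (cases "b \<le> h") auto
  moreover have "{b..h} \<subseteq> domF \<mu> \<nu>" using domF_down[OF h] by auto
  ultimately obtain c where c: "b \<le> c" "c \<le> h" "deriv (F \<mu> \<nu>) c = 0"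
    using IVT2'[of "deriv (F \<mu> \<nu>)" h 0 b] neg b(2)[of b] continuous_on_deriv_F[of "{b..h}"] by auto
  then have "critical_point \<mu> \<nu> c" using domF_down[OF h c(2)] by (simp add: critical_point_def)
  with nc c(2) show False by force
qed

text \<open>Between a point b with positive derivative to its left and any critical point c0, the
  zeros of the derivative form a nonempty compact set; its minimum m is the leftmost critical
  point.\<close>

lemma hstar_critical:
  assumes "\<exists>c. critical_point \<mu> \<nu> c"
  shows "critical_point \<mu> \<nu> (hstar \<mu> \<nu>)" and "critical_point \<mu> \<nu> c \<Longrightarrow> hstar \<mu> \<nu> \<le> c"
proof -
  obtain c0 where c0: "critical_point \<mu> \<nu> c0" using assms by blast
  obtain b where b: "b \<in> domF \<mu> \<nu>" "\<And>t. t \<le> b \<Longrightarrow> deriv (F \<mu> \<nu>) t > 0"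
    using deriv_F_pos_near_minus_infinity by blast
  define Z where "Z = {t \<in> {b..c0}. deriv (F \<mu> \<nu>) t = 0}"
  have c0dom: "c0 \<in> domF \<mu> \<nu>" "deriv (F \<mu> \<nu>) c0 = 0" using c0 by (auto simp: critical_point_def)
  have bc: "b < c0" using b(2)[of c0] c0dom by (cases "b < c0") auto
  have sub: "{b..c0} \<subseteq> domF \<mu> \<nu>" using domF_down[OF c0dom(1)] by auto
  have "closed Z" unfolding Z_def
    by (intro continuous_closed_preimage_constant continuous_on_deriv_F sub) auto
  moreover have "bounded Z" unfolding Z_def by (rule bounded_subset[of "{b..c0}"]) auto
  ultimately have "compact Z" by (simp add: compact_eq_bounded_closed)
  moreover have "Z \<noteq> {}" using bc c0dom by (auto simp: Z_def)
  ultimately obtain m where m: "m \<in> Z" "\<And>t. t \<in> Z \<Longrightarrow> m \<le> t"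
    using compact_attains_inf[of Z] by blast
  have mcrit: "critical_point \<mu> \<nu> m" using m(1) sub by (auto simp: Z_def critical_point_def)
  have least: "m \<le> c" if "critical_point \<mu> \<nu> c" for c
  proof (cases "c \<le> c0")
    case True
    have "b < c" using b(2)[of c] that by (cases "b < c") (auto simp: critical_point_def)
    then show ?thesis using m(2)[of c] that True by (auto simp: Z_def critical_point_def)
  next
    case False
    then show ?thesis using m(1) by (auto simp: Z_def)
  qed
  have mdom: "m \<in> domF \<mu> \<nu>" using mcrit by (simp add: critical_point_def)
  \<comment> \<open>\<open>Hset\<close> requires positivity strictly to the left of its elements, so
    m itself belongs to it.\<close>
  have "Hset \<mu> \<nu> = {..m}"
  proof (intro equalityI subsetI)
    fix h assume "h \<in> Hset \<mu> \<nu>"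
    then have "\<not> m < h" using mcrit unfolding Hset_def critical_point_def by force
    then show "h \<in> {..m}" by simp
  next
    fix h assume "h \<in> {..m}"
    then have "deriv (F \<mu> \<nu>) t > 0" if "t < h" for t
      using that least by (intro no_critical_point_left domF_down[OF mdom]) force+
    then show "h \<in> Hset \<mu> \<nu>" using \<open>h \<in> {..m}\<close> domF_down[OF mdom] by (auto simp: Hset_def)
  qed
  then have "hstar \<mu> \<nu> = m" by (simp add: hstar_def)
  then show "critical_point \<mu> \<nu> (hstar \<mu> \<nu>)" "critical_point \<mu> \<nu> c \<Longrightarrow> hstar \<mu> \<nu> \<le> c"
    using mcrit least by auto
qed

lemma hstar_no_critical:
  assumes "\<not> (\<exists>c. critical_point \<mu> \<nu> c)"
  shows "hstar \<mu> \<nu> = Sup (domF \<mu> \<nu>)"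
proof -
  have "Hset \<mu> \<nu> = domF \<mu> \<nu>"
    using assms domF_down unfolding Hset_def by (auto intro!: no_critical_point_left)
  then show ?thesis by (simp add: hstar_def)
qed

lemma below_hstar:
  assumes "t < hstar \<mu> \<nu>"
  shows "t \<in> domF \<mu> \<nu>" and "deriv (F \<mu> \<nu>) t > 0"
proof -
  show dom: "t \<in> domF \<mu> \<nu>"
  proof (cases "\<exists>c. critical_point \<mu> \<nu> c")
    case True
    then show ?thesis using hstar_critical(1) domF_down assms by (auto simp: critical_point_def)
  next
    case False
    then show ?thesis using hstar_no_critical assms domF_eq by auto
  qed
  show "deriv (F \<mu> \<nu>) t > 0"
    using hstar_critical(2) assms by (intro no_critical_point_left[OF dom]) force
qed

lemma hstar_le_Sup: "hstar \<mu> \<nu> \<le> Sup (domF \<mu> \<nu>)"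
  using hstar_critical(1) hstar_no_critical
  by (cases "\<exists>c. critical_point \<mu> \<nu> c") (auto simp: critical_point_def intro!: cSup_upper bdd_above_domF)

lemma hstar_le_supp: "hstar \<mu> \<nu> \<le> supp_minus \<nu>"
  using hstar_le_Sup Sup_domF_le by simp

lemma F_less:
  assumes "s < t" "t \<le> hstar \<mu> \<nu>" "t \<in> domF \<mu> \<nu>"
  shows "F \<mu> \<nu> s < F \<mu> \<nu> t"
proof (rule DERIV_pos_imp_increasing_open[OF assms(1)])
  show "\<exists>y. (F \<mu> \<nu> has_real_derivative y) (at x) \<and> 0 < y" if "s < x" "x < t" for x
    using F_has_derivative below_hstar[of x] that assms by force
  show "continuous_on {s..t} (F \<mu> \<nu>)"
    using domF_down[OF assms(3)]
    by (intro continuous_at_imp_continuous_on ballI real_analytic_at_isCont F_analytic) auto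
qed

lemma stieltjes_left_tendsto_hstar:
  "((\<lambda>h. ereal (stieltjes \<nu> h)) \<longlongrightarrow> stieltjes_left \<nu> (hstar \<mu> \<nu>)) (at_left (hstar \<mu> \<nu>))"
proof (cases "hstar \<mu> \<nu> < supp_minus \<nu>")
  case True
  then have "isCont (stieltjes \<nu>) (hstar \<mu> \<nu>)"
    by (intro real_analytic_at_isCont nu.real_analytic_stieltjes) auto
  then have "(stieltjes \<nu> \<longlongrightarrow> stieltjes \<nu> (hstar \<mu> \<nu>)) (at_left (hstar \<mu> \<nu>))"
    using tendsto_mono[OF at_le[OF subset_UNIV]] unfolding isCont_def by blast
  then show ?thesis using True by (simp add: stieltjes_left_def)
next
  case False
  then have "hstar \<mu> \<nu> = supp_minus \<nu>" using hstar_le_supp by simp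
  then show ?thesis using nu.stieltjes_left_tendsto by simp
qed

text \<open>If \<open>stieltjes \<nu>\<close> took the edge value m of \<mu> at h', then
  \<open>edge_critical\<close> would give the derivative 1 / m^2 of the R-transform, and F' = 1 -
  \<open>inverse_moment \<nu> 2 h'\<close> / m^2 would be at most 0 by Cauchy-Schwarz. So without
  critical points F only sees genuine values of \<open>stieltjes \<mu>\<close>, never the
  continuation.\<close>

lemma no_critical_below_edge:
  assumes nc: "\<not> (\<exists>c. critical_point \<mu> \<nu> c)" and h: "h \<in> domF \<mu> \<nu>"
  shows "ereal (stieltjes \<nu> h) < stieltjes_left \<mu> (supp_minus \<mu>)"
proof (rule ccontr)
  assume "\<not> ?thesis"
  then have le: "stieltjes_left \<mu> (supp_minus \<mu>) \<le> ereal (stieltjes \<nu> h)" by simp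
  obtain m where m: "stieltjes_left \<mu> (supp_minus \<mu>) = ereal m" "0 < m"
    using le mu.stieltjes_left_pos by (cases "stieltjes_left \<mu> (supp_minus \<mu>)") auto
  have "ereal m < stieltjes_left \<nu> (supp_minus \<nu>)"
    using le_less_trans[OF le nu.stieltjes_less_stieltjes_left[OF domF_below[OF h]]] m by simp
  then obtain h' where h': "h' < supp_minus \<nu>" "stieltjes \<nu> h' = m"
    using nu.stieltjes_attains_left[OF m(2)] by blast
  then have "h' \<le> h"
    using le m nu.stieltjes_less_iff[OF domF_below[OF h] h'(1)] by auto
  then have dom: "h' \<in> domF \<mu> \<nu>" by (rule domF_down[OF h])
  then have "deriv (R_transform \<mu>) (- m) = 1 / m\<^sup>2"
    using h' by (intro mu.edge_critical m(1)) (simp add: domF_def)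
  then have "deriv (F \<mu> \<nu>) h' = 1 - inverse_moment \<nu> 2 h' / m\<^sup>2"
    using deriv_F[OF dom] h' by simp
  moreover have "m\<^sup>2 \<le> inverse_moment \<nu> 2 h'"
    using nu.inverse_moment_log_convex[OF h'(1), of 0] h'(2) by (simp add: stieltjes_eq_inverse_moment numeral_2_eq_2)
  then have "1 \<le> inverse_moment \<nu> 2 h' / m\<^sup>2" using m(2) by simp
  moreover have "deriv (F \<mu> \<nu>) h' > 0" using nc by (intro no_critical_point_left[OF dom]) blast
  ultimately show False by simp
qed

text \<open>If \<open>hstar\<close> is not the edge of \<nu>, then - \<open>stieltjes \<nu>\<close>
  leaves \<open>R_domain \<mu>\<close> there. All values of - \<open>stieltjes \<mu>\<close> belong
  to that domain, so the edge value of \<mu> is not above the limit; passing to the limit in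
  \<open>no_critical_below_edge\<close> gives the other inequality.\<close>

lemma no_critical_hstar_inside:
  assumes nc: "\<not> (\<exists>c. critical_point \<mu> \<nu> c)" and "hstar \<mu> \<nu> \<noteq> supp_minus \<nu>"
  shows "stieltjes_left \<mu> (supp_minus \<mu>) = stieltjes_left \<nu> (hstar \<mu> \<nu>)"
proof -
  let ?b = "hstar \<mu> \<nu>"
  have b: "?b < supp_minus \<nu>" using hstar_le_supp assms(2) by simp
  have "?b \<notin> domF \<mu> \<nu>" using domF_eq hstar_no_critical[OF nc] by auto
  then have nd: "- stieltjes \<nu> ?b \<notin> R_domain \<mu>" using b by (simp add: domF_def)
  have "eventually (\<lambda>h. ereal (stieltjes \<nu> h) \<le> stieltjes_left \<mu> (supp_minus \<mu>)) (at_left ?b)"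
    using no_critical_below_edge[OF nc] below_hstar(1)
    by (intro eventually_at_leftI[of "?b - 1"]) (auto intro: less_imp_le)
  then have "stieltjes_left \<nu> ?b \<le> stieltjes_left \<mu> (supp_minus \<mu>)"
    by (intro tendsto_upperbound[OF stieltjes_left_tendsto_hstar]) auto
  moreover have "\<not> stieltjes_left \<nu> ?b < stieltjes_left \<mu> (supp_minus \<mu>)"
  proof
    assume "stieltjes_left \<nu> ?b < stieltjes_left \<mu> (supp_minus \<mu>)"
    then have "ereal (stieltjes \<nu> ?b) < stieltjes_left \<mu> (supp_minus \<mu>)"
      using b by (simp add: stieltjes_left_def)
    then obtain z where "z < supp_minus \<mu>" "stieltjes \<mu> z = stieltjes \<nu> ?b"
      using mu.stieltjes_attains_left[OF nu.stieltjes_pos[OF b]] by blast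
    then show False using mu.uminus_stieltjes_in_R_domain nd by metis
  qed
  ultimately show ?thesis by simp
qed

section \<open>Global maxima of F extended to its right endpoint\<close>

lemma F_global_max_no_critical:
  assumes nc: "\<not> (\<exists>c. critical_point \<mu> \<nu> c)"
  shows "F_global_max \<mu> \<nu> h \<longleftrightarrow> h = hstar \<mu> \<nu>"
proof -
  define b where "b = hstar \<mu> \<nu>"
  have dom: "domF \<mu> \<nu> = {..<b}" and Sup: "Sup (domF \<mu> \<nu>) = b"
    using domF_eq hstar_no_critical[OF nc] by (simp_all add: b_def)
  have mono: "F \<mu> \<nu> x < F \<mu> \<nu> y" if "x < y" "y < b" for x y
    using that dom by (intro F_less) (auto simp: b_def)
  have "((\<lambda>x. ereal (F \<mu> \<nu> x)) \<longlongrightarrow> (SUP x\<in>{b - 1<..<b}. ereal (F \<mu> \<nu> x))) (at_left b)"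
    using mono by (intro tendsto_at_left_SUP) (auto simp: le_less)
  then have Lb: "F_ext \<mu> \<nu> b = (SUP x\<in>{b - 1<..<b}. ereal (F \<mu> \<nu> x))"
    by (simp add: F_ext_def dom tendsto_Lim)
  have less: "F_ext \<mu> \<nu> x < F_ext \<mu> \<nu> b" if "x < b" for x
  proof -
    define y where "y = max ((x + b) / 2) (b - 1 / 2)"
    have y: "x < y" "b - 1 < y" "y < b" using that by (auto simp: y_def max_def field_simps)
    have "F_ext \<mu> \<nu> x < ereal (F \<mu> \<nu> y)"
      using mono[OF y(1,3)] that by (simp add: F_ext_def dom)
    also have "\<dots> \<le> F_ext \<mu> \<nu> b"
      unfolding Lb using y by (intro SUP_upper) auto
    finally show ?thesis .
  qed
  have ext: "domF_ext \<mu> \<nu> = {..b}" by (auto simp: domF_ext_def Sup dom)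
  show ?thesis
    unfolding F_global_max_def is_arg_max_def ext b_def[symmetric]
    using less by (auto simp: not_less) (metis le_less less_asym order_refl)+
qed

text \<open>The horizontal tangent at a critical point gives the weak inequality; strict concavity
  at the midpoint of x and \<open>hstar\<close> upgrades it.\<close>

lemma F_le_hstar_concave:
  assumes sc: "strictly_concave_on (domF \<mu> \<nu>) (F \<mu> \<nu>)" and cr: "\<exists>c. critical_point \<mu> \<nu> c"
    and x: "x \<in> domF \<mu> \<nu>" "x \<noteq> hstar \<mu> \<nu>"
  shows "F \<mu> \<nu> x < F \<mu> \<nu> (hstar \<mu> \<nu>)"
proof -
  let ?h = "hstar \<mu> \<nu>"
  have h: "?h \<in> domF \<mu> \<nu>" "deriv (F \<mu> \<nu>) ?h = 0"
    using hstar_critical(1)[OF cr] by (auto simp: critical_point_def)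
  have conv: "convex (domF \<mu> \<nu>)" using sc by (simp add: strictly_concave_on_def)
  have strict: "(1 - u) * F \<mu> \<nu> p + u * F \<mu> \<nu> q < F \<mu> \<nu> ((1 - u) * p + u * q)"
    if "p \<in> domF \<mu> \<nu>" "q \<in> domF \<mu> \<nu>" "p \<noteq> q" "0 < u" "u < 1" for p q u
    using sc that unfolding strictly_concave_on_def by blast
  have "convex_on (domF \<mu> \<nu>) (\<lambda>x. - F \<mu> \<nu> x)"
  proof (rule convex_onI)
    fix t p q :: real
    assume t: "0 < t" "t < 1" and pq: "p \<in> domF \<mu> \<nu>" "q \<in> domF \<mu> \<nu>"
    show "- F \<mu> \<nu> ((1 - t) *\<^sub>R p + t *\<^sub>R q) \<le> (1 - t) * - F \<mu> \<nu> p + t * - F \<mu> \<nu> q"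
    proof (cases "p = q")
      case True
      have "(1 - t) * p + t * p = p" by (simp add: algebra_simps)
      then show ?thesis using True by (simp add: algebra_simps)
    next
      case False
      then show ?thesis using strict[OF pq False t] by simp
    qed
  qed (rule conv)
  moreover have "((\<lambda>x. - F \<mu> \<nu> x) has_real_derivative 0) (at ?h within domF \<mu> \<nu>)"
    using DERIV_minus[OF F_has_derivative(1)[OF h(1)]] h(2) by (auto intro: has_field_derivative_at_within)
  ultimately have le: "F \<mu> \<nu> y \<le> F \<mu> \<nu> ?h" if "y \<in> domF \<mu> \<nu>" for y
    using convex_on_imp_above_tangent[of "domF \<mu> \<nu>" "\<lambda>x. - F \<mu> \<nu> x" ?h y 0]
      that h(1) open_domF convex_connected[OF conv] by (simp add: interior_open)
  have "(1 - 1/2) * F \<mu> \<nu> ?h + 1/2 * F \<mu> \<nu> x < F \<mu> \<nu> ((1 - 1/2) * ?h + 1/2 * x)"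
    by (rule strict) (use h x in auto)
  also have "\<dots> \<le> F \<mu> \<nu> ?h"
  proof (rule le)
    have "(1 - 1/2) *\<^sub>R ?h + (1/2) *\<^sub>R x \<in> domF \<mu> \<nu>"
      by (rule convexD[OF conv h(1) x(1)]) auto
    then show "(1 - 1/2) * ?h + 1/2 * x \<in> domF \<mu> \<nu>" by simp
  qed
  finally show ?thesis by simp
qed

text \<open>Besides points of the domain, \<open>hstar\<close> must beat the value at the right
  endpoint. To the right of \<open>hstar\<close>, F is strictly decreasing by strict concavity, so
  this value exists as a limit and is smaller.\<close>

lemma F_global_max_concave:
  assumes sc: "strictly_concave_on (domF \<mu> \<nu>) (F \<mu> \<nu>)"
  shows "F_global_max \<mu> \<nu> h \<longleftrightarrow> h = hstar \<mu> \<nu>"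
proof (cases "\<exists>c. critical_point \<mu> \<nu> c")
  case cr: True
  let ?h = "hstar \<mu> \<nu>"
  define b where "b = Sup (domF \<mu> \<nu>)"
  have dom: "domF \<mu> \<nu> = {..<b}" using domF_eq by (simp add: b_def)
  have h: "?h < b"
    using hstar_critical(1)[OF cr] dom by (auto simp: critical_point_def)
  note lt = F_le_hstar_concave[OF sc cr]
  have strict: "(1 - u) * F \<mu> \<nu> p + u * F \<mu> \<nu> q < F \<mu> \<nu> ((1 - u) * p + u * q)"
    if "p < b" "q < b" "p \<noteq> q" "0 < u" "u < 1" for p q u
    using sc that unfolding strictly_concave_on_def dom by auto
  have decr: "F \<mu> \<nu> y < F \<mu> \<nu> x" if xy: "?h < x" "x < y" "y < b" for x y
  proof -
    define u where "u = (x - ?h) / (y - ?h)"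
    have u: "0 < u" "u < 1" using xy by (auto simp: u_def)
    have "(1 - u) * ?h + u * y = ?h + u * (y - ?h)" by (simp add: algebra_simps)
    also have "\<dots> = x" using xy by (simp add: u_def)
    finally have "(1 - u) * F \<mu> \<nu> ?h + u * F \<mu> \<nu> y < F \<mu> \<nu> x"
      using strict[of ?h y u] xy u h by simp
    moreover have "(1 - u) * F \<mu> \<nu> y < (1 - u) * F \<mu> \<nu> ?h"
      using lt[of y] xy u dom by (intro mult_strict_left_mono) auto
    ultimately show ?thesis by (simp add: algebra_simps)
  qed
  \<comment> \<open>Comparison through an intermediate point preserves strictness, which a bare
    passage to the limit would lose.\<close>
  define m where "m = (?h + b) / 2"
  have m: "?h < m" "m < b" using h by (auto simp: m_def)
  have "((\<lambda>x. ereal (- F \<mu> \<nu> x)) \<longlongrightarrow> (SUP x\<in>{?h<..<b}. ereal (- F \<mu> \<nu> x))) (at_left b)"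
    using decr h by (intro tendsto_at_left_SUP) (auto simp: le_less)
  from tendsto_uminus_ereal[OF this]
  have lim: "((\<lambda>x. ereal (F \<mu> \<nu> x)) \<longlongrightarrow> - (SUP x\<in>{?h<..<b}. ereal (- F \<mu> \<nu> x))) (at_left b)"
    by simp
  then have Lb: "F_ext \<mu> \<nu> b = - (SUP x\<in>{?h<..<b}. ereal (- F \<mu> \<nu> x))"
    by (simp add: F_ext_def dom tendsto_Lim)
  have "eventually (\<lambda>x. ereal (F \<mu> \<nu> x) \<le> ereal (F \<mu> \<nu> m)) (at_left b)"
    using m decr by (intro eventually_at_leftI[of m]) (auto intro: less_imp_le)
  then have "F_ext \<mu> \<nu> b \<le> ereal (F \<mu> \<nu> m)"
    unfolding Lb by (intro tendsto_upperbound[OF lim]) auto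
  also have "\<dots> < ereal (F \<mu> \<nu> ?h)" using lt[of m] m dom by simp
  finally have Fb: "F_ext \<mu> \<nu> b < F_ext \<mu> \<nu> ?h" using h by (simp add: F_ext_def dom)
  have less: "F_ext \<mu> \<nu> x < F_ext \<mu> \<nu> ?h" if "x \<le> b" "x \<noteq> ?h" for x
  proof (cases "x = b")
    case False
    then show ?thesis using that lt[of x] h by (simp add: F_ext_def dom)
  qed (use Fb in simp)
  have ext: "domF_ext \<mu> \<nu> = {..b}" by (auto simp: domF_ext_def b_def[symmetric] dom)
  show ?thesis
    unfolding F_global_max_def is_arg_max_def ext
    using less h by (metis atMost_iff less_asym less_imp_le)
qed (rule F_global_max_no_critical)

end

subsection \<open>Free convolution\<close>

locale free_conv = compact_pair \<mu> \<nu> + rho: compact_prob \<rho> for \<mu> \<nu> \<rho> :: "real measure" +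
  assumes R_domain_conv: "R_domain \<mu> \<inter> R_domain \<nu> \<subseteq> R_domain \<rho>"
    and R_transform_conv: "\<And>t. t \<in> R_domain \<mu> \<Longrightarrow> t \<in> R_domain \<nu> \<Longrightarrow>
      R_transform \<rho> t = R_transform \<mu> t + R_transform \<nu> t"
begin

section \<open>F and the edge of the convolution\<close>

lemma deriv_R_transform_conv:
  assumes "t \<in> R_domain \<mu>" "t \<in> R_domain \<nu>"
  shows "deriv (R_transform \<rho>) t = deriv (R_transform \<mu>) t + deriv (R_transform \<nu>) t"
proof -
  have "((\<lambda>t. R_transform \<mu> t + R_transform \<nu> t) has_real_derivative
      deriv (R_transform \<mu>) t + deriv (R_transform \<nu>) t) (at t)"
    using assms by (intro DERIV_add real_analytic_at_has_derivative mu.real_analytic_R_transform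
        nu.real_analytic_R_transform)
  moreover have "eventually (\<lambda>s. s \<in> R_domain \<mu> \<inter> R_domain \<nu>) (nhds t)"
    using assms mu.open_R_domain nu.open_R_domain by (intro eventually_nhds_in_open) auto
  then have "eventually (\<lambda>t. R_transform \<rho> t = R_transform \<mu> t + R_transform \<nu> t) (nhds t)"
    by eventually_elim (simp add: R_transform_conv)
  ultimately show ?thesis
    using DERIV_cong_ev DERIV_imp_deriv by fastforce
qed

lemma domF_R_domains:
  assumes "h \<in> domF \<mu> \<nu>"
  shows "- stieltjes \<nu> h \<in> R_domain \<mu>" "- stieltjes \<nu> h \<in> R_domain \<nu>" "- stieltjes \<nu> h \<in> R_domain \<rho>"
  using assms nu.uminus_stieltjes_in_R_domain[OF domF_below[OF assms]] R_domain_conv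
  by (auto simp: domF_def)

lemma F_eq_R_transform_conv:
  assumes "h \<in> domF \<mu> \<nu>"
  shows "F \<mu> \<nu> h = R_transform \<rho> (- stieltjes \<nu> h) - 1 / stieltjes \<nu> h"
  using R_transform_conv[OF domF_R_domains(1,2)[OF assms]]
    nu.R_transform_stieltjes[OF domF_below[OF assms]]
  by (simp add: F_def)

lemma deriv_F_conv:
  assumes "h \<in> domF \<mu> \<nu>"
  shows "deriv (F \<mu> \<nu>) h =
    (1 / (stieltjes \<nu> h)\<^sup>2 - deriv (R_transform \<rho>) (- stieltjes \<nu> h)) * inverse_moment \<nu> 2 h"
proof -
  have "inverse_moment \<nu> 2 h > 0"
    using nu.inverse_moment_pos[OF domF_below[OF assms]] .
  then show ?thesis
    by (simp add: deriv_F[OF assms] deriv_R_transform_conv[OF domF_R_domains(1,2)[OF assms]]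
        nu.deriv_R_transform_stieltjes[OF domF_below[OF assms]] field_simps)
qed

lemma gstar_eq: "gstar \<rho> = stieltjes_left \<rho> (supp_minus \<rho>)"
  by (simp add: gstar_def zstar_def)

text \<open>Below \<open>gstar \<rho>\<close> the value of \<open>stieltjes \<nu>\<close> at h is
  also a value of \<open>stieltjes \<rho>\<close>, at some z, and inverting both transforms gives F
  h = z. The derivative is then the quotient of the two second inverse moments.\<close>

lemma below_gstar:
  assumes h: "h \<in> domF \<mu> \<nu>" and less: "ereal (stieltjes \<nu> h) < gstar \<rho>"
  shows "F \<mu> \<nu> h < supp_minus \<rho>" and "stieltjes \<rho> (F \<mu> \<nu> h) = stieltjes \<nu> h"
    and "deriv (F \<mu> \<nu>) h > 0"
proof -
  obtain z where z: "z < supp_minus \<rho>" "stieltjes \<rho> z = stieltjes \<nu> h"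
    using rho.stieltjes_attains_left[OF nu.stieltjes_pos[OF domF_below[OF h]]] less
    unfolding gstar_eq by blast
  have "F \<mu> \<nu> h = z"
    using F_eq_R_transform_conv[OF h] rho.R_transform_stieltjes[OF z(1)] z(2) by simp
  with z show "F \<mu> \<nu> h < supp_minus \<rho>" "stieltjes \<rho> (F \<mu> \<nu> h) = stieltjes \<nu> h" by auto
  have "deriv (F \<mu> \<nu>) h = inverse_moment \<nu> 2 h / inverse_moment \<rho> 2 z"
    using deriv_F_conv[OF h] rho.deriv_R_transform_stieltjes[OF z(1)] z(2) by simp
  then show "deriv (F \<mu> \<nu>) h > 0"
    using nu.inverse_moment_pos[OF domF_below[OF h]] rho.inverse_moment_pos[OF z(1)] by simp
qed

lemma at_gstar:
  assumes h: "h \<in> domF \<mu> \<nu>" and eq: "gstar \<rho> = ereal (stieltjes \<nu> h)"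
  shows "deriv (F \<mu> \<nu>) h = 0" and "F \<mu> \<nu> h = supp_minus \<rho>"
  using rho.edge_critical[OF eq[unfolded gstar_eq] domF_R_domains(3)[OF h]]
  by (simp_all add: deriv_F_conv[OF h] F_eq_R_transform_conv[OF h])

lemma gstar_attained:
  assumes h: "h \<in> domF \<mu> \<nu>" and le: "gstar \<rho> \<le> ereal (stieltjes \<nu> h)"
  obtains h' where "h' \<le> h" "h' \<in> domF \<mu> \<nu>" "gstar \<rho> = ereal (stieltjes \<nu> h')"
proof -
  obtain g where g: "gstar \<rho> = ereal g" "0 < g"
    using le rho.stieltjes_left_pos unfolding gstar_eq by (cases "stieltjes_left \<rho> (supp_minus \<rho>)") auto
  have "ereal g < stieltjes_left \<nu> (supp_minus \<nu>)"
    using le_less_trans[OF le nu.stieltjes_less_stieltjes_left[OF domF_below[OF h]]] g by simp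
  then obtain h' where h': "h' < supp_minus \<nu>" "stieltjes \<nu> h' = g"
    using nu.stieltjes_attains_left[OF g(2)] by blast
  then have "h' \<le> h"
    using le g nu.stieltjes_less_iff[OF domF_below[OF h] h'(1)] by auto
  with domF_down[OF h this] h' g show ?thesis by (intro that) auto
qed

lemma below_hstar_gstar:
  assumes "h < hstar \<mu> \<nu>"
  shows "ereal (stieltjes \<nu> h) < gstar \<rho>"
proof (rule ccontr)
  assume "\<not> ?thesis"
  then obtain h' where h': "h' \<le> h" "h' \<in> domF \<mu> \<nu>" "gstar \<rho> = ereal (stieltjes \<nu> h')"
    using gstar_attained[OF below_hstar(1)[OF assms]] by (metis not_less)
  then have "deriv (F \<mu> \<nu>) h' = 0" by (intro at_gstar)
  moreover have "deriv (F \<mu> \<nu>) h' > 0" using h' assms by (intro below_hstar) simp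
  ultimately show False by simp
qed

text \<open>A vanishing derivative excludes values below \<open>gstar \<rho>\<close>. So
  \<open>gstar \<rho>\<close> is taken at some h' up to \<open>hstar\<close>; h' is critical, and
  minimality of \<open>hstar\<close> forces equality.\<close>

lemma critical_gstar:
  assumes "\<exists>c. critical_point \<mu> \<nu> c"
  shows "gstar \<rho> = ereal (stieltjes \<nu> (hstar \<mu> \<nu>))"
proof -
  have h: "hstar \<mu> \<nu> \<in> domF \<mu> \<nu>" "deriv (F \<mu> \<nu>) (hstar \<mu> \<nu>) = 0"
    using hstar_critical(1)[OF assms] by (auto simp: critical_point_def)
  have "\<not> ereal (stieltjes \<nu> (hstar \<mu> \<nu>)) < gstar \<rho>"
    using below_gstar(3)[OF h(1)] h(2) by auto
  then obtain h' where h': "h' \<le> hstar \<mu> \<nu>" "h' \<in> domF \<mu> \<nu>" "gstar \<rho> = ereal (stieltjes \<nu> h')"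
    using gstar_attained[OF h(1)] by (metis not_less)
  have "critical_point \<mu> \<nu> h'" using h' at_gstar(1) by (simp add: critical_point_def)
  then have "h' = hstar \<mu> \<nu>" using hstar_critical(2)[OF assms] h'(1) by force
  then show ?thesis using h' by simp
qed

text \<open>Here \<open>w z\<close> and \<open>v z\<close> are the values of the two subordination functions of \<open>\<rho>\<close>.\<close>

lemma subordination_nonneg:
  assumes w: "w z < supp_minus \<mu>" and v: "v z < supp_minus \<nu>" "v z \<in> domF \<mu> \<nu>"
    and Gv: "stieltjes \<nu> (v z) = stieltjes \<mu> (w z)"
    and pos: "deriv (F \<mu> \<nu>) (v z) > 0"
    and aw: "real_analytic_at w z" and av: "real_analytic_at v z"
    and eqv: "eventually (\<lambda>y. v y = y + (- 1 / stieltjes \<mu> (w y) - w y)) (nhds z)"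
    and eqw: "eventually (\<lambda>y. w y = y + (- 1 / stieltjes \<nu> (v y) - v y)) (nhds z)"
  shows "\<exists>C D. (\<lambda>y. w (z + y)) has_fps_expansion C \<and> (\<lambda>y. v (z + y)) has_fps_expansion D \<and>
        (\<forall>n\<ge>1. fps_nth C n \<ge> 0 \<and> fps_nth D n \<ge> 0)"
proof -
  define G where "G = stieltjes \<mu> (w z)"
  have G: "G > 0" using mu.stieltjes_pos[OF w] by (simp add: G_def)
  \<comment> \<open>The quotients a and b are 1 plus the linear coefficients of - 1 / G - id for
    \<mu> and \<nu>.\<close>
  define a where "a = inverse_moment \<mu> 2 (w z) / G\<^sup>2"
  define b where "b = inverse_moment \<nu> 2 (v z) / G\<^sup>2"
  have M: "inverse_moment \<mu> 2 (w z) > 0" "inverse_moment \<nu> 2 (v z) > 0"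
    using mu.inverse_moment_pos[OF w] nu.inverse_moment_pos[OF v(1)] by auto
  have "a > 0" using G M by (simp add: a_def)
  have "deriv (R_transform \<mu>) (- stieltjes \<nu> (v z)) = 1 / G\<^sup>2 - 1 / inverse_moment \<mu> 2 (w z)"
    unfolding Gv using mu.deriv_R_transform_stieltjes[OF w] by (simp add: G_def)
  then have "0 < 1 - (1 / G\<^sup>2 - 1 / inverse_moment \<mu> 2 (w z)) * inverse_moment \<nu> 2 (v z)"
    using pos deriv_F[OF v(2)] by simp
  \<comment> \<open>Positivity of F' turns into a + b - a * b > 0, that is (a - 1) * (b - 1) < 1:
    the determinant condition on the linear coefficients.\<close>
  also have "\<dots> = (a + b - a * b) / a"
    using G M by (simp add: a_def b_def field_simps power2_eq_square)
  finally have "a + b - a * b > 0"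
    using \<open>a > 0\<close> by (simp add: zero_less_divide_iff)
  then have det: "(a - 1) * (b - 1) < 1" by (simp add: algebra_simps)
  obtain A where A: "(\<lambda>y. - 1 / stieltjes \<mu> (w z + y) - (w z + y)) has_fps_expansion A"
    "\<And>n. n \<ge> 1 \<Longrightarrow> fps_nth A n \<ge> 0" "fps_nth A 1 = a - 1"
    using mu.has_fps_expansion_H[OF w] unfolding a_def G_def by blast
  obtain B where B: "(\<lambda>y. - 1 / stieltjes \<nu> (v z + y) - (v z + y)) has_fps_expansion B"
    "\<And>n. n \<ge> 1 \<Longrightarrow> fps_nth B n \<ge> 0" "fps_nth B 1 = b - 1"
    using nu.has_fps_expansion_H[OF v(1)] unfolding b_def G_def Gv by blast
  obtain C where C: "(\<lambda>y. w (z + y)) has_fps_expansion C" using aw by (rule real_analytic_at_fpsE)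
  obtain D where D: "(\<lambda>y. v (z + y)) has_fps_expansion D" using av by (rule real_analytic_at_fpsE)
  define C0 where "C0 = C - fps_const (w z)"
  define D0 where "D0 = D - fps_const (v z)"
  have C0: "(\<lambda>y. w (z + y) - w z) has_fps_expansion C0" "fps_nth C0 0 = 0"
    unfolding C0_def using C has_fps_expansion_imp_0_eq_fps_nth_0[OF C]
    by (auto intro: fps_expansion_intros)
  have D0: "(\<lambda>y. v (z + y) - v z) has_fps_expansion D0" "fps_nth D0 0 = 0"
    unfolding D0_def using D has_fps_expansion_imp_0_eq_fps_nth_0[OF D]
    by (auto intro: fps_expansion_intros)
  have lim: "filterlim (\<lambda>y. z + y) (nhds z) (nhds 0)"
    by (rule tendsto_eq_intros filterlim_ident | simp)+
  \<comment> \<open>Coefficient comparison in p = id + k o q, stated once for both subordination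
    equations; the constant term of the inner series is removed beforehand.\<close>
  have step: "fps_nth P n = fps_nth fps_X n + fps_nth (E oo Q) n"
    if p: "(\<lambda>y. p (z + y)) has_fps_expansion P" and q: "(\<lambda>y. q (z + y) - q z) has_fps_expansion Q"
      and Q0: "fps_nth Q 0 = 0" and k: "(\<lambda>y. k (q z + y)) has_fps_expansion E"
      and ev: "eventually (\<lambda>y. p y = y + k (q y)) (nhds z)" and n: "n \<ge> 1"
    for p q k :: "real \<Rightarrow> real" and P Q E n
  proof -
    have "(\<lambda>y. k (q z + (q (z + y) - q z))) has_fps_expansion (E oo Q)"
      by (rule has_fps_expansion_compose_real[OF k q Q0])
    then have "(\<lambda>y. (z + y) + k (q z + (q (z + y) - q z))) has_fps_expansion (fps_const z + fps_X) + (E oo Q)"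
      by (intro fps_expansion_intros)
    moreover have "eventually (\<lambda>y. p (z + y) = (z + y) + k (q (z + y))) (nhds 0)"
      using filterlim_iff[THEN iffD1, OF lim] ev by auto
    ultimately have "(\<lambda>y. p (z + y)) has_fps_expansion (fps_const z + fps_X) + (E oo Q)"
      by (auto simp: has_fps_expansion_def elim: eventually_elim2)
    from fps_expansion_unique_real[OF p this] n show ?thesis by simp
  qed
  have "fps_nth C0 n \<ge> 0 \<and> fps_nth D0 n \<ge> 0" if n: "n \<ge> 1" for n
  proof (rule fps_subordination_nonneg[OF C0(2) D0(2) A(2) B(2) _ _ _ n])
    show "fps_nth A 1 * fps_nth B 1 < 1" using det A(3) B(3) by simp
    show "fps_nth D0 n = fps_nth fps_X n + fps_nth (A oo C0) n" if "n \<ge> 1" for n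
      using step[of v D w C0 "\<lambda>y. - 1 / stieltjes \<mu> y - y" A, OF D C0 A(1) eqv that] that
      by (simp add: D0_def)
    show "fps_nth C0 n = fps_nth fps_X n + fps_nth (B oo D0) n" if "n \<ge> 1" for n
      using step[of w C v D0 "\<lambda>y. - 1 / stieltjes \<nu> y - y" B, OF C D0 B(1) eqw that] that
      by (simp add: C0_def)
  qed
  then have "fps_nth C n \<ge> 0 \<and> fps_nth D n \<ge> 0" if "n \<ge> 1" for n
    using that by (auto simp: C0_def D0_def split: if_splits)
  with C D show ?thesis by blast
qed

text \<open>Let \<gamma> be the limit of \<open>stieltjes \<nu>\<close> at \<open>hstar\<close>. If
  \<gamma> were below \<open>gstar \<rho>\<close>, then \<gamma> =
  \<open>stieltjes \<rho> z0\<close> for some z0 left of the edge. The functions w and v carry z to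
  the points where \<open>stieltjes \<mu>\<close> and \<open>stieltjes \<nu>\<close> equal
  \<open>stieltjes \<rho> z\<close>; a priori they exist only for z < z0, and the work consists in
  continuing w, and with it both R-transforms, to z0.\<close>

lemma no_critical_gstar:
  assumes nc: "\<not> (\<exists>c. critical_point \<mu> \<nu> c)"
  shows "stieltjes_left \<nu> (hstar \<mu> \<nu>) = gstar \<rho>"
proof (rule ccontr)
  assume ne: "stieltjes_left \<nu> (hstar \<mu> \<nu>) \<noteq> gstar \<rho>"
  define b where "b = hstar \<mu> \<nu>"
  have domb: "domF \<mu> \<nu> = {..<b}" using domF_eq hstar_no_critical[OF nc] by (simp add: b_def)
  have ba: "b \<le> supp_minus \<nu>" using hstar_le_supp by (simp add: b_def)
  note lim = stieltjes_left_tendsto_hstar[folded b_def]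
  have "eventually (\<lambda>h. ereal (stieltjes \<nu> h) \<le> gstar \<rho>) (at_left b)"
    using below_hstar_gstar by (intro eventually_at_leftI[of "b - 1"]) (auto simp: b_def intro: less_imp_le)
  then have "stieltjes_left \<nu> b \<le> gstar \<rho>"
    by (intro tendsto_upperbound[OF lim]) auto
  with ne have less: "stieltjes_left \<nu> b < gstar \<rho>" by (simp add: b_def)
  have below: "ereal (stieltjes \<nu> h) < stieltjes_left \<nu> b" if "h < b" for h
  proof (cases "b < supp_minus \<nu>")
    case True
    then show ?thesis using that nu.stieltjes_less_left[of h b] by (simp add: stieltjes_left_def)
  next
    case False
    then have "b = supp_minus \<nu>" using ba by simp
    then show ?thesis using that nu.stieltjes_less_stieltjes_left by simp
  qed
  have "0 < stieltjes \<nu> (b - 1)" using ba by (intro nu.stieltjes_pos) simp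
  with below[of "b - 1"] less obtain \<gamma> where \<gamma>: "stieltjes_left \<nu> b = ereal \<gamma>" "\<gamma> > 0"
    by (cases "stieltjes_left \<nu> b") auto
  obtain z0 where z0: "z0 < supp_minus \<rho>" "stieltjes \<rho> z0 = \<gamma>"
    using rho.stieltjes_attains_left[OF \<gamma>(2)] less \<gamma>(1) unfolding gstar_eq by metis
  define w where "w = (\<lambda>z. stieltjes_inv \<mu> (stieltjes \<rho> z))"
  define v where "v = (\<lambda>z. stieltjes_inv \<nu> (stieltjes \<rho> z))"
  \<comment> \<open>All values below the limit are taken to the left of b, whether b is inside the
    half-line or is the edge itself.\<close>
  have attained: "\<exists>h<b. stieltjes \<nu> h = g" if g: "0 < g" "g < \<gamma>" for g
  proof -
    have "ereal g < stieltjes_left \<nu> (supp_minus \<nu>)"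
    proof (cases "b < supp_minus \<nu>")
      case True
      then show ?thesis using \<gamma>(1) g(2) nu.stieltjes_less_stieltjes_left[OF True]
        by (auto simp: stieltjes_left_def elim: order.strict_trans[rotated])
    next
      case False
      then have "b = supp_minus \<nu>" using ba by simp
      then show ?thesis using \<gamma>(1) g(2) by simp
    qed
    then obtain h where h: "h < supp_minus \<nu>" "stieltjes \<nu> h = g"
      using nu.stieltjes_attains_left[OF g(1)] by blast
    have "h < b"
    proof (rule ccontr)
      assume "\<not> h < b"
      then have "b < supp_minus \<nu>" "b \<le> h" using h(1) by auto
      then have "stieltjes \<nu> b \<le> g" using nu.stieltjes_less_iff[of h b] h by auto
      then show False using \<gamma>(1) g(2) \<open>b < supp_minus \<nu>\<close> by (simp add: stieltjes_left_def)
    qed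
    with h show ?thesis by blast
  qed
  have v: "v z < b" "stieltjes \<nu> (v z) = stieltjes \<rho> z" if z: "z < z0" for z
  proof -
    have "0 < stieltjes \<rho> z" "stieltjes \<rho> z < \<gamma>"
      using z z0 rho.stieltjes_pos[of z] rho.stieltjes_less_left[OF z z0(1)] by auto
    then obtain h where h: "h < b" "stieltjes \<nu> h = stieltjes \<rho> z" using attained by blast
    have "v z = h" unfolding v_def h(2)[symmetric]
      by (rule nu.stieltjes_inv_stieltjes) (use h ba in auto)
    with h show "v z < b" "stieltjes \<nu> (v z) = stieltjes \<rho> z" by auto
  qed
  have vd: "v z \<in> domF \<mu> \<nu>" "v z < supp_minus \<nu>" if "z < z0" for z
    using v(1)[OF that] domb ba by auto
  have w: "w z < supp_minus \<mu>" "stieltjes \<mu> (w z) = stieltjes \<rho> z" if z: "z < z0" for z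
  proof -
    have "ereal (stieltjes \<rho> z) < stieltjes_left \<mu> (supp_minus \<mu>)"
      using no_critical_below_edge[OF nc vd(1)[OF z]] v(2)[OF z] by simp
    then obtain u where u: "u < supp_minus \<mu>" "stieltjes \<mu> u = stieltjes \<rho> z"
      using mu.stieltjes_attains_left rho.stieltjes_pos[of z] z z0(1) by (metis less_trans)
    have "w z = u" unfolding w_def u(2)[symmetric]
      by (rule mu.stieltjes_inv_stieltjes) (use u in auto)
    with u show "w z < supp_minus \<mu>" "stieltjes \<mu> (w z) = stieltjes \<rho> z" by auto
  qed
  have Rw: "R_transform \<mu> (- stieltjes \<rho> z) = w z + 1 / stieltjes \<rho> z" if z: "z < z0" for z
    using mu.R_transform_stieltjes[OF w(1)[OF z]] w(2)[OF z] by simp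
  have Fv: "F \<mu> \<nu> (v z) = z" if z: "z < z0" for z
  proof -
    have "ereal (stieltjes \<nu> (v z)) < gstar \<rho>"
      using below_hstar_gstar v(1)[OF z] by (simp add: b_def)
    from below_gstar[OF vd(1)[OF z] this]
    have "F \<mu> \<nu> (v z) < supp_minus \<rho>" "stieltjes \<rho> (F \<mu> \<nu> (v z)) = stieltjes \<rho> z"
      using v(2)[OF z] by auto
    moreover have "z < supp_minus \<rho>" using z z0 by simp
    ultimately show ?thesis
      using rho.stieltjes_less_left[of z "F \<mu> \<nu> (v z)"] rho.stieltjes_less_left[of "F \<mu> \<nu> (v z)" z]
      by (cases "F \<mu> \<nu> (v z)" z rule: linorder_cases) auto
  qed
  \<comment> \<open>The equation F (v z) = z, with the R-transform of \<mu> written through w. Its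
    right hand side is analytic at z0 because \<open>stieltjes \<rho> z0\<close> = \<gamma> is
    nonzero.\<close>
  have wv: "w z + v z = z - 1 / stieltjes \<rho> z" if z: "z < z0" for z
    using Fv[OF z] Rw[OF z] v(2)[OF z] by (simp add: F_def)
  have G_an: "real_analytic_at (stieltjes \<rho>) z" if "z < supp_minus \<rho>" for z
    by (rule rho.real_analytic_stieltjes) (use that in auto)
  have an: "real_analytic_at w z" "real_analytic_at v z" if z: "z < z0" for z
  proof -
    have "real_analytic_at (stieltjes_inv \<mu>) (stieltjes \<mu> (w z))"
      by (rule mu.real_analytic_stieltjes_inv) (use w(1)[OF z] in auto)
    then show "real_analytic_at w z"
      unfolding w_def w(2)[OF z, unfolded w_def]
      using z z0 by (intro real_analytic_at_compose[of "stieltjes_inv \<mu>" "stieltjes \<rho>"] G_an) auto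
    have "real_analytic_at (stieltjes_inv \<nu>) (stieltjes \<nu> (v z))"
      by (rule nu.real_analytic_stieltjes_inv) (use vd(2)[OF z] in auto)
    then show "real_analytic_at v z"
      unfolding v_def v(2)[OF z, unfolded v_def]
      using z z0 by (intro real_analytic_at_compose[of "stieltjes_inv \<nu>" "stieltjes \<rho>"] G_an) auto
  qed
  have "real_analytic_at (\<lambda>z. 1 / stieltjes \<rho> z) z0"
    using z0 \<gamma>(2) by (intro real_analytic_at_divide real_analytic_at_const G_an) auto
  then have e: "real_analytic_at (\<lambda>z. z - 1 / stieltjes \<rho> z) z0"
    by (rule real_analytic_at_diff[OF real_analytic_at_ident])
  have nonneg: "\<exists>C D. (\<lambda>y. w (z + y)) has_fps_expansion C \<and> (\<lambda>y. v (z + y)) has_fps_expansion D \<and>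
        (\<forall>n\<ge>1. fps_nth C n \<ge> 0 \<and> fps_nth D n \<ge> 0)" if z: "z < z0" for z
  proof (rule subordination_nonneg)
    have ev: "eventually (\<lambda>y. y < z0) (nhds z)"
      using eventually_nhds_in_open[of "{..<z0}" z] z by auto
    then show "eventually (\<lambda>y. v y = y + (- 1 / stieltjes \<mu> (w y) - w y)) (nhds z)"
      by eventually_elim (use wv w(2) in \<open>fastforce simp: algebra_simps\<close>)
    show "eventually (\<lambda>y. w y = y + (- 1 / stieltjes \<nu> (v y) - v y)) (nhds z)"
      using ev by eventually_elim (use wv v(2) in \<open>fastforce simp: algebra_simps\<close>)
    show "deriv (F \<mu> \<nu>) (v z) > 0"
      using v(1)[OF z] by (intro below_hstar) (simp add: b_def)
  qed (use w v vd an z in auto)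
  \<comment> \<open>Nonnegative coefficients of w and v keep singularities at z0 from cancelling in
    the sum, so w itself continues.\<close>
  obtain W where W: "real_analytic_at W z0" "eventually (\<lambda>z. W z = w z) (at_left z0)"
    using analytic_extension_of_monotone_summand[OF e zero_less_one, of w v] wv nonneg by blast
  define K where "K = (\<lambda>t. R_transform \<rho> t + 1 / t)"
  have K: "K (- stieltjes \<rho> z) = z" if "z < supp_minus \<rho>" for z
    using that by (simp add: K_def rho.R_transform_stieltjes)
  have dom\<rho>: "- \<gamma> \<in> R_domain \<rho>" using rho.uminus_stieltjes_in_R_domain[OF z0(1)] z0(2) by simp
  have K\<gamma>: "K (- \<gamma>) = z0" using K[OF z0(1)] z0(2) by simp
  have anK: "real_analytic_at K (- \<gamma>)"
    unfolding K_def using rho.real_analytic_R_transform[OF dom\<rho>] \<gamma>(2)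
    by (intro real_analytic_at_add real_analytic_at_divide) auto
  obtain s where s: "s < z0" "\<And>z. s < z \<Longrightarrow> z < z0 \<Longrightarrow> W z = w z"
    using W(2) unfolding eventually_at_left_field by blast
  have near: "\<exists>z. s < z \<and> z < z0 \<and> stieltjes \<rho> z = - t" if t: "- \<gamma> < t" "t < - stieltjes \<rho> s" for t
  proof -
    have "{s..z0} \<inter> {supp_minus \<rho>..supp_plus \<rho>} = {}" using z0 by auto
    then obtain z where z: "s \<le> z" "z \<le> z0" "stieltjes \<rho> z = - t"
      using IVT'[of "stieltjes \<rho>" s "- t" z0] t z0 s(1) rho.continuous_on_stieltjes[of "{s..z0}"] by auto
    moreover have "z \<noteq> s" "z \<noteq> z0" using z(3) t z0 by auto
    ultimately show ?thesis by force
  qed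
  have dom\<mu>: "- \<gamma> \<in> R_domain \<mu>"
  proof (rule mu.R_domain_extend)
    \<comment> \<open>With t = - \<open>stieltjes \<rho> z\<close> and K t = z, the identity
      \<open>Rw\<close> reads R t = w (K t) - 1 / t; replacing w by W gives the continuation at -
      \<gamma>.\<close>
    have "real_analytic_at (\<lambda>t. W (K t)) (- \<gamma>)"
      by (rule real_analytic_at_compose[of W K]) (use W(1) anK K\<gamma> in auto)
    then show "real_analytic_at (\<lambda>t. W (K t) - 1 / t) (- \<gamma>)"
      using \<gamma>(2) by (intro real_analytic_at_diff real_analytic_at_divide) auto
    show "- \<gamma> < - stieltjes \<rho> s"
      using rho.stieltjes_less_left[OF s(1) z0(1)] z0(2) by simp
    fix t assume "- \<gamma> < t" "t < - stieltjes \<rho> s"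
    then obtain z where z: "s < z" "z < z0" "t = - stieltjes \<rho> z" using near by force
    then have "W (K t) = w z" using K[of z] z0 s(2) by simp
    moreover have "t \<in> R_domain \<mu>"
      using mu.uminus_stieltjes_in_R_domain[OF w(1)[OF z(2)]] w(2)[OF z(2)] z(3) by simp
    ultimately show "t \<in> R_domain \<mu> \<and> W (K t) - 1 / t = R_transform \<mu> t"
      using Rw[OF z(2)] z(3) by simp
  qed
  \<comment> \<open>With - \<gamma> in \<open>R_domain \<mu>\<close>, an endpoint b inside the
    half-line would belong to the open domain whose supremum it is.\<close>
  have b: "b = supp_minus \<nu>"
  proof (rule ccontr)
    assume "b \<noteq> supp_minus \<nu>"
    then have "b < supp_minus \<nu>" using ba by simp
    then have "b \<in> domF \<mu> \<nu>" using dom\<mu> \<gamma>(1) by (simp add: domF_def stieltjes_left_def)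
    then show False using domb by simp
  qed
  \<comment> \<open>Two of the three R-transforms continue to - \<gamma>, and their difference
    continues the third; this makes \<open>edge_critical\<close> applicable to \<nu>.\<close>
  have dom\<nu>: "- \<gamma> \<in> R_domain \<nu>"
  proof (rule nu.R_domain_extend)
    show "real_analytic_at (\<lambda>t. R_transform \<rho> t - R_transform \<mu> t) (- \<gamma>)"
      by (intro real_analytic_at_diff rho.real_analytic_R_transform mu.real_analytic_R_transform dom\<rho> dom\<mu>)
    show "- \<gamma> < 0" using \<gamma> by simp
    fix t assume t: "- \<gamma> < t" "t < 0"
    then obtain h where h: "h < b" "stieltjes \<nu> h = - t" using attained[of "- t"] by auto
    then have "t \<in> R_domain \<nu>" using nu.uminus_stieltjes_in_R_domain[of h] b by simp
    moreover have "t \<in> R_domain \<mu>"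
      using mu.R_domain_interval[OF dom\<mu> mu.zero_in_R_domain] t by simp
    ultimately show "t \<in> R_domain \<nu> \<and> R_transform \<rho> t - R_transform \<mu> t = R_transform \<nu> t"
      using R_transform_conv by simp
  qed
  have "deriv (R_transform \<nu>) (- \<gamma>) = 1 / \<gamma>\<^sup>2"
    using \<gamma>(1) b by (intro nu.edge_critical dom\<nu>) simp
  \<comment> \<open>The derivative for \<rho> is 1 / \<gamma>^2 - 1 /
    \<open>inverse_moment \<rho> 2 z0\<close>, and \<nu> takes away the whole of 1 /
    \<gamma>^2.\<close>
  then have "deriv (R_transform \<mu>) (- \<gamma>) = - 1 / inverse_moment \<rho> 2 z0"
    using deriv_R_transform_conv[OF dom\<mu> dom\<nu>] rho.deriv_R_transform_stieltjes[OF z0(1)] z0(2) by simp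
  then have neg: "deriv (R_transform \<mu>) (- \<gamma>) < 0"
    using rho.inverse_moment_pos[OF z0(1)] by simp
  have "((\<lambda>h. - stieltjes \<nu> h) \<longlongrightarrow> - \<gamma>) (at_left b)"
    using lim \<gamma>(1) by (intro tendsto_minus) simp
  then have "((\<lambda>h. deriv (R_transform \<mu>) (- stieltjes \<nu> h)) \<longlongrightarrow> deriv (R_transform \<mu>) (- \<gamma>)) (at_left b)"
    by (intro isCont_tendsto_compose[OF real_analytic_at_isCont[OF real_analytic_at_deriv]]
        mu.real_analytic_R_transform dom\<mu>)
  \<comment> \<open>To the left of b, \<open>stieltjes \<nu> h\<close> is a genuine value of
    \<open>stieltjes \<mu>\<close>, where \<open>deriv_R_transform_nonneg\<close> applies.\<close>
  moreover have "eventually (\<lambda>h. 0 \<le> deriv (R_transform \<mu>) (- stieltjes \<nu> h)) (at_left b)"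
  proof (intro eventually_at_leftI[of "b - 1"])
    fix h assume "h \<in> {b - 1<..<b}"
    then have "ereal (stieltjes \<nu> h) < stieltjes_left \<mu> (supp_minus \<mu>)" "0 < stieltjes \<nu> h"
      using no_critical_below_edge[OF nc] domb ba nu.stieltjes_pos by auto
    then obtain u where "u < supp_minus \<mu>" "stieltjes \<mu> u = stieltjes \<nu> h"
      using mu.stieltjes_attains_left by blast
    then show "0 \<le> deriv (R_transform \<mu>) (- stieltjes \<nu> h)"
      using mu.deriv_R_transform_nonneg by metis
  qed simp
  ultimately have "0 \<le> deriv (R_transform \<mu>) (- \<gamma>)"
    by (intro tendsto_lowerbound) auto
  with neg show False by simp
qed

text \<open>The meeting point of the two cases: from here on it no longer matters whether
  \<open>hstar\<close> is a critical point or the endpoint.\<close>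

lemma stieltjes_left_hstar: "stieltjes_left \<nu> (hstar \<mu> \<nu>) = gstar \<rho>"
proof (cases "\<exists>c. critical_point \<mu> \<nu> c")
  case True
  then have "hstar \<mu> \<nu> < supp_minus \<nu>"
    using hstar_critical(1)[OF True] domF_below by (auto simp: critical_point_def)
  then show ?thesis using critical_gstar[OF True] by (simp add: stieltjes_left_def)
qed (rule no_critical_gstar)

text \<open>To the left of the edge \<open>stieltjes \<rho> z\<close> is below
  \<open>gstar \<rho>\<close>, the limit of \<open>stieltjes \<nu>\<close> at \<open>hstar\<close>.
  So \<open>stieltjes \<nu>\<close> takes this value before \<open>hstar\<close>, and F returns z
  there.\<close>

lemma F_solution_exists:
  assumes z: "z < supp_minus \<rho>"
  obtains h where "h < hstar \<mu> \<nu>" "F \<mu> \<nu> h = z" "stieltjes \<nu> h = stieltjes \<rho> z"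
proof -
  let ?b = "hstar \<mu> \<nu>"
  have pos: "stieltjes \<rho> z > 0" by (rule rho.stieltjes_pos[OF z])
  have less: "ereal (stieltjes \<rho> z) < stieltjes_left \<nu> ?b"
    using rho.stieltjes_less_stieltjes_left[OF z] stieltjes_left_hstar gstar_eq by simp
  obtain h where h: "h < ?b" "stieltjes \<nu> h = stieltjes \<rho> z"
  proof (cases "?b < supp_minus \<nu>")
    case True
    then have l: "stieltjes \<rho> z < stieltjes \<nu> ?b" using less by (simp add: stieltjes_left_def)
    then have "ereal (stieltjes \<rho> z) < stieltjes_left \<nu> (supp_minus \<nu>)"
      using nu.stieltjes_less_stieltjes_left[OF True] by (meson ereal_less_eq(3) le_less_trans less_imp_le)
    then obtain h where h: "h < supp_minus \<nu>" "stieltjes \<nu> h = stieltjes \<rho> z"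
      using nu.stieltjes_attains_left[OF pos] by blast
    then have "h < ?b" using l nu.stieltjes_less_iff[OF h(1) True] by simp
    with h show ?thesis by (intro that)
  next
    case False
    then have "?b = supp_minus \<nu>" using hstar_le_supp by simp
    then show ?thesis using nu.stieltjes_attains_left[OF pos] less that by metis
  qed
  have F: "F \<mu> \<nu> h < supp_minus \<rho>" "stieltjes \<rho> (F \<mu> \<nu> h) = stieltjes \<rho> z"
    using below_gstar[OF below_hstar(1)[OF h(1)] below_hstar_gstar[OF h(1)]] h(2) by auto
  then have "F \<mu> \<nu> h = z"
    using rho.stieltjes_less_iff[OF F(1) z] rho.stieltjes_less_iff[OF z F(1)] by simp
  with h show ?thesis by (intro that)
qed

text \<open>F increases strictly up to \<open>hstar\<close>. Hence no point of the whole domain to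
  the left of h solves the equation, which identifies the \<open>LEAST\<close> over all of
  \<open>domF\<close>, and no second solution lies below \<open>hstar\<close>.\<close>

lemma F_solutions:
  shows F_solution_iff: "(\<exists>h \<in> domF \<mu> \<nu> \<inter> {..<hstar \<mu> \<nu>}. F \<mu> \<nu> h = z) \<longleftrightarrow> z < zstar \<rho>"
    and "z < zstar \<rho> \<Longrightarrow> hless \<mu> \<nu> z \<in> domF \<mu> \<nu> \<inter> {..<hstar \<mu> \<nu>} \<and> F \<mu> \<nu> (hless \<mu> \<nu> z) = z \<and>
                (\<forall>h \<in> domF \<mu> \<nu> \<inter> {..<hstar \<mu> \<nu>}. F \<mu> \<nu> h = z \<longrightarrow> h = hless \<mu> \<nu> z) \<and>
                stieltjes \<rho> z = stieltjes \<nu> (hless \<mu> \<nu> z)"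
proof -
  let ?b = "hstar \<mu> \<nu>"
  show "(\<exists>h \<in> domF \<mu> \<nu> \<inter> {..<?b}. F \<mu> \<nu> h = z) \<longleftrightarrow> z < zstar \<rho>"
    using below_gstar(1) below_hstar_gstar F_solution_exists below_hstar(1)
    unfolding zstar_def by (metis IntE IntI lessThan_iff)
  assume "z < zstar \<rho>"
  then obtain h where h: "h < ?b" "F \<mu> \<nu> h = z" "stieltjes \<nu> h = stieltjes \<rho> z"
    using F_solution_exists unfolding zstar_def by blast
  have hd: "h \<in> domF \<mu> \<nu>" by (rule below_hstar(1)[OF h(1)])
  have least: "h \<le> y" if "y \<in> domF \<mu> \<nu>" "F \<mu> \<nu> y = z" for y
  proof (rule ccontr)
    assume "\<not> h \<le> y"
    then have "F \<mu> \<nu> y < F \<mu> \<nu> h" using h(1) hd by (intro F_less) auto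
    then show False using that h(2) by simp
  qed
  have "(LEAST h. h \<in> domF \<mu> \<nu> \<and> F \<mu> \<nu> h = z) = h"
    using hd h(2) least by (intro Least_equality) auto
  then have eq: "hless \<mu> \<nu> z = h" using hd h(2) unfolding hless_def by auto
  have uniq: "y = h" if "y \<in> domF \<mu> \<nu> \<inter> {..<?b}" "F \<mu> \<nu> y = z" for y
  proof (rule ccontr)
    assume "y \<noteq> h"
    then have "h < y" using least[of y] that by simp
    then have "F \<mu> \<nu> h < F \<mu> \<nu> y" using that by (intro F_less) auto
    then show False using that h(2) by simp
  qed
  show "hless \<mu> \<nu> z \<in> domF \<mu> \<nu> \<inter> {..<?b} \<and> F \<mu> \<nu> (hless \<mu> \<nu> z) = z \<and>
      (\<forall>h \<in> domF \<mu> \<nu> \<inter> {..<?b}. F \<mu> \<nu> h = z \<longrightarrow> h = hless \<mu> \<nu> z) \<and>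
      stieltjes \<rho> z = stieltjes \<nu> (hless \<mu> \<nu> z)"
    unfolding eq
  proof (intro conjI ballI impI)
    show "h \<in> domF \<mu> \<nu> \<inter> {..<?b}" using h(1) hd by simp
    show "stieltjes \<rho> z = stieltjes \<nu> h" by (rule h(3)[symmetric])
  qed (fact h(2), rule uniq)
qed

text \<open>With a critical point, F is K composed with - \<open>stieltjes \<nu>\<close>, and
  \<open>edge_local_max\<close> bounds K near - g by the value that F attains at
  \<open>hstar\<close>. Without one, the right endpoint is even a global maximum.\<close>

lemma F_local_max_edge_growth:
  assumes c2: "c2 > 0"
    and growth: "\<And>\<epsilon>. 0 < \<epsilon> \<Longrightarrow> \<epsilon> < c2 \<Longrightarrow>
      measure \<rho> {supp_minus \<rho><..<supp_minus \<rho> + \<epsilon>} \<le> c1 * \<epsilon> powr (3/2)"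
  shows "F_local_max \<mu> \<nu> (hstar \<mu> \<nu>)"
proof (cases "\<exists>c. critical_point \<mu> \<nu> c")
  case False
  then have "F_global_max \<mu> \<nu> (hstar \<mu> \<nu>)" by (simp add: F_global_max_no_critical)
  then show ?thesis
    unfolding F_local_max_def F_global_max_def is_arg_max_def by (intro exI[of _ 1]) auto
next
  case cr: True
  define h where "h = hstar \<mu> \<nu>"
  define g where "g = stieltjes \<nu> h"
  have h: "h \<in> domF \<mu> \<nu>" using hstar_critical(1)[OF cr] by (simp add: critical_point_def h_def)
  have g: "gstar \<rho> = ereal g" using critical_gstar[OF cr] by (simp add: g_def h_def)
  have "- g \<in> R_domain \<rho>" using domF_R_domains(3)[OF h] by (simp add: g_def)
  from rho.edge_local_max[OF c2 growth g[unfolded gstar_eq] this]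
  have ev: "eventually (\<lambda>t. R_transform \<rho> t + 1 / t \<le> supp_minus \<rho>) (nhds (- g))" .
  have "isCont (stieltjes \<nu>) h"
    using domF_below[OF h] by (intro real_analytic_at_isCont nu.real_analytic_stieltjes) auto
  then have "((\<lambda>x. - stieltjes \<nu> x) \<longlongrightarrow> - g) (nhds h)"
    unfolding g_def by (intro tendsto_minus) (metis continuous_at tendsto_at_iff_tendsto_nhds)
  then have "eventually (\<lambda>x. R_transform \<rho> (- stieltjes \<nu> x) + 1 / (- stieltjes \<nu> x) \<le> supp_minus \<rho>) (nhds h)"
    using ev filterlim_iff by fastforce
  moreover have "eventually (\<lambda>x. x \<in> domF \<mu> \<nu>) (nhds h)"
    by (rule eventually_nhds_in_open[OF open_domF h])
  ultimately have "eventually (\<lambda>x. x \<in> domF \<mu> \<nu> \<and> F \<mu> \<nu> x \<le> supp_minus \<rho>) (nhds h)"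
    by eventually_elim (simp add: F_eq_R_transform_conv)
  then obtain e where e: "e > 0" "\<And>x. \<bar>x - h\<bar> < e \<Longrightarrow> x \<in> domF \<mu> \<nu> \<and> F \<mu> \<nu> x \<le> supp_minus \<rho>"
    unfolding eventually_nhds_metric by (auto simp: dist_norm)
  have "F \<mu> \<nu> h = supp_minus \<rho>" using at_gstar(2)[OF h] g by (simp add: g_def)
  then have "is_arg_max (F_ext \<mu> \<nu>) (\<lambda>x. x \<in> domF_ext \<mu> \<nu> \<and> \<bar>x - h\<bar> < e) h"
    unfolding is_arg_max_def using h e by (force simp: domF_ext_def F_ext_def)
  then show ?thesis
    unfolding F_local_max_def h_def[symmetric] using e(1) by blast
qed

text \<open>Every real below the edge is a value of F by \<open>F_solution_exists\<close>, so the
  supremum is never smaller than the edge.\<close>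

lemma zstar_eq_SUP:
  assumes le: "\<And>h. h \<in> domF \<mu> \<nu> \<Longrightarrow> F \<mu> \<nu> h \<le> supp_minus \<rho>"
  shows "ereal (zstar \<rho>) = (SUP h \<in> domF \<mu> \<nu>. ereal (F \<mu> \<nu> h))"
proof (rule SUP_eqI[symmetric])
  show "ereal (F \<mu> \<nu> h) \<le> ereal (zstar \<rho>)" if "h \<in> domF \<mu> \<nu>" for h
    using le[OF that] by (simp add: zstar_def)
  fix y assume y: "\<And>h. h \<in> domF \<mu> \<nu> \<Longrightarrow> ereal (F \<mu> \<nu> h) \<le> y"
  show "ereal (zstar \<rho>) \<le> y"
  proof (rule ccontr)
    assume "\<not> ?thesis"
    then obtain z where z: "y < ereal z" "ereal z < ereal (supp_minus \<rho>)"
      using ereal_dense2[of y "ereal (zstar \<rho>)"] by (auto simp: zstar_def not_le)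
    then obtain h where "h < hstar \<mu> \<nu>" "F \<mu> \<nu> h = z" using F_solution_exists[of z] by auto
    then show False using y[of h] below_hstar(1) z(1) by auto
  qed
qed

lemma concave_edge:
  assumes sc: "strictly_concave_on (domF \<mu> \<nu>) (F \<mu> \<nu>)"
  shows "ereal (zstar \<rho>) = (SUP h \<in> domF \<mu> \<nu>. ereal (F \<mu> \<nu> h))"
    and "gstar \<rho> = stieltjes_left \<nu> (F_argsup \<mu> \<nu>)"
proof -
  show "ereal (zstar \<rho>) = (SUP h \<in> domF \<mu> \<nu>. ereal (F \<mu> \<nu> h))"
  proof (rule zstar_eq_SUP)
    fix h assume h: "h \<in> domF \<mu> \<nu>"
    show "F \<mu> \<nu> h \<le> supp_minus \<rho>"
    proof (cases "\<exists>c. critical_point \<mu> \<nu> c")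
      case True
      have "F \<mu> \<nu> h \<le> F \<mu> \<nu> (hstar \<mu> \<nu>)"
        using F_le_hstar_concave[OF sc True h] by (cases "h = hstar \<mu> \<nu>") auto
      also have "\<dots> = supp_minus \<rho>"
        using hstar_critical(1)[OF True] critical_gstar[OF True]
        by (intro at_gstar(2)) (auto simp: critical_point_def)
      finally show ?thesis .
    next
      case False
      then have "h < hstar \<mu> \<nu>" using h domF_eq hstar_no_critical by auto
      then show ?thesis using below_gstar(1)[OF h below_hstar_gstar] by simp
    qed
  qed
  have "F_argsup \<mu> \<nu> = hstar \<mu> \<nu>"
    unfolding F_argsup_def F_global_max_concave[OF sc] by simp
  then show "gstar \<rho> = stieltjes_left \<nu> (F_argsup \<mu> \<nu>)"
    using stieltjes_left_hstar by simp
qed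

end

text \<open>Assertions about the convolution are made for every \<rho> that satisfies
  \<open>is_free_convolution\<close>, without a choice operator. The supremum in the concave case is
  taken in \<open>ereal\<close>, where it exists unconditionally, and the uniqueness of the global
  maximum gives meaning to \<open>F_argsup\<close>.\<close>

theorem proposition1p4:
  fixes \<mu> \<nu> :: "real measure"
  assumes "compactly_supported_prob \<mu>" and "compactly_supported_prob \<nu>"
    and "non_degenerate \<mu>"
  shows
    "((\<exists>c. critical_point \<mu> \<nu> c) \<longrightarrow>
        critical_point \<mu> \<nu> (hstar \<mu> \<nu>) \<and> (\<forall>c. critical_point \<mu> \<nu> c \<longrightarrow> hstar \<mu> \<nu> \<le> c)) \<and>
     (\<not> (\<exists>c. critical_point \<mu> \<nu> c) \<longrightarrow>
        hstar \<mu> \<nu> = Sup (domF \<mu> \<nu>)) \<and>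
     (\<not> (\<exists>c. critical_point \<mu> \<nu> c) \<longrightarrow>
        (\<forall>\<rho>. is_free_convolution \<mu> \<nu> \<rho> \<longrightarrow>
          (hstar \<mu> \<nu> = supp_minus \<nu> \<and> gstar \<rho> = stieltjes_left \<nu> (supp_minus \<nu>)) \<or>
          (stieltjes_left \<mu> (supp_minus \<mu>) = stieltjes_left \<nu> (hstar \<mu> \<nu>) \<and>
           stieltjes_left \<nu> (hstar \<mu> \<nu>) = gstar \<rho>))) \<and>
     (\<forall>\<rho>. is_free_convolution \<mu> \<nu> \<rho> \<longrightarrow>
        (\<exists>c1>0. \<exists>c2>0. \<forall>\<epsilon>\<in>{0<..<c2}.
           inverse c1 * \<epsilon> powr (3/2) \<le> measure \<rho> {zstar \<rho> <..< zstar \<rho> + \<epsilon>} \<and>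
           measure \<rho> {zstar \<rho> <..< zstar \<rho> + \<epsilon>} \<le> c1 * \<epsilon> powr (3/2)) \<longrightarrow>
        F_local_max \<mu> \<nu> (hstar \<mu> \<nu>)) \<and>
     (strictly_concave_on (domF \<mu> \<nu>) (F \<mu> \<nu>) \<longrightarrow>
        F_global_max \<mu> \<nu> (hstar \<mu> \<nu>) \<and>
        (\<forall>h. F_global_max \<mu> \<nu> h \<longrightarrow> h = hstar \<mu> \<nu>) \<and>
        (\<forall>\<rho>. is_free_convolution \<mu> \<nu> \<rho> \<longrightarrow>
           ereal (zstar \<rho>) = (SUP h \<in> domF \<mu> \<nu>. ereal (F \<mu> \<nu> h)) \<and>
           gstar \<rho> = stieltjes_left \<nu> (F_argsup \<mu> \<nu>))) \<and>
     (\<forall>\<rho>. is_free_convolution \<mu> \<nu> \<rho> \<longrightarrow>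
        (\<forall>z. ((\<exists>h \<in> domF \<mu> \<nu> \<inter> {..<hstar \<mu> \<nu>}. F \<mu> \<nu> h = z) \<longleftrightarrow> z < zstar \<rho>) \<and>
             (z < zstar \<rho> \<longrightarrow>
                hless \<mu> \<nu> z \<in> domF \<mu> \<nu> \<inter> {..<hstar \<mu> \<nu>} \<and> F \<mu> \<nu> (hless \<mu> \<nu> z) = z \<and>
                (\<forall>h \<in> domF \<mu> \<nu> \<inter> {..<hstar \<mu> \<nu>}. F \<mu> \<nu> h = z \<longrightarrow> h = hless \<mu> \<nu> z) \<and>
                stieltjes \<rho> z = stieltjes \<nu> (hless \<mu> \<nu> z))))"
proof -
  interpret compact_pair \<mu> \<nu>
    using assms by (simp add: compact_pair_def compact_prob_iff)
  have conv: "free_conv \<mu> \<nu> \<rho>" if "is_free_convolution \<mu> \<nu> \<rho>" for \<rho>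
    using that compact_pair_axioms
    by (auto simp: is_free_convolution_def free_conv_def free_conv_axioms_def compact_prob_iff)
  show ?thesis
  proof (intro conjI impI allI)
    show "critical_point \<mu> \<nu> (hstar \<mu> \<nu>)" if "\<exists>c. critical_point \<mu> \<nu> c"
      by (rule hstar_critical(1)[OF that])
    show "hstar \<mu> \<nu> \<le> c" if "\<exists>c. critical_point \<mu> \<nu> c" "critical_point \<mu> \<nu> c" for c
      by (rule hstar_critical(2)[OF that])
    show "hstar \<mu> \<nu> = Sup (domF \<mu> \<nu>)" if "\<not> (\<exists>c. critical_point \<mu> \<nu> c)"
      by (rule hstar_no_critical[OF that])
    show "(hstar \<mu> \<nu> = supp_minus \<nu> \<and> gstar \<rho> = stieltjes_left \<nu> (supp_minus \<nu>)) \<or>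
        (stieltjes_left \<mu> (supp_minus \<mu>) = stieltjes_left \<nu> (hstar \<mu> \<nu>) \<and>
         stieltjes_left \<nu> (hstar \<mu> \<nu>) = gstar \<rho>)"
      if "\<not> (\<exists>c. critical_point \<mu> \<nu> c)" "is_free_convolution \<mu> \<nu> \<rho>" for \<rho>
      using free_conv.stieltjes_left_hstar[OF conv[OF that(2)]] no_critical_hstar_inside[OF that(1)]
      by metis
    show "F_local_max \<mu> \<nu> (hstar \<mu> \<nu>)"
      if \<rho>: "is_free_convolution \<mu> \<nu> \<rho>"
        and growth: "\<exists>c1>0. \<exists>c2>0. \<forall>\<epsilon>\<in>{0<..<c2}.
           inverse c1 * \<epsilon> powr (3/2) \<le> measure \<rho> {zstar \<rho> <..< zstar \<rho> + \<epsilon>} \<and>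
           measure \<rho> {zstar \<rho> <..< zstar \<rho> + \<epsilon>} \<le> c1 * \<epsilon> powr (3/2)" for \<rho>
    proof -
      obtain c1 c2 where c: "c2 > 0" "\<forall>\<epsilon>\<in>{0<..<c2}.
          measure \<rho> {supp_minus \<rho> <..< supp_minus \<rho> + \<epsilon>} \<le> c1 * \<epsilon> powr (3/2)"
        using growth unfolding zstar_def by blast
      show ?thesis
        by (rule free_conv.F_local_max_edge_growth[OF conv[OF \<rho>] c(1), of c1]) (use c(2) in auto)
    qed
    show "F_global_max \<mu> \<nu> (hstar \<mu> \<nu>)" if "strictly_concave_on (domF \<mu> \<nu>) (F \<mu> \<nu>)"
      using F_global_max_concave[OF that] by simp
    show "h = hstar \<mu> \<nu>" if "strictly_concave_on (domF \<mu> \<nu>) (F \<mu> \<nu>)" "F_global_max \<mu> \<nu> h" for h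
      using F_global_max_concave[OF that(1)] that(2) by simp
    show "ereal (zstar \<rho>) = (SUP h \<in> domF \<mu> \<nu>. ereal (F \<mu> \<nu> h))"
      and "gstar \<rho> = stieltjes_left \<nu> (F_argsup \<mu> \<nu>)"
      if "strictly_concave_on (domF \<mu> \<nu>) (F \<mu> \<nu>)" "is_free_convolution \<mu> \<nu> \<rho>" for \<rho>
      by (rule free_conv.concave_edge[OF conv[OF that(2)] that(1)])+
    show "(\<exists>h \<in> domF \<mu> \<nu> \<inter> {..<hstar \<mu> \<nu>}. F \<mu> \<nu> h = z) \<longleftrightarrow> z < zstar \<rho>"
      if "is_free_convolution \<mu> \<nu> \<rho>" for \<rho> z
      by (rule free_conv.F_solution_iff[OF conv[OF that]])
    note solutions = free_conv.F_solutions(2)[OF conv]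
    show "hless \<mu> \<nu> z \<in> domF \<mu> \<nu> \<inter> {..<hstar \<mu> \<nu>}" "F \<mu> \<nu> (hless \<mu> \<nu> z) = z"
      "stieltjes \<rho> z = stieltjes \<nu> (hless \<mu> \<nu> z)"
      if "is_free_convolution \<mu> \<nu> \<rho>" "z < zstar \<rho>" for \<rho> z
      using solutions[OF that] by blast+
    show "\<forall>h \<in> domF \<mu> \<nu> \<inter> {..<hstar \<mu> \<nu>}. F \<mu> \<nu> h = z \<longrightarrow> h = hless \<mu> \<nu> z"
      if "is_free_convolution \<mu> \<nu> \<rho>" "z < zstar \<rho>" for \<rho> z
      using solutions[OF that] by blast
  qed
qed

end
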